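(* Let $\Omega\subset\mathbb R^n$, $n\ge3$, be a bounded domain with $\partial\Omega=\Gamma_1\cup\{0\}\cup\Gamma_2$, $\overline{\Gamma_1}\cap\overline{\Gamma_2}=\{0\}$, and let $\mathcal L$, $\Gamma_2$, $\ell$, $s\ge e_1-2$ satisfy the standing assumptions in the context. Let $u$ be sub-elliptic in $\Omega$, $u>0$ in $\Omega$. Suppose that $u\le0$ on $\Gamma_1$ and $\frac{\partial u}{\partial\ell}\le0$ on $\Gamma_2$. Let $\Omega$ be admissible in the layer $U_R$. Then there is a constant $\eta>0$, depending only on $s$, the ellipticity constant $e_1$, the Lipschitz constant $L$, the vector field $\ell$, the constants $\theta,\varkappa,\delta$ in the definition of admissibility and the number $N$ of balls in the set $\mathcal B$, such that $\eta\,\mathbf C_s(H)R^{-s}<1$ and $$\sup_{\Omega}u\ \ge\ \frac{\sup_{S_R}u}{1-\eta\,\mathbf C_s(H)R^{-s}},$$ where $H=\Gamma_1\cap\hat U_R$ and $S_R=\partial B(0,q^*R)\cap\Omega$.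
   Context: Notation: $x=(x',x_n)$; $B(x,R)$ is the ball of radius $R$ centered at $x$. Operator: $\mathcal Lu=-\sum_{i,j=1}^na_{ij}(x)D_iD_ju$ in $\Omega$, with $(a_{ij})$ bounded, measurable, symmetric and $e_1:=\max_{|\xi|=1}\sup_{x\in\Omega}\frac{\sum_ia_{ii}(x)}{\sum_{i,j}a_{ij}(x)\xi_i\xi_j}<\infty$. A function $u$ is sub-elliptic in $\Omega$ if $u\in W^2_n(\Omega)\cap\mathcal C^1(\Omega\cup\Gamma_2)$ and $\mathcal Lu\le0$ in $\Omega$. Functions are assumed continuous on $\Omega\cup\Gamma_1\cup\Gamma_2$; they need not be defined at $0$. Neumann boundary: for some $r_0>0$, $\Gamma_2\cap B(0,r_0)$ is contained in the graph $x_n=f(x')$ of a Lipschitz function $f$ with Lipschitz constant at most $L$, and $\Omega\cap B(0,r_0)\subset\{x_n<f(x')\}$. $\ell$ is a measurable outward unit vector field on $\Gamma_2$, and there is $\varepsilon>0$ such that the angle between $\ell(x)$ and the positive $x_n$-direction is at most $\cot^{-1}(L)-\varepsilon$ for all $x\in\Gamma_2$. $\frac{\partial u}{\partial\ell}(x):=\lim_{t\to+0}\frac{u(x)-u(x-t\ell)}{t}$. $R$ is small enough that $U_R$ and all balls $B(\xi_k,(a+2)\theta R)$ appearing below lie in $B(0,r_0)$. Capacity: for a Borel set $H$, $\mathcal M(H)$ is the set of measures $\mu$ on Borel subsets of $H$ with $\int_H\frac{d\mu(y)}{|x-y|^s}\le1$ for all $x\in\mathbb R^n\setminus H$, and $\mathbf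 C_s(H)=\sup_{\mu\in\mathcal M(H)}\mu(H)$. Here $s\ge e_1-2$ is fixed. The constant $a$: $a=a(L,\varepsilon,e_1)>1$ is a fixed constant with the following growth property near the Neumann boundary. Let $D$ be a bounded domain with $\partial D=\Gamma_1'\cup\Gamma_2'$, on which an operator with ellipticity constant at most $e_1$ is given; let $x^0\in\Gamma_2'\cap\partial B(z,r)$, where $\Gamma_2'\cap B(z,r)=\emptyset$, $r\le\delta_0/2$, $\Gamma_2'\cap B(x^0,\delta_0)$ is a Lipschitz graph $x_n=g(x')$ with constant at most $L$, $D\cap B(x^0,\delta_0)\subset\{x_n<g(x')\}$, and let the oblique field on $\Gamma_2'$ make an angle at most $\cot^{-1}(L)-\varepsilon$ with the positive $x_n$-direction; let $D\cap B(z,\alpha r)=\emptyset$ for some $0<\alpha<\frac12$. Then every sub-elliptic function $v>0$ in $D$ with $v=0$ on $\Gamma_1'$ and $\frac{\partial v}{\partial\ell}\le0$ on $\Gamma_2'$ satisfies $\sup_{D\cap B(z,ar)}v\ge(1-\eta_2)^{-1}\sup_{D\cap B(z,r)}v$ with some $\eta_2\in(0,1)$ determined by $\alpha$ and $a$ (for fixed $s$). Admissible domains: fix constants $0<q_1<q_2<q^*<q_3<q_4$ and set $U_R=B(0,q_4R)\setminus B(0,q_1R)$, $\hat U_R=B(0,q_3R)\setminus B(0,q_2R)$. $\Omega$ is called admissible in the layer $U_R$ if for some $\theta>0$ there is a finite set of balls $\mathcal B=\{B^k=B(\xi_k,\theta R)\}_{k=0}^N$, $B^k\subset\hat U_R$,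 such that: 1. $\mathbf C_s(B^0\cap\Gamma_1)\ge\varkappa\,\mathbf C_s(\Gamma_1\cap\hat U_R)$ for some constant $\varkappa>0$. 2. $B^k\cap\Gamma_2=\emptyset$ for $k=1,\dots,N$, and $B(\xi_0,a\theta R)\cap\Gamma_2=\emptyset$ (the boundaries of some balls $B^k$ may touch $\Gamma_2$). 3. There is $\delta\in(0,1/2)$ such that every ball in $\mathcal B$ can be connected with $B^0$ by a subsequence of balls $B^j$ of $\mathcal B$ (relabelled consecutively, starting at $B^0$) such that any intersection $B^j\cap B^{j+1}\cap\Omega$ of consecutive balls contains the ball $B(\xi_{j+1},\delta R)$. 4. The set $S_R=\partial B(0,q^*R)\cap\Omega$ is covered by the balls in $\mathcal B$. *)

theory Defs
  imports "HOL-Analysis.Analysis"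
begin

definition bounded_domain :: "(real^'n) set \<Rightarrow> bool" where
  "bounded_domain \<Omega> \<longleftrightarrow> open \<Omega> \<and> connected \<Omega> \<and> \<Omega> \<noteq> {} \<and> bounded \<Omega>"

(* x' for x = (x', x_n): the coordinate "x_n" is the one with index k, and R^(n-1) is identified
   with the hyperplane {y. y $ k = 0}. *)
definition horiz :: "'n \<Rightarrow> real^'n \<Rightarrow> real^'n" where
  "horiz k x = (\<chi> i. if i = k then 0 else x $ i)"

definition arccot :: "real \<Rightarrow> real" where
  "arccot t = pi / 2 - arctan t"

definition vec_angle :: "real^'n \<Rightarrow> real^'n \<Rightarrow> real" where
  "vec_angle v w = arccos ((v \<bullet> w) / (norm v * norm w))"

(* C^1(S \<union> T) for open S with T \<subseteq> frontier S: u and its gradient, taken in S,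
   extend continuously to S \<union> T. *)
definition C1_upto :: "(real^'n) set \<Rightarrow> (real^'n) set \<Rightarrow> (real^'n \<Rightarrow> real) \<Rightarrow> bool" where
  "C1_upto S T u \<longleftrightarrow> continuous_on (S \<union> T) u \<and>
     (\<exists>G. continuous_on (S \<union> T) G \<and> (\<forall>x\<in>S. GDERIV u x :> G x))"

definition Lp_on :: "(real^'n) set \<Rightarrow> real \<Rightarrow> (real^'n \<Rightarrow> real) \<Rightarrow> bool" where
  "Lp_on \<Omega> p f \<longleftrightarrow> set_borel_measurable lebesgue \<Omega> f \<and>
     set_integrable lebesgue \<Omega> (\<lambda>x. \<bar>f x\<bar> powr p)"

(* g is the weak derivative D_i u in \<Omega>, tested against compactly supported C^1 functions phi
   with gradient dphi.  Only used for u and g in L^p with p \<ge> 1, so both integrals converge. *)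
definition weak_partial ::
  "(real^'n) set \<Rightarrow> 'n \<Rightarrow> (real^'n \<Rightarrow> real) \<Rightarrow> (real^'n \<Rightarrow> real) \<Rightarrow> bool" where
  "weak_partial \<Omega> i u g \<longleftrightarrow>
     (\<forall>phi dphi K. (\<forall>x. GDERIV phi x :> dphi x) \<longrightarrow> continuous_on UNIV dphi \<longrightarrow>
        compact K \<longrightarrow> K \<subseteq> \<Omega> \<longrightarrow> (\<forall>x. x \<notin> K \<longrightarrow> phi x = 0) \<longrightarrow>
        (LINT x:\<Omega>|lebesgue. u x * dphi x $ i) = - (LINT x:\<Omega>|lebesgue. g x * phi x))"

(* u \<in> W^2_p(\<Omega>), with D2 i j a version of the weak derivative D_i D_j u *)
definition W2_with ::
  "(real^'n) set \<Rightarrow> real \<Rightarrow> (real^'n \<Rightarrow> real) \<Rightarrow> ('n \<Rightarrow> 'n \<Rightarrow> real^'n \<Rightarrow> real) \<Rightarrow> bool" where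
  "W2_with \<Omega> p u D2 \<longleftrightarrow> Lp_on \<Omega> p u \<and>
     (\<exists>D1. (\<forall>j. Lp_on \<Omega> p (D1 j) \<and> weak_partial \<Omega> j u (D1 j)) \<and>
           (\<forall>i j. Lp_on \<Omega> p (D2 i j) \<and> weak_partial \<Omega> i (D1 j) (D2 i j)))"

definition ellipticity_const :: "(real^'n) set \<Rightarrow> (real^'n \<Rightarrow> real^'n^'n) \<Rightarrow> ereal" where
  "ellipticity_const \<Omega> A =
     (SUP \<xi>\<in>sphere 0 1. SUP x\<in>\<Omega>. ereal (trace (A x) / (\<xi> \<bullet> (A x *v \<xi>))))"

(* Pointwise positivity of the quadratic form is implicit in the finiteness of the ellipticity
   constant on paper; here it must be stated because x / 0 = 0. *)
definition elliptic_coeffs :: "(real^'n) set \<Rightarrow> (real^'n \<Rightarrow> real^'n^'n) \<Rightarrow> bool" where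
  "elliptic_coeffs \<Omega> A \<longleftrightarrow>
     A \<in> borel_measurable (lebesgue_on \<Omega>) \<and> bounded (A ` \<Omega>) \<and>
     (\<forall>x\<in>\<Omega>. transpose (A x) = A x \<and> (\<forall>\<xi>. \<xi> \<noteq> 0 \<longrightarrow> \<xi> \<bullet> (A x *v \<xi>) > 0)) \<and>
     ellipticity_const \<Omega> A < \<infinity>"

definition sub_elliptic ::
  "(real^'n) set \<Rightarrow> (real^'n) set \<Rightarrow> (real^'n \<Rightarrow> real^'n^'n) \<Rightarrow> (real^'n \<Rightarrow> real) \<Rightarrow> bool" where
  "sub_elliptic \<Omega> \<Gamma>2 A u \<longleftrightarrow> C1_upto \<Omega> \<Gamma>2 u \<and>
     (\<exists>D2. W2_with \<Omega> (real CARD('n)) u D2 \<and>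
        (AE x in lebesgue. x \<in> \<Omega> \<longrightarrow> - (\<Sum>i\<in>UNIV. \<Sum>j\<in>UNIV. A x $ i $ j * D2 i j x) \<le> 0))"

(* Measurable outward unit field l on \<Gamma>2 making an angle at most arccot L - \<epsilon> with the positive
   x_n-direction.  "Outward" means that x - t l(x) lies in \<Omega> for small t > 0, as is needed for the
   one-sided derivative along l. *)
definition oblique_field ::
  "'n \<Rightarrow> real \<Rightarrow> real \<Rightarrow> (real^'n) set \<Rightarrow> (real^'n) set \<Rightarrow> (real^'n \<Rightarrow> real^'n) \<Rightarrow> bool" where
  "oblique_field k L \<epsilon> \<Omega> \<Gamma>2 l \<longleftrightarrow>
     l \<in> borel_measurable (restrict_space borel \<Gamma>2) \<and>
     (\<forall>x\<in>\<Gamma>2. norm (l x) = 1 \<and> (\<forall>\<^sub>F t in at_right 0. x - t *\<^sub>R l x \<in> \<Omega>) \<and>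
        vec_angle (l x) (axis k 1) \<le> arccot L - \<epsilon>)"

definition has_oblique_deriv ::
  "(real^'n \<Rightarrow> real) \<Rightarrow> (real^'n \<Rightarrow> real^'n) \<Rightarrow> real^'n \<Rightarrow> real \<Rightarrow> bool" where
  "has_oblique_deriv u l x d \<longleftrightarrow>
     ((\<lambda>t. (u x - u (x - t *\<^sub>R l x)) / t) \<longlongrightarrow> d) (at_right 0)"

definition oblique_deriv_le_0 ::
  "(real^'n) set \<Rightarrow> (real^'n \<Rightarrow> real^'n) \<Rightarrow> (real^'n \<Rightarrow> real) \<Rightarrow> bool" where
  "oblique_deriv_le_0 \<Gamma>2 l u \<longleftrightarrow> (\<forall>x\<in>\<Gamma>2. \<exists>d\<le>0. has_oblique_deriv u l x d)"

(* C_s(H), for Borel sets H; a measure on the Borel subsets of H has restrict_space borel H as its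
   measurable space. *)
definition capacity_measures :: "real \<Rightarrow> (real^'n) set \<Rightarrow> (real^'n) measure set" where
  "capacity_measures s H = {\<mu>. sets \<mu> = sets (restrict_space borel H) \<and>
     (\<forall>x. x \<notin> H \<longrightarrow> (\<integral>\<^sup>+ y. ennreal (1 / norm (x - y) powr s) \<partial>\<mu>) \<le> 1)}"

definition capacity :: "real \<Rightarrow> (real^'n) set \<Rightarrow> ennreal" where
  "capacity s H = (SUP \<mu>\<in>capacity_measures s H. emeasure \<mu> H)"

(* The growth property near the oblique boundary which the constant a is required to have.
   Suprema are taken in ereal. *)
definition oblique_growth_const :: "'n::finite \<Rightarrow> real \<Rightarrow> real \<Rightarrow> real \<Rightarrow> real \<Rightarrow> bool" where
  "oblique_growth_const k L \<epsilon> e1 a \<longleftrightarrow>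
    (\<forall>\<alpha>. 0 < \<alpha> \<and> \<alpha> < 1/2 \<longrightarrow>
      (\<exists>\<eta>2. 0 < \<eta>2 \<and> \<eta>2 < 1 \<and>
        (\<forall>(D :: (real^'n) set) \<Gamma>1 \<Gamma>2 A l z r x0 \<delta>0 g v.
           bounded_domain D \<longrightarrow> frontier D = \<Gamma>1 \<union> \<Gamma>2 \<longrightarrow>
           elliptic_coeffs D A \<longrightarrow> ellipticity_const D A \<le> ereal e1 \<longrightarrow>
           0 < r \<longrightarrow> r \<le> \<delta>0 / 2 \<longrightarrow>
           x0 \<in> \<Gamma>2 \<inter> sphere z r \<longrightarrow> \<Gamma>2 \<inter> ball z r = {} \<longrightarrow>
           L-lipschitz_on {y. y $ k = 0} g \<longrightarrow>
           \<Gamma>2 \<inter> ball x0 \<delta>0 = {x \<in> ball x0 \<delta>0. x $ k = g (horiz k x)} \<longrightarrow>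
           D \<inter> ball x0 \<delta>0 \<subseteq> {x. x $ k < g (horiz k x)} \<longrightarrow>
           oblique_field k L \<epsilon> D \<Gamma>2 l \<longrightarrow>
           D \<inter> ball z (\<alpha> * r) = {} \<longrightarrow>
           sub_elliptic D \<Gamma>2 A v \<longrightarrow> continuous_on (D \<union> \<Gamma>1 \<union> \<Gamma>2) v \<longrightarrow>
           (\<forall>x\<in>D. v x > 0) \<longrightarrow> (\<forall>x\<in>\<Gamma>1. v x = 0) \<longrightarrow> oblique_deriv_le_0 \<Gamma>2 l v \<longrightarrow>
           (SUP x\<in>D \<inter> ball z (a * r). ereal (v x))
             \<ge> ereal (inverse (1 - \<eta>2)) * (SUP x\<in>D \<inter> ball z r. ereal (v x)))))"

definition layer :: "real \<Rightarrow> real \<Rightarrow> real \<Rightarrow> (real^'n) set" where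
  "layer p q R = ball 0 (q * R) - ball 0 (p * R)"

(* Admissibility in the layer, with the constants \<theta>, \<kappa>, \<delta> and the balls B^j = B(\<xi> j, \<theta> R), j \<le> N,
   as parameters.  In the third condition p lists the indices of the balls joining B^0 to B^j. *)
definition admissible_with ::
  "real \<Rightarrow> real \<Rightarrow> real \<Rightarrow> real \<Rightarrow> real \<Rightarrow> real \<Rightarrow> real \<Rightarrow> real \<Rightarrow> nat \<Rightarrow> (nat \<Rightarrow> real^'n) \<Rightarrow>
   (real^'n) set \<Rightarrow> (real^'n) set \<Rightarrow> (real^'n) set \<Rightarrow> real \<Rightarrow> bool" where
  "admissible_with s a q2 qs q3 \<theta> \<kappa> \<delta> N \<xi> \<Omega> \<Gamma>1 \<Gamma>2 R \<longleftrightarrow>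
     (\<forall>j\<le>N. ball (\<xi> j) (\<theta> * R) \<subseteq> layer q2 q3 R) \<and>
     capacity s (ball (\<xi> 0) (\<theta> * R) \<inter> \<Gamma>1) \<ge> ennreal \<kappa> * capacity s (\<Gamma>1 \<inter> layer q2 q3 R) \<and>
     (\<forall>j\<in>{1..N}. ball (\<xi> j) (\<theta> * R) \<inter> \<Gamma>2 = {}) \<and>
     ball (\<xi> 0) (a * \<theta> * R) \<inter> \<Gamma>2 = {} \<and>
     (\<forall>j\<le>N. \<exists>m p. p (0::nat) = 0 \<and> p m = j \<and> (\<forall>i\<le>m. p i \<le> N) \<and>
        (\<forall>i<m. ball (\<xi> (p (Suc i))) (\<delta> * R) \<subseteq>
           ball (\<xi> (p i)) (\<theta> * R) \<inter> ball (\<xi> (p (Suc i))) (\<theta> * R) \<inter> \<Omega>)) \<and>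
     frontier (ball 0 (qs * R)) \<inter> \<Omega> \<subseteq> (\<Union>j\<le>N. ball (\<xi> j) (\<theta> * R))"

end

theory Submission
  imports Defs
begin

text \<open>The proof rests on a maximum principle: a subsolution in \<open>W\<^sup>2\<^sub>n\<close> cannot be touched from above by a
  strict \<open>C\<^sup>2\<close> supersolution, neither in the interior (Alexandrov-Bakelman-Pucci) nor at a point of
  \<open>\<Gamma>\<^sub>2\<close> at which the supersolution increases strictly along the oblique field. Let \<open>M\<close> be the supremum
  of \<open>u\<close>. Comparison with Riesz potentials of order \<open>s \<ge> e\<^sub>1 - 2\<close> shows that \<open>M - u\<close> is at least a
  multiple of \<open>M C\<^sub>s(H) R\<^sup>-\<^sup>s\<close> in the ball \<open>B\<^sup>0\<close>. Comparison with \<open>|x - z|\<close> to the power \<open>- e\<^sub>1\<close> carries a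
  lower bound for \<open>M - u\<close> from a smaller ball about \<open>z\<close> to a larger one, up to a constant factor. This remains
  true when the larger ball touches \<open>\<Gamma>\<^sub>2\<close>: a ball lying below the Lipschitz graph misses the
  cone of directions above each point \<open>y\<close> of the graph, so if \<open>y\<close> is close to the ball, the angle condition
  gives \<open>(y - z) \<bullet> l(y) > 0\<close>. Iterating along the chain of balls, of length bounded in terms of \<open>N\<close>, gives
  the estimate on \<open>S\<^sub>R\<close>.\<close>

section \<open>Change of variables over an arbitrary finite index type\<close>

text \<open>The constant must serve every domain, operator and radius at once. So all comparisons
  are scale invariant, and the data they use (the mesh \<open>\<sigma>\<close>, the partition
  \<open>Q\<close>, the ratios \<open>\<gamma>\<close>, \<open>\<beta>\<close>,
  \<open>\<tau>\<close>) are fixed before \<open>\<Omega>\<close> and \<open>R\<close>. The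
  exponents come from contracting the Hessian of the power \<open>- s\<close> of the distance with
  an elliptic matrix: the result is nonnegative once \<open>s \<ge> e1 - 2\<close> and has a
  definite surplus for \<open>s = e1\<close>. Riesz potentials of order \<open>s\<close> are
  therefore only borderline and receive a small quadratic correction, while the power
  \<open>- e1\<close> is strict by itself. Second derivatives of \<open>u\<close> exist only as
  elements of L^n, so they cannot be evaluated at a maximum; the volume of a gradient image replaces
  the pointwise test. The Riesz comparison needs a ball of four times the radius free of
  \<open>\<Gamma>2\<close>, but the first ball has only the margin
  \<open>(a - 1) * \<theta> * R\<close> around it. Hence the capacity is split among small pieces,
  each piece is used at its own small scale, and the resulting lower bounds for \<open>M - u\<close>
  are moved inside the first ball and added up.\<close>

text \<open>The change of variables theorem of HOL-Analysis is stated for vectors indexed by a well-ordered type.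
  A copy of \<^typ>\<open>'a\<close> as an initial segment of the natural numbers makes it available for every finite
  index type, by permuting coordinates.\<close>

typedef 'a idx = "{..<CARD('a::finite)}"
  by (rule exI[of _ 0]) simp

instantiation idx :: (finite) linorder
begin
definition less_eq_idx :: "'a idx \<Rightarrow> 'a idx \<Rightarrow> bool" where "less_eq_idx x y \<longleftrightarrow> Rep_idx x \<le> Rep_idx y"
definition less_idx :: "'a idx \<Rightarrow> 'a idx \<Rightarrow> bool" where "less_idx x y \<longleftrightarrow> Rep_idx x < Rep_idx y"
instance
  by standard (auto simp: less_eq_idx_def less_idx_def Rep_idx_inject)
end

instance idx :: (finite) wellorder
proof
  fix P :: "'a idx \<Rightarrow> bool" and a
  assume step: "\<And>x. (\<And>y. y < x \<Longrightarrow> P y) \<Longrightarrow> P x"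
  show "P a"
  proof (induction a rule: measure_induct_rule[of Rep_idx])
    case (less x)
    show ?case by (rule step) (rule less, simp add: less_idx_def)
  qed
qed

instance idx :: (finite) finite
proof
  have "finite (Rep_idx ` (UNIV :: 'a idx set))"
    by (rule finite_subset[of _ "{..<CARD('a)}"]) (use Rep_idx in auto)
  then show "finite (UNIV :: 'a idx set)"
    by (rule finite_imageD) (simp add: inj_on_def Rep_idx_inject)
qed

lemma card_idx: "CARD('a::finite idx) = CARD('a)"
  using type_definition.card[OF type_definition_idx] by simp

lemma abs_det_le:
  fixes A :: "real^'n::finite^'n"
  assumes "\<And>i j. \<bar>A $ i $ j\<bar> \<le> b"
  shows "\<bar>det A\<bar> \<le> fact CARD('n) * b ^ CARD('n)"
proof -
  have "\<bar>det A\<bar> \<le> (\<Sum>p\<in>{p. p permutes (UNIV::'n set)}. \<bar>of_int (sign p) * (\<Prod>i\<in>UNIV. A $ i $ p i)\<bar>)"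
    unfolding det_def by (rule sum_abs)
  also have "\<dots> \<le> (\<Sum>p\<in>{p. p permutes (UNIV::'n set)}. b ^ CARD('n))"
  proof (rule sum_mono)
    fix p
    have "\<bar>of_int (sign p) * (\<Prod>i\<in>UNIV. A $ i $ p i)\<bar> = (\<Prod>i\<in>UNIV. \<bar>A $ i $ p i\<bar>)"
      by (simp add: abs_mult abs_prod sign_def)
    also have "\<dots> \<le> (\<Prod>i\<in>(UNIV::'n set). b)"
      by (rule prod_mono) (use assms in auto)
    finally show "\<bar>of_int (sign p) * (\<Prod>i\<in>UNIV. A $ i $ p i)\<bar> \<le> b ^ CARD('n)" by simp
  qed
  also have "\<dots> = fact CARD('n) * b ^ CARD('n)"
    by (simp add: card_permutations[of UNIV "CARD('n)"])
  finally show ?thesis .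
qed

text \<open>The entrywise l^1 norm. It dominates every entry, hence the determinant through
  \<open>abs_det_le\<close>, and on \<open>psd\<close> matrices it is at most a multiple of the
  trace.\<close>

definition entry_sum :: "real^'n^'n \<Rightarrow> real" where
  "entry_sum A = (\<Sum>i\<in>UNIV. \<Sum>j\<in>UNIV. \<bar>A $ i $ j\<bar>)"

lemma entry_sum_nonneg: "0 \<le> entry_sum A"
  unfolding entry_sum_def by (intro sum_nonneg) auto

lemma entry_le_entry_sum: "\<bar>A $ i $ j\<bar> \<le> entry_sum A"
proof -
  have "\<bar>A $ i $ j\<bar> \<le> (\<Sum>j\<in>UNIV. \<bar>A $ i $ j\<bar>)"
    by (rule member_le_sum) auto
  also have "\<dots> \<le> entry_sum A"
    unfolding entry_sum_def
    by (rule member_le_sum[of i UNIV "\<lambda>i. \<Sum>j\<in>UNIV. \<bar>A $ i $ j\<bar>"]) (auto intro: sum_nonneg)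
  finally show ?thesis .
qed

lemma continuous_on_entry_sum [continuous_intros]:
  "continuous_on S J \<Longrightarrow> continuous_on S (\<lambda>x. entry_sum (J x))"
  unfolding entry_sum_def by (intro continuous_intros)

lemma set_integrable_lborel_compact:
  fixes f :: "real^'n::finite \<Rightarrow> real"
  assumes "compact S" "continuous_on S f"
  shows "set_integrable lborel S f"
  unfolding set_integrable_def by (rule borel_integrable_compact[OF assms])

text \<open>The volume of an image is at most the integral of the absolute Jacobian determinant,
  also without injectivity; the determinant is then traded for the entries. Losing a factor that
  depends on the dimension is harmless, since the integral is later made arbitrarily small.\<close>

lemma measure_image_le_wellorder:
  fixes f :: "real^'n::{finite,wellorder} \<Rightarrow> real^'n::_"
  assumes S: "compact S" and J: "continuous_on S J"
    and der: "\<And>x. x \<in> S \<Longrightarrow> (f has_derivative (\<lambda>h. J x *v h)) (at x within S)"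
  shows "measure lborel (f ` S) \<le> fact CARD('n) * (LINT x:S|lborel. entry_sum (J x) ^ CARD('n))"
proof -
  have c: "continuous_on S (\<lambda>x. \<bar>det (J x)\<bar>)"
    unfolding det_def using J by (intro continuous_intros)
  have i1: "set_integrable lborel S (\<lambda>x. \<bar>det (J x)\<bar>)"
    by (rule set_integrable_lborel_compact[OF S c])
  have i2: "set_integrable lborel S (\<lambda>x. entry_sum (J x) ^ CARD('n))"
    using J by (intro set_integrable_lborel_compact[OF S] continuous_intros)
  have mS: "S \<in> sets borel" using S by (simp add: borel_compact)
  have "continuous_on S f"
    using der has_derivative_continuous continuous_on_eq_continuous_within by blast
  then have "compact (f ` S)" using S compact_continuous_image by blast
  then have "measure lborel (f ` S) = measure lebesgue (f ` S)"
    by (simp add: borel_compact measure_completion)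
  also have "\<dots> \<le> integral S (\<lambda>x. \<bar>det (matrix (\<lambda>h. J x *v h))\<bar>)"
    using S der i1 mS
    by (intro measure_differentiable_image)
       (auto simp: set_borel_integral_eq_integral)
  also have "\<dots> = (LINT x:S|lborel. \<bar>det (J x)\<bar>)"
    using set_borel_integral_eq_integral(2)[OF i1] by simp
  also have "\<dots> \<le> (LINT x:S|lborel. fact CARD('n) * entry_sum (J x) ^ CARD('n))"
    using i1 i2 by (intro set_integral_mono) (auto intro: abs_det_le entry_le_entry_sum)
  finally show ?thesis by simp
qed

text \<open>Relabelling coordinates carries boxes to boxes with the same side lengths, and Lebesgue
  measure is determined by its values on boxes.\<close>

lemma lborel_distr_reindex:
  fixes e :: "'m::finite \<Rightarrow> 'n::finite"
  assumes e: "bij e"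
  shows "distr lborel borel (\<lambda>x::real^'n. (\<chi> i. x $ e i) :: real^'m) = lborel"
proof (rule lborel_eqI[symmetric])
  let ?P = "\<lambda>x::real^'n. (\<chi> i. x $ e i) :: real^'m"
  let ?Q = "\<lambda>y::real^'m. (\<chi> j. y $ inv e j) :: real^'n"
  have cP: "continuous_on UNIV ?P" by (intro continuous_intros)
  have [measurable]: "?P \<in> borel_measurable borel" by (rule borel_measurable_continuous_onI[OF cP])
  fix l u :: "real^'m" assume le: "\<And>b. b \<in> Basis \<Longrightarrow> l \<bullet> b \<le> u \<bullet> b"
  have le': "l $ i \<le> u $ i" for i
    using le[of "axis i 1"] by (auto simp: inner_axis axis_in_Basis_iff)
  have eq: "?P -` box l u = box (?Q l) (?Q u)"
    using bij_is_inj[OF e] bij_is_surj[OF e]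
    by (auto simp: mem_box_cart) (metis inv_f_f surj_f_inv_f)+
  have "emeasure (distr lborel borel ?P) (box l u) = emeasure lborel (box (?Q l) (?Q u))"
    by (subst emeasure_distr) (auto simp: eq)
  also have "\<dots> = (\<Prod>b\<in>Basis. (?Q u - ?Q l) \<bullet> b)"
    by (subst emeasure_lborel_box) (auto simp: le' Basis_vec_def inner_axis)
  also have "(\<Prod>b\<in>Basis. (?Q u - ?Q l) \<bullet> b) = (\<Prod>j\<in>UNIV. (?Q u - ?Q l) $ j)"
    by (subst prod.reindex_bij_betw[of "\<lambda>j. axis j 1", symmetric])
       (auto simp: bij_betw_def inj_on_def axis_eq_axis Basis_vec_def inner_axis)
  also have "\<dots> = (\<Prod>i\<in>UNIV. (u - l) $ i)"
    by (subst prod.reindex_bij_betw[of e UNIV UNIV, symmetric])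
       (use e in \<open>auto simp: bij_betw_def bij_is_inj inv_f_f\<close>)
  also have "\<dots> = (\<Prod>b\<in>Basis. (u - l) \<bullet> b)"
    by (subst prod.reindex_bij_betw[of "\<lambda>j. axis j 1" UNIV, symmetric])
       (auto simp: bij_betw_def inj_on_def axis_eq_axis Basis_vec_def inner_axis)
  finally show "emeasure (distr lborel borel ?P) (box l u) = (\<Prod>b\<in>Basis. (u - l) \<bullet> b)" .
qed simp

text \<open>The map is conjugated with the coordinate relabelling \<open>P\<close>. This preserves
  volumes and permutes the rows and columns of the Jacobian, so \<open>entry_sum\<close> does not
  change either.\<close>

lemma measure_image_le:
  fixes f :: "real^'n::finite \<Rightarrow> real^'n"
  assumes S: "compact S" and J: "continuous_on S J"
    and der: "\<And>x. x \<in> S \<Longrightarrow> (f has_derivative (\<lambda>h. J x *v h)) (at x within S)"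
  shows "measure lborel (f ` S) \<le> fact CARD('n) * (LINT x:S|lborel. entry_sum (J x) ^ CARD('n))"
proof -
  obtain e :: "'n idx \<Rightarrow> 'n" where e: "bij e"
    using finite_same_card_bij[of "UNIV :: 'n idx set" "UNIV :: 'n set"] card_idx[where 'a='n] by auto
  define P where "P = (\<lambda>x::real^'n. (\<chi> i. x $ e i) :: real^('n idx))"
  define Q where "Q = (\<lambda>y::real^('n idx). (\<chi> j. y $ inv e j) :: real^'n)"
  have PQ [simp]: "P (Q y) = y" for y
    using e by (simp add: P_def Q_def vec_eq_iff bij_is_inj)
  have QP [simp]: "Q (P x) = x" for x
    using e by (simp add: P_def Q_def vec_eq_iff bij_is_surj surj_f_inv_f)
  have injP: "inj P" by (metis QP injI)
  have lP: "linear P" and lQ: "linear Q"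
    by (auto simp: P_def Q_def linear_iff vec_eq_iff)
  have cP: "continuous_on A P" for A
    unfolding P_def by (intro continuous_intros)
  have cQ: "continuous_on A Q" for A
    unfolding Q_def by (intro continuous_intros)
  have [measurable]: "P \<in> borel_measurable borel" "Q \<in> borel_measurable borel"
    using cP cQ by (auto intro: borel_measurable_continuous_onI)
  have dP: "distr lborel borel P = lborel"
    unfolding P_def by (rule lborel_distr_reindex[OF e])
  have meas: "measure lborel (P ` T) = measure lborel T" if "compact T" for T
  proof -
    have "compact (P ` T)" using that cP compact_continuous_image by blast
    then have "measure lborel (P ` T) = measure (distr lborel borel P) (P ` T)"
      by (simp add: dP)
    also have "\<dots> = measure lborel (P -` P ` T)"
      using \<open>compact (P ` T)\<close> by (subst measure_distr) (auto simp: borel_compact)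
    also have "P -` P ` T = T" using injP by (simp add: inj_vimage_image_eq)
    finally show ?thesis .
  qed
  define F where "F = (\<lambda>y. P (f (Q y)))"
  define J' where "J' = (\<lambda>y. (\<chi> i j. J (Q y) $ e i $ e j) :: real^('n idx)^('n idx))"
  have S': "compact (P ` S)" using S cP compact_continuous_image by blast
  have QS: "Q ` P ` S = S" by (auto simp: image_image)
  have cJ: "continuous_on (P ` S) (\<lambda>y. J (Q y))"
    using continuous_on_compose2[OF J cQ] QS by blast
  have cJ': "continuous_on (P ` S) J'"
    unfolding J'_def using cJ by (intro continuous_intros)
  have sum_e: "(\<Sum>i\<in>UNIV. g (e i)) = (\<Sum>i\<in>UNIV. g i)" for g :: "'n \<Rightarrow> real"
    by (rule sum.reindex_bij_betw[OF e])
  have Jlin: "P (J x *v Q h) = J' (P x) *v h" for x h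
  proof -
    have "(\<Sum>j\<in>UNIV. J x $ e i $ j * h $ inv e j) = (\<Sum>k\<in>UNIV. J x $ e i $ e k * h $ k)" for i
      using sum_e[of "\<lambda>j. J x $ e i $ j * h $ inv e j"] e by (simp add: bij_is_inj)
    then show ?thesis
      unfolding J'_def QP by (simp add: matrix_vector_mult_def vec_eq_iff P_def Q_def)
  qed
  have derF: "(F has_derivative (\<lambda>h. J' y *v h)) (at y within P ` S)" if y: "y \<in> P ` S" for y
  proof -
    have d1: "(Q has_derivative Q) (at y within P ` S)"
      using lQ by (simp add: linear_conv_bounded_linear bounded_linear_imp_has_derivative)
    have "(f has_derivative (\<lambda>h. J (Q y) *v h)) (at (Q y) within Q ` P ` S)"
      using der y by (auto simp: image_image)
    from diff_chain_within[OF d1 this]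
    have d2: "((\<lambda>y. f (Q y)) has_derivative (\<lambda>h. J (Q y) *v Q h)) (at y within P ` S)"
      by (simp add: o_def)
    have "((\<lambda>y. P (f (Q y))) has_derivative (\<lambda>h. P (J (Q y) *v Q h))) (at y within P ` S)"
      using bounded_linear.has_derivative[OF _ d2] lP by (simp add: linear_conv_bounded_linear)
    then show ?thesis using Jlin[of "Q y"] by (simp add: F_def)
  qed
  have es: "entry_sum (J' (P x)) = entry_sum (J x)" for x
  proof -
    have "entry_sum (J' (P x)) = (\<Sum>i\<in>UNIV. (\<Sum>j\<in>UNIV. \<bar>J x $ e i $ e j\<bar>))"
      by (simp add: entry_sum_def J'_def)
    also have "\<dots> = (\<Sum>i\<in>UNIV. (\<Sum>j\<in>UNIV. \<bar>J x $ e i $ j\<bar>))"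
      by (intro sum.cong refl sum_e)
    also have "\<dots> = entry_sum (J x)"
      unfolding entry_sum_def by (rule sum_e)
    finally show ?thesis .
  qed
  have "continuous_on S f"
    using der has_derivative_continuous continuous_on_eq_continuous_within by blast
  then have "compact (f ` S)" using S compact_continuous_image by blast
  then have "measure lborel (f ` S) = measure lborel (P ` f ` S)" using meas by simp
  also have "P ` f ` S = F ` P ` S" by (auto simp: F_def image_image)
  also have "measure lborel (F ` P ` S)
      \<le> fact CARD('n idx) * (LINT y:P ` S|lborel. entry_sum (J' y) ^ CARD('n idx))"
    by (rule measure_image_le_wellorder[OF S' cJ' derF])
  also have "(LINT y:P ` S|lborel. entry_sum (J' y) ^ CARD('n idx))
      = (LINT y:P ` S|distr lborel borel P. entry_sum (J' y) ^ CARD('n))"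
    by (simp add: dP card_idx)
  also have "\<dots> = (LINT x|lborel. indicator (P ` S) (P x) *\<^sub>R entry_sum (J' (P x)) ^ CARD('n))"
    unfolding set_lebesgue_integral_def
  proof (rule integral_distr)
    have "(\<lambda>y. indicator (P ` S) y *\<^sub>R entry_sum (J' y) ^ CARD('n)) \<in> borel_measurable borel"
      using cJ' S' by (intro borel_measurable_continuous_on_indicator continuous_intros) (auto simp: borel_compact)
    then show "(\<lambda>y. indicator (P ` S) y *\<^sub>R entry_sum (J' y) ^ CARD('n)) \<in> borel_measurable borel" .
  qed simp
  also have "\<dots> = (LINT x:S|lborel. entry_sum (J x) ^ CARD('n))"
    unfolding set_lebesgue_integral_def es
    by (intro Bochner_Integration.integral_cong) (auto simp: indicator_def inj_image_mem_iff[OF injP])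
  finally show ?thesis by (simp add: card_idx)
qed

section \<open>Mollification\<close>

text \<open>A kernel of class C^1 only. That is enough: \<open>weak_partial\<close> tests against
  C^1 functions, and the second derivatives of a mollified function arise as first derivatives of
  its mollified weak gradient.\<close>

definition bump :: "real \<Rightarrow> real^'n::finite \<Rightarrow> real" where
  "bump e x = (max 0 (e\<^sup>2 - x \<bullet> x))\<^sup>2"

definition bump_grad :: "real \<Rightarrow> real^'n::finite \<Rightarrow> real^'n" where
  "bump_grad e x = (- 4 * max 0 (e\<^sup>2 - x \<bullet> x)) *\<^sub>R x"

lemma bump_nonneg: "0 \<le> bump e x" by (simp add: bump_def)

lemma bump_eq_0: "0 \<le> e \<Longrightarrow> e \<le> norm x \<Longrightarrow> bump e x = 0"
  by (simp add: bump_def max_def power2_norm_eq_inner[symmetric] abs_le_square_iff[symmetric])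

lemma bump_pos: "norm x < e \<Longrightarrow> 0 < bump e x"
  by (simp add: bump_def power2_norm_eq_inner[symmetric] abs_square_less_1 power_strict_mono max_def)
     (smt (verit) norm_ge_zero power_strict_mono pos2)

lemma bump_le: "bump e x \<le> e ^ 4"
proof -
  have "max 0 (e\<^sup>2 - x \<bullet> x) \<le> e\<^sup>2" by simp
  then have "(max 0 (e\<^sup>2 - x \<bullet> x))\<^sup>2 \<le> (e\<^sup>2)\<^sup>2" by (intro power_mono) auto
  then show ?thesis by (simp add: bump_def)
qed

lemma bump_minus: "bump e (- x) = bump e x" by (simp add: bump_def)

lemma continuous_on_bump [continuous_intros]:
  "continuous_on S f \<Longrightarrow> continuous_on S (\<lambda>x. bump e (f x))"
  unfolding bump_def by (intro continuous_intros)

lemma continuous_on_bump_grad [continuous_intros]: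
  "continuous_on S f \<Longrightarrow> continuous_on S (\<lambda>x. bump_grad e (f x))"
  unfolding bump_grad_def by (intro continuous_intros)

text \<open>The derivative \<open>2 * max 0 t\<close> of the squared positive part is Lipschitz with
  constant 2, which makes the first-order Taylor error quadratic even across 0.\<close>

lemma sq_pos_part_taylor:
  fixes t d :: real
  shows "\<bar>(max 0 (t + d))\<^sup>2 - (max 0 t)\<^sup>2 - 2 * max 0 t * d\<bar> \<le> d\<^sup>2"
proof (cases "t \<ge> 0"; cases "t + d \<ge> 0")
  assume "t \<ge> 0" "t + d \<ge> 0"
  then show ?thesis by (simp add: power2_eq_square algebra_simps)
next
  assume a: "t \<ge> 0" "\<not> t + d \<ge> 0"
  then have "(max 0 (t + d))\<^sup>2 - (max 0 t)\<^sup>2 - 2 * max 0 t * d = - (t * (t + 2 * d))"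
    by (simp add: power2_eq_square algebra_simps)
  moreover have "t * (t + 2 * d) \<le> 0" using a by (intro mult_nonneg_nonpos) auto
  moreover have "- (t * (t + 2 * d)) \<le> d\<^sup>2"
    using zero_le_power2[of "t + d"] by (simp add: power2_eq_square algebra_simps)
  ultimately show ?thesis by simp
next
  assume a: "\<not> t \<ge> 0" "t + d \<ge> 0"
  then have "(t + d)\<^sup>2 \<le> d\<^sup>2" by (intro power_mono) auto
  then show ?thesis using a by simp
next
  assume a: "\<not> t \<ge> 0" "\<not> t + d \<ge> 0"
  then show ?thesis by simp
qed

text \<open>The constant does not depend on \<open>x\<close>. This uniformity permits
  differentiation under an integral against a merely integrable function. If
  \<open>norm x > e + 1\<close>, both \<open>x\<close> and \<open>x + h\<close> lie outside the
  support.\<close>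

lemma bump_taylor:
  fixes x h :: "real^'n::finite"
  assumes "0 \<le> e" "norm h \<le> 1"
  shows "\<bar>bump e (x + h) - bump e x - bump_grad e x \<bullet> h\<bar> \<le> ((2 * e + 3)\<^sup>2 + 2 * e\<^sup>2) * (norm h)\<^sup>2"
proof (cases "norm x \<le> e + 1")
  case True
  define t where "t = e\<^sup>2 - x \<bullet> x"
  define d where "d = - (2 * (x \<bullet> h) + h \<bullet> h)"
  have eq: "bump e (x + h) - bump e x - bump_grad e x \<bullet> h
      = ((max 0 (t + d))\<^sup>2 - (max 0 t)\<^sup>2 - 2 * max 0 t * d) - 2 * max 0 t * (norm h)\<^sup>2"
    by (simp add: bump_def bump_grad_def t_def d_def power2_norm_eq_inner inner_commute algebra_simps)
  have hh: "h \<bullet> h = norm h * norm h" by (simp add: dot_square_norm power2_eq_square)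
  have "\<bar>d\<bar> \<le> 2 * (norm x * norm h) + norm h * norm h"
    unfolding d_def hh using Cauchy_Schwarz_ineq2[of x h] zero_le_square[of "norm h"] by linarith
  also have "\<dots> \<le> (2 * e + 3) * norm h"
    using True assms mult_right_mono[of "norm x" "e+1" "norm h"] mult_right_mono[of "norm h" 1 "norm h"]
    by (simp add: algebra_simps)
  finally have "d\<^sup>2 \<le> (2 * e + 3)\<^sup>2 * (norm h)\<^sup>2"
    by (metis abs_ge_zero power2_abs power_mono power_mult_distrib)
  moreover have "2 * max 0 t * (norm h)\<^sup>2 \<le> 2 * e\<^sup>2 * (norm h)\<^sup>2"
    by (intro mult_right_mono) (auto simp: t_def)
  moreover have "0 \<le> 2 * max 0 t * (norm h)\<^sup>2" by simp
  ultimately show ?thesis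
    unfolding eq distrib_right using sq_pos_part_taylor[of t d] by linarith
next
  case False
  then have "bump e x = 0" "bump e (x + h) = 0"
    using assms norm_triangle_ineq2[of x "- h"] by (auto intro!: bump_eq_0)
  moreover have "e\<^sup>2 \<le> (norm x)\<^sup>2" using False assms by (intro power_mono) auto
  then have "bump_grad e x = 0" by (simp add: bump_grad_def power2_norm_eq_inner max_def)
  ultimately show ?thesis by simp
qed

lemma has_derivative_quadratic_bound:
  fixes f :: "'a::real_normed_vector \<Rightarrow> real"
  assumes L: "bounded_linear L"
    and b: "\<And>h. norm h \<le> 1 \<Longrightarrow> \<bar>f (x + h) - f x - L h\<bar> \<le> C * (norm h)\<^sup>2"
  shows "(f has_derivative L) (at x)"
proof -
  have "(\<lambda>h. norm (f (x + h) - f x - L h) / norm h) \<midarrow>0\<rightarrow> 0"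
  proof (rule Lim_null_comparison)
    show "\<forall>\<^sub>F h in at 0. norm (norm (f (x + h) - f x - L h) / norm h) \<le> C * norm h"
      unfolding eventually_at
    proof (intro exI[of _ 1] conjI ballI impI)
      fix h :: 'a assume h: "h \<noteq> 0 \<and> dist h 0 < 1"
      then have "\<bar>f (x + h) - f x - L h\<bar> / norm h \<le> C * (norm h)\<^sup>2 / norm h"
        by (intro divide_right_mono b) auto
      then show "norm (norm (f (x + h) - f x - L h) / norm h) \<le> C * norm h"
        using h by (simp add: power2_eq_square)
    qed simp
    show "(\<lambda>h. C * norm h) \<midarrow>0\<rightarrow> 0"
      by (rule tendsto_mult_right_zero, rule tendsto_norm_zero, rule tendsto_ident_at)
  qed
  then show ?thesis using L by (simp add: has_derivative_at)
qed

lemma has_derivative_bump: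
  assumes "0 \<le> e"
  shows "(bump e has_derivative (\<lambda>h. bump_grad e x \<bullet> h)) (at x)"
  by (rule has_derivative_quadratic_bound[OF _ bump_taylor[OF assms]]) (rule bounded_linear_inner_right)

lemma bump_grad_bounded:
  fixes x :: "real^'n::finite"
  assumes "0 \<le> e" shows "norm (bump_grad e x) \<le> 4 * e ^ 3"
proof (cases "norm x \<le> e")
  case True
  have "max 0 (e\<^sup>2 - x \<bullet> x) * norm x \<le> e\<^sup>2 * e" by (intro mult_mono) (use True assms in auto)
  then show ?thesis by (simp add: bump_grad_def abs_mult power2_eq_square power3_eq_cube)
next
  case False
  then have "e\<^sup>2 \<le> (norm x)\<^sup>2" using assms by (intro power_mono) auto
  then show ?thesis using assms by (simp add: bump_grad_def power2_norm_eq_inner max_def)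
qed

lemma integrable_mult_bounded_continuous:
  fixes f :: "real^'n::finite \<Rightarrow> real"
  assumes f: "integrable lborel f" and k: "continuous_on UNIV k" "\<And>x. \<bar>k x\<bar> \<le> B"
  shows "integrable lborel (\<lambda>y. f y * k y)"
proof (rule Bochner_Integration.integrable_bound)
  show "integrable lborel (\<lambda>y. B * f y)" using f by simp
  have "k \<in> borel_measurable borel" using k(1) by (rule borel_measurable_continuous_onI)
  then show "(\<lambda>y. f y * k y) \<in> borel_measurable lborel" using f by auto
  show "AE y in lborel. norm (f y * k y) \<le> norm (B * f y)"
  proof (rule AE_I2)
    fix y
    have "\<bar>k y\<bar> \<le> \<bar>B\<bar>" using k(2)[of y] by linarith
    then show "norm (f y * k y) \<le> norm (B * f y)"
      by (simp add: abs_mult mult.commute[of "\<bar>B\<bar>"] mult_left_mono)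
  qed
qed

lemma integrable_mult_bump:
  assumes "integrable lborel f" "0 \<le> e"
  shows "integrable lborel (\<lambda>y. f y * bump e (x - y))"
  by (rule integrable_mult_bounded_continuous[OF assms(1), where B="e^4"])
     (auto intro!: continuous_intros simp: bump_le bump_nonneg)

lemma integrable_mult_bump_grad:
  assumes "integrable lborel f" "0 \<le> e"
  shows "integrable lborel (\<lambda>y. f y * bump_grad e (x - y) $ i)"
  by (rule integrable_mult_bounded_continuous[OF assms(1), where B="4 * e ^ 3"])
     (auto intro!: continuous_intros order_trans[OF component_le_norm_cart bump_grad_bounded] simp: assms)

lemma has_derivative_convolution_bump:
  fixes f :: "real^'n::finite \<Rightarrow> real"
  assumes f: "integrable lborel f" and e: "0 \<le> e"
  shows "((\<lambda>x. LINT y|lborel. f y * bump e (x - y)) has_derivative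
      (\<lambda>h. (\<chi> i. LINT y|lborel. f y * bump_grad e (x - y) $ i) \<bullet> h)) (at x)"
proof (rule has_derivative_quadratic_bound)
  show "bounded_linear (\<lambda>h. (\<chi> i. LINT y|lborel. f y * bump_grad e (x - y) $ i) \<bullet> h)"
    by (rule bounded_linear_inner_right)
  fix h :: "real^'n" assume h: "norm h \<le> 1"
  let ?C = "((2 * e + 3)\<^sup>2 + 2 * e\<^sup>2) * (norm h)\<^sup>2"
  have lin: "(\<chi> i. LINT y|lborel. f y * bump_grad e (x - y) $ i) \<bullet> h
      = (LINT y|lborel. f y * (bump_grad e (x - y) \<bullet> h))"
  proof -
    have "(\<chi> i. LINT y|lborel. f y * bump_grad e (x - y) $ i) \<bullet> h
        = (\<Sum>i\<in>UNIV. (LINT y|lborel. f y * bump_grad e (x - y) $ i) * h $ i)"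
      by (simp add: inner_vec_def)
    also have "\<dots> = (\<Sum>i\<in>UNIV. (LINT y|lborel. f y * bump_grad e (x - y) $ i * h $ i))"
      by simp
    also have "\<dots> = (LINT y|lborel. (\<Sum>i\<in>UNIV. f y * bump_grad e (x - y) $ i * h $ i))"
      by (subst Bochner_Integration.integral_sum) (auto intro: integrable_mult_bump_grad f e)
    also have "\<dots> = (LINT y|lborel. f y * (bump_grad e (x - y) \<bullet> h))"
      by (simp add: inner_vec_def sum_distrib_left mult.assoc)
    finally show ?thesis .
  qed
  have int: "integrable lborel (\<lambda>y. f y * (bump_grad e (x - y) \<bullet> h))"
    by (rule integrable_mult_bounded_continuous[OF f, where B="4 * e ^ 3 * norm h"])
       (auto intro!: continuous_intros order_trans[OF Cauchy_Schwarz_ineq2] mult_right_mono bump_grad_bounded e)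
  have "(LINT y|lborel. f y * bump e (x + h - y)) - (LINT y|lborel. f y * bump e (x - y))
      - (LINT y|lborel. f y * (bump_grad e (x - y) \<bullet> h))
      = (LINT y|lborel. f y * (bump e (x - y + h) - bump e (x - y) - bump_grad e (x - y) \<bullet> h))"
    using int integrable_mult_bump[OF f e] by (simp add: algebra_simps)
  moreover have "\<bar>\<dots>\<bar> \<le> (LINT y|lborel. ?C * \<bar>f y\<bar>)"
  proof (rule order_trans[OF integral_abs_bound Bochner_Integration.integral_mono'])
    show "integrable lborel (\<lambda>y. ?C * \<bar>f y\<bar>)" using f by (intro integrable_mult_right integrable_abs)
    show "\<bar>f y * (bump e (x - y + h) - bump e (x - y) - bump_grad e (x - y) \<bullet> h)\<bar> \<le> ?C * \<bar>f y\<bar>" for y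
      using mult_right_mono[OF bump_taylor[OF e h, of "x - y"], of "\<bar>f y\<bar>"] by (simp add: abs_mult mult.commute)
  qed simp
  ultimately show "\<bar>(LINT y|lborel. f y * bump e (x + h - y)) - (LINT y|lborel. f y * bump e (x - y))
      - (\<chi> i. LINT y|lborel. f y * bump_grad e (x - y) $ i) \<bullet> h\<bar>
      \<le> (((2 * e + 3)\<^sup>2 + 2 * e\<^sup>2) * (LINT y|lborel. \<bar>f y\<bar>)) * (norm h)\<^sup>2"
    unfolding lin by (simp add: mult_ac)
qed

lemma integrable_bump:
  assumes "0 \<le> e" shows "integrable lborel (bump e :: real^'n::finite \<Rightarrow> real)"
proof -
  have "(\<lambda>x. indicator (cball 0 e) x *\<^sub>R bump e x) = (bump e :: real^'n \<Rightarrow> real)"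
    using assms by (auto simp: fun_eq_iff indicator_def bump_eq_0)
  moreover have "integrable lborel (\<lambda>x::real^'n. indicator (cball 0 e) x *\<^sub>R bump e x)"
    by (rule borel_integrable_compact) (auto intro: continuous_intros)
  ultimately show ?thesis by simp
qed

definition bump_mass :: "real \<Rightarrow> (real^'n::finite) itself \<Rightarrow> real" where
  "bump_mass e _ = (LINT z|lborel. bump e (z :: real^'n))"

lemma borel_measurable_bump [measurable]:
  "f \<in> borel_measurable M \<Longrightarrow> (\<lambda>x. bump e (f x :: real^'n::finite)) \<in> borel_measurable M"
  by (rule measurable_compose[OF _ borel_measurable_continuous_onI]) (auto intro: continuous_intros)

lemma bump_eq_0_iff: "0 < e \<Longrightarrow> bump e x = 0 \<longleftrightarrow> e \<le> norm x"
  using bump_pos[of x e] bump_eq_0[of e x] by (cases "norm x < e") simp_all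

lemma bump_mass_pos:
  assumes "0 < e" shows "0 < bump_mass e TYPE(real^'n::finite)"
proof -
  have "bump_mass e TYPE(real^'n) \<noteq> 0"
  proof
    assume "bump_mass e TYPE(real^'n) = 0"
    then have z: "(LINT z|lborel. bump e (z :: real^'n)) = 0" by (simp add: bump_mass_def)
    have ae: "AE x in lborel. bump e (x :: real^'n) = 0"
      by (rule iffD1[OF integral_nonneg_eq_0_iff_AE z], rule integrable_bump)
         (use assms in \<open>simp_all add: bump_nonneg\<close>)
    have eq: "{x. bump e (x :: real^'n) \<noteq> 0} = ball 0 e"
      using assms by (auto simp: bump_eq_0_iff)
    have "emeasure lborel (ball (0 :: real^'n) e) = 0"
      by (rule iffD1[OF AE_iff_measurable ae]) (simp_all add: eq)
    moreover have "emeasure lborel (ball (0 :: real^'n) e) \<noteq> 0"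
      using open_not_negligible[of "ball (0 :: real^'n) e"] assms
      by (simp add: negligible_iff_null_sets null_sets_def)
    ultimately show False by simp
  qed
  moreover have "bump_mass e TYPE(real^'n) \<ge> 0"
    by (simp add: bump_mass_def bump_nonneg)
  ultimately show ?thesis by simp
qed

definition mollifier :: "real \<Rightarrow> real^'n::finite \<Rightarrow> real" where
  "mollifier e x = bump e x / bump_mass e TYPE(real^'n)"

lemma integral_translate:
  fixes g :: "real^'n::finite \<Rightarrow> real"
  assumes "g \<in> borel_measurable borel"
  shows "(LINT y|lborel. g (y - x)) = (LINT y|lborel. g y)"
proof -
  have "(LINT y|lborel. g y) = (LINT y|distr lborel borel ((+) (- x)). g y)"
    by (simp add: lborel_distr_plus)
  also have "\<dots> = (LINT y|lborel. g (- x + y))"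
    by (rule integral_distr) (use assms in auto)
  finally show ?thesis by simp
qed

lemma mollifier_minus: "mollifier e (x - y) = mollifier e (y - x)"
  using bump_minus[of e "x - y"] by (simp add: mollifier_def)

lemma borel_measurable_mollifier [measurable]:
  "f \<in> borel_measurable M \<Longrightarrow> (\<lambda>x. mollifier e (f x :: real^'n::finite)) \<in> borel_measurable M"
  unfolding mollifier_def by (intro borel_measurable_divide borel_measurable_bump borel_measurable_const)

lemma mollifier_nonneg: "0 < e \<Longrightarrow> 0 \<le> mollifier e (x :: real^'n::finite)"
  using bump_mass_pos[of e, where 'n='n] by (simp add: mollifier_def bump_nonneg)

lemma mollifier_eq_0: "0 < e \<Longrightarrow> e \<le> norm x \<Longrightarrow> mollifier e x = 0"
  by (simp add: mollifier_def bump_eq_0)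

lemma integral_mollifier:
  assumes "0 < e"
  shows "(LINT y|lborel. mollifier e (x - y :: real^'n::finite)) = 1"
    "(LINT y|lborel. mollifier e (y - x :: real^'n::finite)) = 1"
proof -
  have "(LINT y|lborel. mollifier e (y - x :: real^'n)) = (LINT y|lborel. mollifier e (y :: real^'n))"
    by (rule integral_translate) measurable
  also have "\<dots> = 1"
    using bump_mass_pos[OF assms, where 'n='n] by (simp add: mollifier_def bump_mass_def)
  finally show "(LINT y|lborel. mollifier e (y - x :: real^'n)) = 1" .
  then show "(LINT y|lborel. mollifier e (x - y :: real^'n)) = 1"
    by (simp add: mollifier_minus[of e x])
qed

lemma integrable_mollifier:
  assumes "0 < e"
  shows "integrable lborel (\<lambda>y. mollifier e (x - y :: real^'n::finite))"
    "integrable lborel (\<lambda>y. mollifier e (y - x :: real^'n::finite))"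
proof -
  show "integrable lborel (\<lambda>y. mollifier e (x - y :: real^'n))"
    using integral_mollifier(1)[OF assms, of x] by (rule contrapos_pp) (simp add: not_integrable_integral_eq)
  show "integrable lborel (\<lambda>y. mollifier e (y - x :: real^'n))"
    using integral_mollifier(2)[OF assms, of x] by (rule contrapos_pp) (simp add: not_integrable_integral_eq)
qed

definition mollify :: "real \<Rightarrow> (real^'n::finite \<Rightarrow> real) \<Rightarrow> real^'n \<Rightarrow> real" where
  "mollify e f x = (LINT y|lborel. f y * mollifier e (x - y))"

lemma integrable_mult_mollifier:
  fixes f :: "real^'n::finite \<Rightarrow> real"
  assumes "integrable lborel f" "0 < e"
  shows "integrable lborel (\<lambda>y. f y * mollifier e (x - y))"
  using integrable_mult_bump[of f e x] assms by (simp add: mollifier_def)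

lemma has_derivative_mollify:
  fixes f :: "real^'n::finite \<Rightarrow> real"
  assumes f: "integrable lborel f" and e: "0 < e"
  shows "(mollify e f has_derivative
      (\<lambda>h. (\<chi> i. (LINT y|lborel. f y * bump_grad e (x - y) $ i) / bump_mass e TYPE(real^'n)) \<bullet> h)) (at x)"
proof -
  have "((\<lambda>x. (LINT y|lborel. f y * bump e (x - y)) / bump_mass e TYPE(real^'n)) has_derivative
    (\<lambda>h. ((\<chi> i. LINT y|lborel. f y * bump_grad e (x - y) $ i) \<bullet> h) / bump_mass e TYPE(real^'n))) (at x)"
    using has_derivative_convolution_bump[OF f, of e x] e
    by (intro bounded_linear.has_derivative[OF bounded_linear_divide]) auto
  then show ?thesis
    by (simp add: mollify_def[abs_def] mollifier_def inner_vec_def sum_divide_distrib)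
qed

lemma continuous_on_mollify:
  assumes "integrable lborel f" "0 < e"
  shows "continuous_on S (mollify e f)"
  by (intro continuous_at_imp_continuous_on ballI has_derivative_continuous[OF has_derivative_mollify[OF assms]])

text \<open>Convexity in tangent form; integrated against a probability density with
  \<open>a\<close> the mean, it becomes Jensen's inequality.\<close>

lemma power_tangent:
  fixes t a :: real
  assumes "0 \<le> t" "0 \<le> a"
  shows "a ^ Suc m + real (Suc m) * a ^ m * (t - a) \<le> t ^ Suc m"
proof (induction m)
  case (Suc m)
  have "a ^ Suc (Suc m) + real (Suc (Suc m)) * a ^ Suc m * (t - a)
      = t * (a ^ Suc m + real (Suc m) * a ^ m * (t - a)) - real (Suc m) * (a ^ m * (t - a)\<^sup>2)"
    by (simp add: algebra_simps power2_eq_square)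
  also have "\<dots> \<le> t * t ^ Suc m"
    using Suc.IH assms mult_left_mono[OF Suc.IH assms(1)] by simp (smt (verit) mult_nonneg_nonneg of_nat_0_le_iff zero_le_power zero_le_power2)
  finally show ?case by simp
qed simp

lemma abs_mollify_power_le:
  fixes f :: "real^'n::finite \<Rightarrow> real"
  assumes f: "integrable lborel f" and fp: "integrable lborel (\<lambda>x. \<bar>f x\<bar> ^ Suc m)" and e: "0 < e"
  shows "\<bar>mollify e f x\<bar> ^ Suc m \<le> (LINT y|lborel. \<bar>f y\<bar> ^ Suc m * mollifier e (x - y))"
proof -
  let ?k = "\<lambda>y. mollifier e (x - y)"
  define a where "a = (LINT y|lborel. \<bar>f y\<bar> * ?k y)"
  have int1: "integrable lborel (\<lambda>y. \<bar>f y\<bar> * ?k y)"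
    using f e by (intro integrable_mult_mollifier integrable_abs)
  have int2: "integrable lborel (\<lambda>y. \<bar>f y\<bar> ^ Suc m * ?k y)"
    using fp e by (intro integrable_mult_mollifier)
  note int0 = integrable_mollifier(1)[OF e, of x]
  have a0: "0 \<le> a" unfolding a_def using e by (intro Bochner_Integration.integral_nonneg) (auto simp: mollifier_nonneg)
  have "\<bar>mollify e f x\<bar> \<le> (LINT y|lborel. \<bar>f y * ?k y\<bar>)"
    unfolding mollify_def by (rule integral_abs_bound)
  also have "\<dots> = a" unfolding a_def using e by (simp add: abs_mult mollifier_nonneg)
  finally have "\<bar>mollify e f x\<bar> ^ Suc m \<le> a ^ Suc m" by (intro power_mono) auto
  \<comment> \<open>The kernel has integral 1, so the added summand is 0; it turns the power of the
    mean into the integral of the tangent line at \<open>a\<close>.\<close>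
  also have "a ^ Suc m = a ^ Suc m * (LINT y|lborel. ?k y) + real (Suc m) * a ^ m * (a - a * (LINT y|lborel. ?k y))"
    using integral_mollifier(1)[OF e, of x] by simp
  also have "\<dots> = (LINT y|lborel. a ^ Suc m * ?k y + real (Suc m) * a ^ m * (\<bar>f y\<bar> * ?k y - a * ?k y))"
    using int0 int1 by (simp add: a_def[symmetric])
  also have "\<dots> \<le> (LINT y|lborel. \<bar>f y\<bar> ^ Suc m * ?k y)"
  proof (rule Bochner_Integration.integral_mono)
    show "integrable lborel (\<lambda>y. a ^ Suc m * ?k y + real (Suc m) * a ^ m * (\<bar>f y\<bar> * ?k y - a * ?k y))"
      using int0 int1 by (intro Bochner_Integration.integrable_add integrable_mult_right Bochner_Integration.integrable_diff)
    show "integrable lborel (\<lambda>y. \<bar>f y\<bar> ^ Suc m * ?k y)" by (rule int2)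
    fix y :: "real^'n"
    have "(a ^ Suc m + real (Suc m) * a ^ m * (\<bar>f y\<bar> - a)) * ?k y \<le> \<bar>f y\<bar> ^ Suc m * ?k y"
      using power_tangent[of "\<bar>f y\<bar>" a m] a0 e by (intro mult_right_mono) (auto simp: mollifier_nonneg)
    then show "a ^ Suc m * ?k y + real (Suc m) * a ^ m * (\<bar>f y\<bar> * ?k y - a * ?k y) \<le> \<bar>f y\<bar> ^ Suc m * ?k y"
      by (simp add: algebra_simps)
  qed
  finally show ?thesis .
qed

text \<open>Jensen followed by Tonelli: the kernel integrates to 1 in either variable, so
  mollification does not increase the L^p norm.\<close>

lemma nn_integral_mollify_power_le:
  fixes f :: "real^'n::finite \<Rightarrow> real"
  assumes f: "integrable lborel f" and fp: "integrable lborel (\<lambda>x. \<bar>f x\<bar> ^ Suc m)" and e: "0 < e"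
  shows "(\<integral>\<^sup>+x. ennreal (\<bar>mollify e f x\<bar> ^ Suc m) \<partial>lborel) \<le> (\<integral>\<^sup>+x. ennreal (\<bar>f x\<bar> ^ Suc m) \<partial>lborel)"
proof -
  have [measurable]: "f \<in> borel_measurable borel" using f by auto
  have "(\<integral>\<^sup>+x. ennreal (\<bar>mollify e f x\<bar> ^ Suc m) \<partial>lborel)
      \<le> (\<integral>\<^sup>+x. \<integral>\<^sup>+y. ennreal (\<bar>f y\<bar> ^ Suc m * mollifier e (x - y)) \<partial>lborel \<partial>lborel)"
  proof (rule nn_integral_mono)
    fix x :: "real^'n"
    have "integrable lborel (\<lambda>y. \<bar>f y\<bar> ^ Suc m * mollifier e (x - y))"
      using fp e by (intro integrable_mult_mollifier)
    then have "(\<integral>\<^sup>+y. ennreal (\<bar>f y\<bar> ^ Suc m * mollifier e (x - y)) \<partial>lborel)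
        = ennreal (LINT y|lborel. \<bar>f y\<bar> ^ Suc m * mollifier e (x - y))"
      using e by (intro nn_integral_eq_integral) (auto simp: mollifier_nonneg)
    then show "ennreal (\<bar>mollify e f x\<bar> ^ Suc m) \<le> (\<integral>\<^sup>+y. ennreal (\<bar>f y\<bar> ^ Suc m * mollifier e (x - y)) \<partial>lborel)"
      using abs_mollify_power_le[OF f fp e, of x] by (simp add: ennreal_leI)
  qed
  also have "\<dots> = (\<integral>\<^sup>+y. \<integral>\<^sup>+x. ennreal (\<bar>f y\<bar> ^ Suc m * mollifier e (x - y)) \<partial>lborel \<partial>lborel)"
    by (rule lborel_pair.Fubini'[symmetric]) measurable
  also have "\<dots> = (\<integral>\<^sup>+y. ennreal (\<bar>f y\<bar> ^ Suc m) * (\<integral>\<^sup>+x. ennreal (mollifier e (x - y)) \<partial>lborel) \<partial>lborel)"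
    using e by (simp add: ennreal_mult mollifier_nonneg nn_integral_cmult)
  also have "\<dots> = (\<integral>\<^sup>+y. ennreal (\<bar>f y\<bar> ^ Suc m) \<partial>lborel)"
  proof (rule nn_integral_cong)
    fix y :: "real^'n"
    have "(\<integral>\<^sup>+x. ennreal (mollifier e (x - y)) \<partial>lborel) = ennreal 1"
      using integrable_mollifier(2)[OF e, of y] integral_mollifier(2)[OF e, of y] e
      by (subst nn_integral_eq_integral) (auto simp: mollifier_nonneg)
    then show "ennreal (\<bar>f y\<bar> ^ Suc m) * (\<integral>\<^sup>+x. ennreal (mollifier e (x - y)) \<partial>lborel) = ennreal (\<bar>f y\<bar> ^ Suc m)"
      by simp
  qed
  finally show ?thesis .
qed

lemma abs_mollify_diff_le:
  fixes f :: "real^'n::finite \<Rightarrow> real"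
  assumes f: "integrable lborel f" and e: "0 < e"
    and near: "\<And>y. norm (x - y) < e \<Longrightarrow> \<bar>f y - a\<bar> \<le> w"
  shows "\<bar>mollify e f x - a\<bar> \<le> w"
proof -
  let ?k = "\<lambda>y. mollifier e (x - y)"
  note int1 = integrable_mult_mollifier[OF f e, of x] and int0 = integrable_mollifier(1)[OF e, of x]
  have "mollify e f x - a = mollify e f x - a * (LINT y|lborel. ?k y)"
    using integral_mollifier(1)[OF e, of x] by simp
  also have "\<dots> = (LINT y|lborel. f y * ?k y - a * ?k y)"
    unfolding mollify_def using int1 int0 by simp
  finally have "\<bar>mollify e f x - a\<bar> = \<bar>LINT y|lborel. f y * ?k y - a * ?k y\<bar>" by simp
  also have "\<dots> \<le> (LINT y|lborel. \<bar>f y * ?k y - a * ?k y\<bar>)" by (rule integral_abs_bound)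
  also have "\<dots> \<le> (LINT y|lborel. w * ?k y)"
  proof (rule Bochner_Integration.integral_mono)
    show "integrable lborel (\<lambda>y. \<bar>f y * ?k y - a * ?k y\<bar>)"
      using int1 int0 by (intro integrable_abs Bochner_Integration.integrable_diff integrable_mult_right)
    show "integrable lborel (\<lambda>y. w * ?k y)" using int0 by (rule integrable_mult_right)
    fix y
    show "\<bar>f y * ?k y - a * ?k y\<bar> \<le> w * ?k y"
    proof (cases "norm (x - y) < e")
      case True
      have "\<bar>f y * ?k y - a * ?k y\<bar> = \<bar>f y - a\<bar> * ?k y"
        using mollifier_nonneg[OF e, of "x - y"] by (simp add: left_diff_distrib[symmetric] abs_mult)
      also have "\<dots> \<le> w * ?k y"
        using near[OF True] mollifier_nonneg[OF e, of "x - y"] by (rule mult_right_mono)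
      finally show ?thesis .
    next
      case False
      then have "?k y = 0" using e by (intro mollifier_eq_0) auto
      then show ?thesis by simp
    qed
  qed
  also have "\<dots> = w" using integral_mollifier(1)[OF e, of x] by simp
  finally show ?thesis .
qed

lemma add_power_le:
  fixes a b :: real
  assumes "0 \<le> a" "0 \<le> b"
  shows "(a + b) ^ p \<le> 2 ^ p * (a ^ p + b ^ p)"
proof -
  have "(a + b) ^ p \<le> (2 * max a b) ^ p" using assms by (intro power_mono) auto
  also have "\<dots> = 2 ^ p * max a b ^ p" by (simp add: power_mult_distrib)
  also have "\<dots> \<le> 2 ^ p * (a ^ p + b ^ p)"
    using assms by (intro mult_left_mono) (auto simp: max_def)
  finally show ?thesis .
qed

lemma nn_integral_truncation_tendsto:
  fixes f :: "real^'n::finite \<Rightarrow> real"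
  assumes f [measurable]: "f \<in> borel_measurable borel" and fp: "integrable lborel (\<lambda>x. \<bar>f x\<bar> ^ Suc m)"
  shows "(\<lambda>k. \<integral>\<^sup>+x. ennreal (\<bar>f x - max (- real k) (min (real k) (f x))\<bar> ^ Suc m) \<partial>lborel) \<longlonglongrightarrow> 0"
proof -
  have "(\<lambda>k. \<integral>\<^sup>+x. ennreal (\<bar>f x - max (- real k) (min (real k) (f x))\<bar> ^ Suc m) \<partial>lborel)
      \<longlonglongrightarrow> (\<integral>\<^sup>+x. 0 \<partial>(lborel :: (real^'n) measure))"
  proof (rule nn_integral_dominated_convergence[where w="\<lambda>x. ennreal (\<bar>f x\<bar> ^ Suc m)"])
    show "(\<integral>\<^sup>+x. ennreal (\<bar>f x\<bar> ^ Suc m) \<partial>lborel) < \<infinity>"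
      using fp by (subst nn_integral_eq_integral) auto
    show "AE x in lborel. ennreal (\<bar>f x - max (- real k) (min (real k) (f x))\<bar> ^ Suc m) \<le> ennreal (\<bar>f x\<bar> ^ Suc m)" for k
      by (intro AE_I2 ennreal_leI power_mono) auto
    have "(\<lambda>k. ennreal (\<bar>f x - max (- real k) (min (real k) (f x))\<bar> ^ Suc m)) \<longlonglongrightarrow> 0" for x
    proof (rule tendsto_eventually)
      obtain K :: nat where "\<bar>f x\<bar> \<le> real K" using real_arch_simple by blast
      then show "\<forall>\<^sub>F k in sequentially. ennreal (\<bar>f x - max (- real k) (min (real k) (f x))\<bar> ^ Suc m) = 0"
        by (intro eventually_sequentiallyI[of K]) auto
    qed
    then show "AE x in lborel. (\<lambda>k. ennreal (\<bar>f x - max (- real k) (min (real k) (f x))\<bar> ^ Suc m)) \<longlonglongrightarrow> 0"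
      by (rule AE_I2)
  qed measurable
  then show ?thesis by simp
qed

text \<open>Measurable functions are a.e. limits of continuous ones; clamping the approximants to
  \<open>[-B, B]\<close> keeps the limit and supplies a dominating constant on the ball.\<close>

lemma bounded_approx_continuous:
  fixes f :: "real^'n::finite \<Rightarrow> real"
  assumes f [measurable]: "f \<in> borel_measurable borel" and b: "\<And>x. \<bar>f x\<bar> \<le> B" and e: "0 < e"
  obtains g where "continuous_on UNIV g"
    "(\<integral>\<^sup>+x. ennreal (\<bar>f x - g x\<bar> ^ Suc m) * indicator (cball c r) x \<partial>lborel) < ennreal e"
proof -
  have B: "0 \<le> B" using b[of 0] by linarith
  have [measurable]: "cball c r \<in> sets borel" by simp
  have "f measurable_on UNIV"
    by (rule lebesgue_measurable_imp_measurable_on_real) (auto intro: measurable_completion f)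
  then obtain N g where N: "negligible N" and g: "\<And>n. continuous_on UNIV (g n)"
    and lim: "\<And>x. x \<notin> N \<Longrightarrow> (\<lambda>n. g n x) \<longlonglongrightarrow> f x"
    unfolding measurable_on_def by auto
  define G where "G = (\<lambda>n x. max (- B) (min B (g n x)))"
  have cG: "continuous_on UNIV (G n)" for n
    unfolding G_def using g by (intro continuous_intros)
  have [measurable]: "G n \<in> borel_measurable borel" for n
    using cG by (rule borel_measurable_continuous_onI)
  have limG: "(\<lambda>n. G n x) \<longlonglongrightarrow> f x" if "x \<notin> N" for x
  proof -
    have "(\<lambda>n. G n x) \<longlonglongrightarrow> max (- B) (min B (f x))"
      unfolding G_def by (intro tendsto_intros lim that)
    also have "max (- B) (min B (f x)) = f x" using b[of x] by auto
    finally show ?thesis .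
  qed
  have aeN: "AE x in lborel. x \<notin> N"
  proof -
    have "AE x in lebesgue. x \<notin> N"
      using N by (auto simp: negligible_iff_null_sets intro: AE_not_in)
    then show ?thesis by (simp add: AE_completion_iff)
  qed
  have "(\<lambda>n. \<integral>\<^sup>+x. ennreal (\<bar>f x - G n x\<bar> ^ Suc m) * indicator (cball c r) x \<partial>lborel)
      \<longlonglongrightarrow> (\<integral>\<^sup>+x. 0 \<partial>(lborel :: (real^'n) measure))"
  proof (rule nn_integral_dominated_convergence[where w="\<lambda>x. ennreal ((2 * B) ^ Suc m) * indicator (cball c r) x"])
    show "(\<integral>\<^sup>+x. ennreal ((2 * B) ^ Suc m) * indicator (cball c r) x \<partial>lborel) < \<infinity>"
      using emeasure_lborel_cball_finite[of c r]
      by (simp add: nn_integral_cmult_indicator ennreal_mult_less_top del: power_Suc)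
    show "AE x in lborel. ennreal (\<bar>f x - G n x\<bar> ^ Suc m) * indicator (cball c r) x
        \<le> ennreal ((2 * B) ^ Suc m) * indicator (cball c r) x" for n
    proof (intro AE_I2 mult_right_mono ennreal_leI power_mono)
      fix x
      show "\<bar>f x - G n x\<bar> \<le> 2 * B" using b[of x] B by (auto simp: G_def)
    qed auto
    show "AE x in lborel. (\<lambda>n. ennreal (\<bar>f x - G n x\<bar> ^ Suc m) * indicator (cball c r) x) \<longlonglongrightarrow> 0"
      using aeN
    proof eventually_elim
      case (elim x)
      have "(\<lambda>n. \<bar>f x - G n x\<bar> ^ Suc m) \<longlonglongrightarrow> \<bar>f x - f x\<bar> ^ Suc m"
        by (intro tendsto_intros limG elim)
      then have "(\<lambda>n. ennreal (\<bar>f x - G n x\<bar> ^ Suc m)) \<longlonglongrightarrow> ennreal 0"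
        by (intro tendsto_ennrealI) simp
      then show ?case by (cases "x \<in> cball c r") simp_all
    qed
  qed measurable
  then have "\<forall>\<^sub>F n in sequentially. (\<integral>\<^sup>+x. ennreal (\<bar>f x - G n x\<bar> ^ Suc m) * indicator (cball c r) x \<partial>lborel) < ennreal e"
    using e by (intro order_tendstoD(2)) auto
  then obtain n where "(\<integral>\<^sup>+x. ennreal (\<bar>f x - G n x\<bar> ^ Suc m) * indicator (cball c r) x \<partial>lborel) < ennreal e"
    by (auto simp: eventually_sequentially)
  then show ?thesis using that cG by blast
qed

lemma Lp_approx_continuous:
  fixes f :: "real^'n::finite \<Rightarrow> real"
  assumes f [measurable]: "f \<in> borel_measurable borel" and fp: "integrable lborel (\<lambda>x. \<bar>f x\<bar> ^ Suc m)" and e: "0 < e"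
  obtains g where "continuous_on UNIV g"
    "(\<integral>\<^sup>+x. ennreal (\<bar>f x - g x\<bar> ^ Suc m) * indicator (cball c r) x \<partial>lborel) \<le> ennreal e"
proof -
  \<comment> \<open>Half of \<open>e\<close> for the truncation and half for the continuous
    approximation, divided by the factor lost in \<open>add_power_le\<close>.\<close>
  define d where "d = e / (2 * 2 ^ Suc m)"
  have d: "0 < d" using e by (simp add: d_def)
  have [measurable]: "cball c r \<in> sets borel" by simp
  let ?t = "\<lambda>k x. max (- real k) (min (real k) (f x))"
  have "\<forall>\<^sub>F k in sequentially. (\<integral>\<^sup>+x. ennreal (\<bar>f x - ?t k x\<bar> ^ Suc m) \<partial>lborel) < ennreal d"
    using d by (intro order_tendstoD(2)[OF nn_integral_truncation_tendsto[OF f fp]]) auto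
  then obtain k where k: "(\<integral>\<^sup>+x. ennreal (\<bar>f x - ?t k x\<bar> ^ Suc m) \<partial>lborel) < ennreal d"
    by (auto simp: eventually_sequentially)
  have "?t k \<in> borel_measurable borel" by measurable
  moreover have "\<bar>?t k x\<bar> \<le> real k" for x by auto
  ultimately obtain g where g: "continuous_on UNIV g"
    and gk: "(\<integral>\<^sup>+x. ennreal (\<bar>?t k x - g x\<bar> ^ Suc m) * indicator (cball c r) x \<partial>lborel) < ennreal d"
    by (rule bounded_approx_continuous[OF _ _ d])
  have [measurable]: "g \<in> borel_measurable borel"
    using g by (rule borel_measurable_continuous_onI)
  have "(\<integral>\<^sup>+x. ennreal (\<bar>f x - g x\<bar> ^ Suc m) * indicator (cball c r) x \<partial>lborel)
      \<le> (\<integral>\<^sup>+x. ennreal (2 ^ Suc m) * (ennreal (\<bar>f x - ?t k x\<bar> ^ Suc m)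
            + ennreal (\<bar>?t k x - g x\<bar> ^ Suc m) * indicator (cball c r) x) \<partial>lborel)"
  proof (rule nn_integral_mono)
    fix x
    have "\<bar>f x - g x\<bar> ^ Suc m \<le> (\<bar>f x - ?t k x\<bar> + \<bar>?t k x - g x\<bar>) ^ Suc m"
      by (intro power_mono) auto
    also have "\<dots> \<le> 2 ^ Suc m * (\<bar>f x - ?t k x\<bar> ^ Suc m + \<bar>?t k x - g x\<bar> ^ Suc m)"
      by (rule add_power_le) auto
    finally have "ennreal (\<bar>f x - g x\<bar> ^ Suc m) \<le> ennreal (2 ^ Suc m * (\<bar>f x - ?t k x\<bar> ^ Suc m + \<bar>?t k x - g x\<bar> ^ Suc m))"
      by (rule ennreal_leI)
    also have "\<dots> = ennreal (2 ^ Suc m) * (ennreal (\<bar>f x - ?t k x\<bar> ^ Suc m) + ennreal (\<bar>?t k x - g x\<bar> ^ Suc m))"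
      by (subst ennreal_mult, simp, simp, subst ennreal_plus) auto
    finally have "ennreal (\<bar>f x - g x\<bar> ^ Suc m) \<le> ennreal (2 ^ Suc m) * (ennreal (\<bar>f x - ?t k x\<bar> ^ Suc m) + ennreal (\<bar>?t k x - g x\<bar> ^ Suc m))" .
    then show "ennreal (\<bar>f x - g x\<bar> ^ Suc m) * indicator (cball c r) x \<le> ennreal (2 ^ Suc m) * (ennreal (\<bar>f x - ?t k x\<bar> ^ Suc m)
            + ennreal (\<bar>?t k x - g x\<bar> ^ Suc m) * indicator (cball c r) x)"
      by (cases "x \<in> cball c r") auto
  qed
  also have "\<dots> = ennreal (2 ^ Suc m) * ((\<integral>\<^sup>+x. ennreal (\<bar>f x - ?t k x\<bar> ^ Suc m) \<partial>lborel)
      + (\<integral>\<^sup>+x. ennreal (\<bar>?t k x - g x\<bar> ^ Suc m) * indicator (cball c r) x \<partial>lborel))"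
    by (subst nn_integral_cmult, measurable, subst nn_integral_add) measurable
  also have "\<dots> \<le> ennreal (2 ^ Suc m) * (ennreal d + ennreal d)"
    using k gk by (intro mult_left_mono add_mono less_imp_le) auto
  also have "\<dots> = ennreal (2 ^ Suc m * (d + d))"
    using d by (simp flip: ennreal_mult ennreal_plus)
  also have "2 ^ Suc m * (d + d) = e" by (simp add: d_def field_simps)
  finally show ?thesis using that g by blast
qed

text \<open>Density argument: near the ball \<open>f\<close> is a continuous function plus a
  remainder small in L^p. Uniform continuity settles the first part,
  \<open>nn_integral_mollify_power_le\<close> the second. The ball of radius \<open>r + 1\<close>
  contains everything that a kernel of width below 1 sees.\<close>

lemma mollify_Lp_convergence:
  fixes f :: "real^'n::finite \<Rightarrow> real"
  assumes f: "integrable lborel f" and fp: "integrable lborel (\<lambda>x. \<bar>f x\<bar> ^ Suc m)" and e: "0 < e"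
  obtains d where "0 < d"
    "\<And>t. 0 < t \<Longrightarrow> t < d \<Longrightarrow>
      (\<integral>\<^sup>+x. ennreal (\<bar>mollify t f x - f x\<bar> ^ Suc m) * indicator (cball c r) x \<partial>lborel) \<le> ennreal e"
proof -
  have fb [measurable]: "f \<in> borel_measurable borel" using f by auto
  have [measurable]: "cball c r \<in> sets borel" by simp
  \<comment> \<open>Two uses of \<open>add_power_le\<close> cost \<open>2 ^ Suc m\<close> each;
    three error terms remain, and each is allotted \<open>e1\<close>.\<close>
  define q where "q = (4::real) ^ Suc m"
  define V where "V = measure lborel (cball c r)"
  have q: "0 < q" by (simp add: q_def)
  have V: "0 \<le> V" "emeasure lborel (cball c r) = ennreal V"
    using emeasure_lborel_cball_finite[of c r] by (simp_all add: V_def emeasure_eq_ennreal_measure less_top)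
  define e1 where "e1 = e / (3 * q)"
  have e1: "0 < e1" using e q by (simp add: e1_def)
  let ?K = "cball c (r + 1)"
  obtain g where g: "continuous_on UNIV g"
    and gf: "(\<integral>\<^sup>+x. ennreal (\<bar>f x - g x\<bar> ^ Suc m) * indicator ?K x \<partial>lborel) \<le> ennreal e1"
    by (rule Lp_approx_continuous[OF fb fp e1])
  have [measurable]: "g \<in> borel_measurable borel"
    using g by (rule borel_measurable_continuous_onI)
  \<comment> \<open>Bounded by 1 so that a power of \<open>w\<close> is at most \<open>w\<close>,
    and small enough that integrating the constant \<open>w\<close> over the ball costs at most
    \<open>e1\<close>.\<close>
  define w where "w = min 1 (e1 / (V + 1))"
  have w: "0 < w" "w \<le> 1" "w * V \<le> e1"
    using e1 V(1) by (auto simp: w_def min_def field_simps mult_less_0_iff)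
  have "uniformly_continuous_on ?K g"
    by (intro compact_uniformly_continuous continuous_on_subset[OF g]) auto
  then obtain d0 where d0: "0 < d0" "\<And>x y. x \<in> ?K \<Longrightarrow> y \<in> ?K \<Longrightarrow> dist y x < d0 \<Longrightarrow> dist (g y) (g x) < w"
    unfolding uniformly_continuous_on_def using w(1) by meson
  define g1 where "g1 = (\<lambda>x. indicator ?K x *\<^sub>R g x)"
  define h where "h = (\<lambda>x. indicator ?K x *\<^sub>R f x - g1 x)"
  have ig: "integrable lborel g1"
    unfolding g1_def by (intro borel_integrable_compact continuous_on_subset[OF g]) auto
  have ih: "integrable lborel h"
    unfolding h_def by (intro Bochner_Integration.integrable_diff ig integrable_mult_indicator f) auto
  have hK: "ennreal (\<bar>h x\<bar> ^ Suc m) = ennreal (\<bar>f x - g x\<bar> ^ Suc m) * indicator ?K x" for x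
    by (auto simp: h_def g1_def indicator_def)
  have nh: "(\<integral>\<^sup>+x. ennreal (\<bar>h x\<bar> ^ Suc m) \<partial>lborel) \<le> ennreal e1"
    using gf by (simp only: hK)
  have ihp: "integrable lborel (\<lambda>x. \<bar>h x\<bar> ^ Suc m)"
  proof (rule integrableI_bounded)
    show "(\<lambda>x. \<bar>h x\<bar> ^ Suc m) \<in> borel_measurable lborel" using ih by measurable
    show "(\<integral>\<^sup>+x. ennreal (norm (\<bar>h x\<bar> ^ Suc m)) \<partial>lborel) < \<infinity>"
      using nh by (simp add: power_abs) (metis ennreal_less_top order_le_less_trans)
  qed
  show ?thesis
  proof (rule that[of "min 1 d0"])
    show "0 < min 1 d0" using d0(1) by simp
    fix t assume t: "0 < t" "t < min 1 d0"
    have pt: "\<bar>mollify t f x - f x\<bar> ^ Suc m \<le> q * (w + \<bar>mollify t h x\<bar> ^ Suc m + \<bar>h x\<bar> ^ Suc m)"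
      if x: "x \<in> cball c r" for x
    proof -
      have xK: "x \<in> ?K" using x by auto
      have yK: "y \<in> ?K" if "norm (x - y) < t" for y
        using x that t dist_triangle[of c y x] by (auto simp: dist_norm)
      have "mollify t f x = (LINT y|lborel. (g1 y + h y) * mollifier t (x - y))"
        unfolding mollify_def
      proof (rule Bochner_Integration.integral_cong[OF refl])
        fix y
        show "f y * mollifier t (x - y) = (g1 y + h y) * mollifier t (x - y)"
        proof (cases "norm (x - y) < t")
          case True
          then show ?thesis using yK by (simp add: h_def)
        next
          case False
          then have "mollifier t (x - y) = 0" using t by (intro mollifier_eq_0) auto
          then show ?thesis by simp
        qed
      qed
      also have "\<dots> = mollify t g1 x + mollify t h x"
        using integrable_mult_mollifier[OF ig t(1), of x] integrable_mult_mollifier[OF ih t(1), of x]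
        by (simp add: mollify_def distrib_right)
      finally have "mollify t f x - f x = (mollify t g1 x - g x) + mollify t h x - h x"
        using xK by (simp add: h_def g1_def)
      moreover have "\<bar>mollify t g1 x - g x\<bar> \<le> w"
      proof (rule abs_mollify_diff_le[OF ig t(1)])
        fix y assume y: "norm (x - y) < t"
        then have "dist (g y) (g x) < w"
          using t yK[OF y] xK by (intro d0(2)) (auto simp: dist_norm norm_minus_commute)
        then show "\<bar>g1 y - g x\<bar> \<le> w" using yK[OF y] by (simp add: g1_def dist_real_def)
      qed
      ultimately have "\<bar>mollify t f x - f x\<bar> \<le> w + (\<bar>mollify t h x\<bar> + \<bar>h x\<bar>)" by linarith
      then have "\<bar>mollify t f x - f x\<bar> ^ Suc m \<le> (w + (\<bar>mollify t h x\<bar> + \<bar>h x\<bar>)) ^ Suc m"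
        by (rule power_mono) auto
      also have "\<dots> \<le> 2 ^ Suc m * (w ^ Suc m + (\<bar>mollify t h x\<bar> + \<bar>h x\<bar>) ^ Suc m)"
        using w by (intro add_power_le) auto
      also have "\<dots> \<le> 2 ^ Suc m * (w ^ Suc m + 2 ^ Suc m * (\<bar>mollify t h x\<bar> ^ Suc m + \<bar>h x\<bar> ^ Suc m))"
        by (intro mult_left_mono add_left_mono add_power_le) auto
      also have "\<dots> \<le> 2 ^ Suc m * (2 ^ Suc m * w + 2 ^ Suc m * (\<bar>mollify t h x\<bar> ^ Suc m + \<bar>h x\<bar> ^ Suc m))"
      proof -
        have "w ^ Suc m \<le> w" using w power_le_one[of w m] by (simp add: mult_left_le)
        also have "w \<le> 2 ^ Suc m * w" using w one_le_power[of "2::real" "Suc m"] by (simp add: mult_le_cancel_right1 del: power_Suc)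
        finally show ?thesis by (intro mult_left_mono add_right_mono) auto
      qed
      also have "\<dots> = q * (w + \<bar>mollify t h x\<bar> ^ Suc m + \<bar>h x\<bar> ^ Suc m)"
      proof -
        have "q = 2 ^ Suc m * 2 ^ Suc m" by (simp only: q_def power_mult_distrib[symmetric]) simp
        then show ?thesis by (simp only: algebra_simps)
      qed
      finally show ?thesis .
    qed
    have [measurable]: "mollify t h \<in> borel_measurable borel"
      using continuous_on_mollify[OF ih t(1)] by (rule borel_measurable_continuous_onI)
    have [measurable]: "h \<in> borel_measurable borel" using ih by auto
    have "(\<integral>\<^sup>+x. ennreal (\<bar>mollify t f x - f x\<bar> ^ Suc m) * indicator (cball c r) x \<partial>lborel)
      \<le> (\<integral>\<^sup>+x. ennreal q * (ennreal w * indicator (cball c r) x + ennreal (\<bar>mollify t h x\<bar> ^ Suc m) + ennreal (\<bar>h x\<bar> ^ Suc m)) \<partial>lborel)"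
    proof (rule nn_integral_mono)
      fix x
      show "ennreal (\<bar>mollify t f x - f x\<bar> ^ Suc m) * indicator (cball c r) x
        \<le> ennreal q * (ennreal w * indicator (cball c r) x + ennreal (\<bar>mollify t h x\<bar> ^ Suc m) + ennreal (\<bar>h x\<bar> ^ Suc m))"
      proof (cases "x \<in> cball c r")
        case True
        have "ennreal (\<bar>mollify t f x - f x\<bar> ^ Suc m) \<le> ennreal (q * (w + \<bar>mollify t h x\<bar> ^ Suc m + \<bar>h x\<bar> ^ Suc m))"
          by (rule ennreal_leI[OF pt[OF True]])
        also have "\<dots> = ennreal q * (ennreal w + ennreal (\<bar>mollify t h x\<bar> ^ Suc m) + ennreal (\<bar>h x\<bar> ^ Suc m))"
          using q w by (simp del: power_Suc flip: ennreal_mult ennreal_plus)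
        finally show ?thesis using True by simp
      qed simp
    qed
    also have "\<dots> = ennreal q * (ennreal w * emeasure lborel (cball c r) + (\<integral>\<^sup>+x. ennreal (\<bar>mollify t h x\<bar> ^ Suc m) \<partial>lborel) + (\<integral>\<^sup>+x. ennreal (\<bar>h x\<bar> ^ Suc m) \<partial>lborel))"
      by (simp add: nn_integral_cmult nn_integral_add nn_integral_cmult_indicator del: power_Suc)
    also have "\<dots> \<le> ennreal q * (ennreal e1 + ennreal e1 + ennreal e1)"
    proof (intro mult_left_mono add_mono nh)
      show "ennreal w * emeasure lborel (cball c r) \<le> ennreal e1"
        using w V by (simp add: ennreal_leI flip: ennreal_mult)
      show "(\<integral>\<^sup>+x. ennreal (\<bar>mollify t h x\<bar> ^ Suc m) \<partial>lborel) \<le> ennreal e1"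
        by (rule order_trans[OF nn_integral_mollify_power_le[OF ih ihp t(1)] nh])
    qed auto
    also have "\<dots> = ennreal (q * (e1 + e1 + e1))"
      using q e1 by (simp flip: ennreal_mult ennreal_plus)
    also have "q * (e1 + e1 + e1) = e" using q by (simp add: e1_def)
    finally show "(\<integral>\<^sup>+x. ennreal (\<bar>mollify t f x - f x\<bar> ^ Suc m) * indicator (cball c r) x \<partial>lborel) \<le> ennreal e" .
  qed
qed

section \<open>Second derivatives and positive semidefinite matrices\<close>

lemma inner_mult_vec:
  fixes B :: "real^'n::finite^'n"
  shows "x \<bullet> (B *v y) = (\<Sum>i\<in>UNIV. \<Sum>j\<in>UNIV. B $ i $ j * (x $ i * y $ j))"
  by (simp add: inner_vec_def matrix_vector_mult_def sum_distrib_left mult_ac)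

definition psd :: "real^'n::finite^'n \<Rightarrow> bool" where
  "psd B \<longleftrightarrow> (\<forall>i j. B $ i $ j = B $ j $ i) \<and> (\<forall>x. 0 \<le> x \<bullet> (B *v x))"

lemma quadratic_form_axis_add:
  fixes B :: "real^'n::finite^'n"
  shows "(s *\<^sub>R axis i 1 + r *\<^sub>R axis j 1) \<bullet> (B *v (s *\<^sub>R axis i 1 + r *\<^sub>R axis j 1))
    = s\<^sup>2 * B $ i $ i + r\<^sup>2 * B $ j $ j + s * r * (B $ i $ j + B $ j $ i)"
  by (simp add: matrix_vector_right_distrib matrix_vector_mult_scaleR inner_add_left
      matrix_vector_mul_component inner_axis' inner_axis row_def power2_eq_square algebra_simps
      matrix_vector_mult_basis column_def)

lemma psd_diag_nonneg: "psd B \<Longrightarrow> 0 \<le> B $ i $ i"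
  using quadratic_form_axis_add[of 1 i 0 i B] by (auto simp: psd_def) (metis power_one mult_1)

text \<open>The form is tested on the sum and on the difference of two basis vectors.\<close>

lemma psd_entry_le_diag:
  assumes "psd B" shows "2 * \<bar>B $ i $ j\<bar> \<le> B $ i $ i + B $ j $ j"
proof -
  have "0 \<le> B $ i $ i + B $ j $ j + s * 2 * B $ i $ j" if "s = 1 \<or> s = -1" for s
  proof -
    have "0 \<le> (s *\<^sub>R axis i 1 + 1 *\<^sub>R axis j 1) \<bullet> (B *v (s *\<^sub>R axis i 1 + 1 *\<^sub>R axis j 1))"
      using assms by (simp add: psd_def)
    then show ?thesis
      unfolding quadratic_form_axis_add using that assms by (auto simp: psd_def)
  qed
  from this[of 1] this[of "-1"] show ?thesis by simp
qed

lemma psd_entry_le_trace: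
  assumes "psd B" shows "\<bar>B $ i $ j\<bar> \<le> trace B"
proof -
  have d: "B $ k $ k \<le> trace B" for k
    unfolding trace_def using assms by (intro member_le_sum) (auto intro: psd_diag_nonneg)
  show ?thesis using psd_entry_le_diag[OF assms, of i j] d[of i] d[of j] by linarith
qed

text \<open>With a zero diagonal entry the form on \<open>s *\<^sub>R axis i 1 + axis j 1\<close> is
  affine in \<open>s\<close>, so it takes negative values unless the mixed entry vanishes.\<close>

lemma psd_diag_zero:
  assumes B: "psd B" and z: "B $ i $ i = 0" shows "B $ i $ j = 0"
proof (rule ccontr)
  assume n: "B $ i $ j \<noteq> 0"
  define s where "s = - (B $ j $ j + 1) / (2 * B $ i $ j)"
  have "0 \<le> (s *\<^sub>R axis i 1 + 1 *\<^sub>R axis j 1) \<bullet> (B *v (s *\<^sub>R axis i 1 + 1 *\<^sub>R axis j 1))"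
    using B by (simp add: psd_def)
  also have "\<dots> = B $ j $ j + 2 * s * B $ i $ j"
    unfolding quadratic_form_axis_add using B z by (simp add: psd_def)
  also have "\<dots> = -1" using n by (simp add: s_def field_simps)
  finally show False by simp
qed

text \<open>Subtracting a rank-one matrix clears one diagonal entry of \<^term>\<open>B\<close> (Lagrange reduction), which
  replaces the spectral theorem here.\<close>

lemma psd_contraction_nonneg:
  fixes C B :: "real^'n::finite^'n"
  assumes C: "\<And>x. 0 \<le> x \<bullet> (C *v x)" and B: "psd B"
  shows "0 \<le> (\<Sum>i\<in>UNIV. \<Sum>j\<in>UNIV. C $ i $ j * B $ i $ j)"
  using B
proof (induction "card {i. B $ i $ i \<noteq> 0}" arbitrary: B rule: less_induct)
  case (less B)
  note B = less.prems
  show ?case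
  proof (cases "\<exists>p. B $ p $ p \<noteq> 0")
    case False
    then have "B $ i $ j = 0" for i j using psd_diag_zero[OF B] by blast
    then show ?thesis by simp
  next
    case True
    then obtain p where p: "B $ p $ p \<noteq> 0" by blast
    define v where "v = column p B"
    define b where "b = B $ p $ p"
    have b: "0 < b" using psd_diag_nonneg[OF B, of p] p by (simp add: b_def)
    define B' where "B' = (\<chi> i j. B $ i $ j - v $ i * v $ j / b)"
    have sym: "B $ i $ j = B $ j $ i" for i j using B by (simp add: psd_def)
    have qf: "x \<bullet> (B' *v x) = x \<bullet> (B *v x) - (x \<bullet> v)\<^sup>2 / b" for x
      unfolding inner_mult_vec
      by (simp add: B'_def inner_vec_def left_diff_distrib right_diff_distrib sum_subtractf power2_eq_square
          sum_product sum_divide_distrib mult_ac)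
    have Bp: "B *v axis p 1 = v" by (simp add: v_def matrix_vector_mult_basis)
    have pB: "axis p 1 \<bullet> (B *v x) = x \<bullet> v" for x
      unfolding inner_axis' using sym by (simp add: v_def column_def matrix_vector_mult_def inner_vec_def mult.commute)
    have "0 \<le> x \<bullet> (B' *v x)" for x
    proof -
      \<comment> \<open>Completing the square: \<open>?y\<close> minimises the form of
        \<open>B\<close> on the line through \<open>x\<close> in direction \<open>axis p 1\<close>,
        and the minimum is the form of \<open>B'\<close> at \<open>x\<close>.\<close>
      let ?y = "x - ((x \<bullet> v) / b) *\<^sub>R axis p 1"
      have vp: "axis p 1 \<bullet> v = b" by (simp add: inner_axis' v_def column_def b_def)
      have "?y \<bullet> (B *v ?y) = x \<bullet> (B *v x) - (x \<bullet> v)\<^sup>2 / b"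
        using b by (simp add: matrix_vector_mult_diff_distrib matrix_vector_mult_scaleR Bp pB vp inner_diff_left inner_diff_right
            power2_eq_square field_simps)
      moreover have "0 \<le> ?y \<bullet> (B *v ?y)" using B by (simp add: psd_def)
      ultimately show ?thesis unfolding qf by simp
    qed
    then have B': "psd B'" by (simp add: psd_def B'_def sym mult.commute)
    \<comment> \<open>A zero diagonal entry has a zero row, so the reduction leaves it zero; thus
      the number of nonzero ones strictly drops.\<close>
    have z: "B' $ i $ i = 0" if "B $ i $ i = 0" for i
      using psd_diag_zero[OF B that] that by (simp add: B'_def v_def column_def)
    have "{i. B' $ i $ i \<noteq> 0} \<subset> {i. B $ i $ i \<noteq> 0}"
    proof
      show "{i. B' $ i $ i \<noteq> 0} \<subseteq> {i. B $ i $ i \<noteq> 0}" using z by blast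
      have "B' $ p $ p = 0" using b by (simp add: B'_def v_def column_def b_def)
      then show "{i. B' $ i $ i \<noteq> 0} \<noteq> {i. B $ i $ i \<noteq> 0}" using p by blast
    qed
    then have "card {i. B' $ i $ i \<noteq> 0} < card {i. B $ i $ i \<noteq> 0}"
      by (intro psubset_card_mono) auto
    from less.hyps[OF this B'] have "0 \<le> (\<Sum>i\<in>UNIV. \<Sum>j\<in>UNIV. C $ i $ j * B' $ i $ j)" .
    also have "\<dots> = (\<Sum>i\<in>UNIV. \<Sum>j\<in>UNIV. C $ i $ j * B $ i $ j) - (v \<bullet> (C *v v)) / b"
      by (simp add: inner_mult_vec B'_def right_diff_distrib sum_subtractf sum_divide_distrib)
    also have "\<dots> \<le> (\<Sum>i\<in>UNIV. \<Sum>j\<in>UNIV. C $ i $ j * B $ i $ j)"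
      using C[of v] b by simp
    finally show ?thesis .
  qed
qed

text \<open>The mixed second difference along \<^term>\<open>u\<close> and \<^term>\<open>v\<close> is symmetric, and by the mean value
  theorem it is asymptotic to both \<^term>\<open>t\<^sup>2 * (u \<bullet> (J *v v))\<close> and \<^term>\<open>t\<^sup>2 * (v \<bullet> (J *v u))\<close>.\<close>

lemma second_difference_bound:
  fixes w :: "real^'n::finite \<Rightarrow> real"
  assumes d: "0 < d" and g: "\<And>y. y \<in> ball x d \<Longrightarrow> (w has_derivative (\<lambda>h. G y \<bullet> h)) (at y)"
    and J: "(G has_derivative (\<lambda>h. J *v h)) (at x)" and e: "0 < e"
  shows "\<forall>\<^sub>F t in at_right 0. \<bar>w (x + t *\<^sub>R u + t *\<^sub>R v) - w (x + t *\<^sub>R u) - w (x + t *\<^sub>R v) + w x - t\<^sup>2 * (u \<bullet> (J *v v))\<bar>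
      \<le> e * t\<^sup>2"
proof -
  define M where "M = norm u + norm v + 1"
  have M: "0 < M" by (simp add: M_def add_nonneg_pos)
  \<comment> \<open>At each of two points the linearisation of \<open>G\<close> errs by at most
    \<open>e' * (t * M)\<close>; pairing with \<open>u\<close> and multiplying by \<open>t\<close>
    gives \<open>2 * e' * M * M * t\<^sup>2\<close>, which is \<open>e * t\<^sup>2\<close>.\<close>
  define e' where "e' = e / (2 * M * M)"
  have e': "0 < e'" using e M by (simp add: e'_def)
  obtain d1 where d1: "0 < d1" "\<And>y. norm (y - x) < d1 \<Longrightarrow> norm (G y - G x - J *v (y - x)) \<le> e' * norm (y - x)"
    using J e' unfolding has_derivative_at_alt by blast
  define d2 where "d2 = min d d1 / M"
  have d2: "0 < d2" using d d1 M by (simp add: d2_def)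
  show ?thesis
    unfolding eventually_at_right_field
  proof (intro exI[of _ d2] conjI allI impI d2)
    fix t :: real assume t: "0 < t" "t < d2"
    then have tM: "t * M < min d d1" using M by (simp add: d2_def pos_less_divide_eq)
    have near: "norm (s *\<^sub>R u + r *\<^sub>R v) \<le> t * M" if "0 \<le> s" "s \<le> t" "0 \<le> r" "r \<le> t" for s r
    proof -
      have "norm (s *\<^sub>R u + r *\<^sub>R v) \<le> s * norm u + r * norm v"
        using norm_triangle_ineq[of "s *\<^sub>R u" "r *\<^sub>R v"] that by simp
      also have "\<dots> \<le> t * norm u + t * norm v" using that by (intro add_mono mult_right_mono) auto
      also have "\<dots> \<le> t * M" using t by (simp add: M_def algebra_simps)
      finally show ?thesis .
    qed
    have der: "(w has_derivative (\<lambda>h. G (x + (s *\<^sub>R u + r *\<^sub>R v)) \<bullet> h)) (at (x + (s *\<^sub>R u + r *\<^sub>R v)))"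
      if "0 \<le> s" "s \<le> t" "0 \<le> r" "r \<le> t" for s r
    proof -
      have "x + a \<in> ball x d" if "norm a < d" for a using that by (simp add: dist_norm)
      then show ?thesis using near[OF that] tM by (intro g) simp
    qed
    \<comment> \<open>The difference in the direction \<open>v\<close> as a function of the step
      along \<open>u\<close>; the mean value theorem in \<open>s\<close> exposes the gradient
      increment that \<open>J\<close> linearises.\<close>
    define \<psi> where "\<psi> = (\<lambda>s. w (x + (s *\<^sub>R u + t *\<^sub>R v)) - w (x + (s *\<^sub>R u + 0 *\<^sub>R v)))"
    have d\<psi>: "(\<psi> has_real_derivative ((G (x + (s *\<^sub>R u + t *\<^sub>R v)) - G (x + (s *\<^sub>R u + 0 *\<^sub>R v))) \<bullet> u)) (at s)"
      if "0 \<le> s" "s \<le> t" for s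
    proof -
      have "((\<lambda>s. w (x + (s *\<^sub>R u + r *\<^sub>R v))) has_derivative (\<lambda>h. G (x + (s *\<^sub>R u + r *\<^sub>R v)) \<bullet> (h *\<^sub>R u))) (at s)"
        if r: "0 \<le> r" "r \<le> t" for r
        by (rule has_derivative_compose[where f="\<lambda>s. x + (s *\<^sub>R u + r *\<^sub>R v)" and g=w and f'="\<lambda>h. h *\<^sub>R u", OF _ der[OF \<open>0 \<le> s\<close> \<open>s \<le> t\<close> r]]) (auto intro!: derivative_eq_intros)
      from this[of t] this[of 0] t
      have "((\<lambda>s. w (x + (s *\<^sub>R u + t *\<^sub>R v))) has_real_derivative G (x + (s *\<^sub>R u + t *\<^sub>R v)) \<bullet> u) (at s)"
        "((\<lambda>s. w (x + (s *\<^sub>R u + 0 *\<^sub>R v))) has_real_derivative G (x + (s *\<^sub>R u + 0 *\<^sub>R v)) \<bullet> u) (at s)"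
        by (simp_all add: has_field_derivative_def mult.commute[of _ "_ \<bullet> _"])
      from DERIV_diff[OF this] show ?thesis
        unfolding \<psi>_def by (simp add: inner_diff_left)
    qed
    have "\<exists>z>0. z < t \<and> \<psi> t - \<psi> 0 = (t - 0) * ((G (x + (z *\<^sub>R u + t *\<^sub>R v)) - G (x + (z *\<^sub>R u + 0 *\<^sub>R v))) \<bullet> u)"
      by (rule MVT2[OF t(1)]) (use d\<psi> in auto)
    then obtain s where s: "0 < s" "s < t"
      and eq: "\<psi> t - \<psi> 0 = t * ((G (x + (s *\<^sub>R u + t *\<^sub>R v)) - G (x + (s *\<^sub>R u + 0 *\<^sub>R v))) \<bullet> u)" by auto
    define R where "R = (\<lambda>y. G y - G x - J *v (y - x))"
    have R: "norm (R (x + (s *\<^sub>R u + r *\<^sub>R v))) \<le> e' * (t * M)" if "0 \<le> r" "r \<le> t" for r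
    proof -
      have n: "norm (s *\<^sub>R u + r *\<^sub>R v) \<le> t * M" using near s that by simp
      then have "norm (R (x + (s *\<^sub>R u + r *\<^sub>R v))) \<le> e' * norm (s *\<^sub>R u + r *\<^sub>R v)"
        using d1(2)[of "x + (s *\<^sub>R u + r *\<^sub>R v)"] tM unfolding R_def by simp
      also have "\<dots> \<le> e' * (t * M)" using n e' by simp
      finally show ?thesis .
    qed
    have diff: "G (x + (s *\<^sub>R u + t *\<^sub>R v)) - G (x + (s *\<^sub>R u + 0 *\<^sub>R v))
        = t *\<^sub>R (J *v v) + (R (x + (s *\<^sub>R u + t *\<^sub>R v)) - R (x + (s *\<^sub>R u + 0 *\<^sub>R v)))"
      by (simp add: R_def matrix_vector_right_distrib matrix_vector_mult_scaleR)
    have "w (x + t *\<^sub>R u + t *\<^sub>R v) - w (x + t *\<^sub>R u) - w (x + t *\<^sub>R v) + w x - t\<^sup>2 * (u \<bullet> (J *v v))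
        = \<psi> t - \<psi> 0 - t\<^sup>2 * (u \<bullet> (J *v v))"
      by (simp add: \<psi>_def add.assoc)
    also have "\<dots> = t * ((R (x + (s *\<^sub>R u + t *\<^sub>R v)) - R (x + (s *\<^sub>R u + 0 *\<^sub>R v))) \<bullet> u)"
      unfolding eq diff by (simp add: inner_add_left inner_commute power2_eq_square algebra_simps)
    finally have "\<bar>w (x + t *\<^sub>R u + t *\<^sub>R v) - w (x + t *\<^sub>R u) - w (x + t *\<^sub>R v) + w x - t\<^sup>2 * (u \<bullet> (J *v v))\<bar>
        = t * \<bar>(R (x + (s *\<^sub>R u + t *\<^sub>R v)) - R (x + (s *\<^sub>R u + 0 *\<^sub>R v))) \<bullet> u\<bar>"
      using t by (simp add: abs_mult)
    also have "\<dots> \<le> t * ((e' * (t * M) + e' * (t * M)) * M)"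
    proof (intro mult_left_mono)
      have "norm (R (x + (s *\<^sub>R u + t *\<^sub>R v)) - R (x + (s *\<^sub>R u + 0 *\<^sub>R v))) \<le> e' * (t * M) + e' * (t * M)"
        using R[of t] R[of 0] t norm_triangle_ineq4[of "R (x + (s *\<^sub>R u + t *\<^sub>R v))" "R (x + (s *\<^sub>R u + 0 *\<^sub>R v))"] by linarith
      then show "\<bar>(R (x + (s *\<^sub>R u + t *\<^sub>R v)) - R (x + (s *\<^sub>R u + 0 *\<^sub>R v))) \<bullet> u\<bar> \<le> (e' * (t * M) + e' * (t * M)) * M"
        using e' t M by (intro order_trans[OF Cauchy_Schwarz_ineq2] mult_mono) (auto simp: M_def)
    qed (use t in auto)
    also have "\<dots> = e * t\<^sup>2" using M by (simp add: e'_def power2_eq_square)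
    finally show "\<bar>w (x + t *\<^sub>R u + t *\<^sub>R v) - w (x + t *\<^sub>R u) - w (x + t *\<^sub>R v) + w x - t\<^sup>2 * (u \<bullet> (J *v v))\<bar> \<le> e * t\<^sup>2" .
  qed
qed

text \<open>The Jacobian of a mollified gradient is assembled from weak derivatives
  \<open>D2 i j\<close> that are not assumed symmetric in \<open>i\<close> and \<open>j\<close>; the
  symmetry at contact points that \<open>psd\<close> requires comes from here.\<close>

lemma hessian_symmetric:
  fixes w :: "real^'n::finite \<Rightarrow> real"
  assumes d: "0 < d" and g: "\<And>y. y \<in> ball x d \<Longrightarrow> (w has_derivative (\<lambda>h. G y \<bullet> h)) (at y)"
    and J: "(G has_derivative (\<lambda>h. J *v h)) (at x)"
  shows "u \<bullet> (J *v v) = v \<bullet> (J *v u)"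
proof (rule ccontr)
  assume ne: "u \<bullet> (J *v v) \<noteq> v \<bullet> (J *v u)"
  define e where "e = \<bar>u \<bullet> (J *v v) - v \<bullet> (J *v u)\<bar> / 3"
  have e: "0 < e" using ne by (simp add: e_def)
  have "\<forall>\<^sub>F t::real in at_right 0. 0 < t" by (simp add: eventually_at_right_less)
  moreover have "\<forall>\<^sub>F t in at_right 0. \<bar>w (x + t *\<^sub>R u + t *\<^sub>R v) - w (x + t *\<^sub>R u) - w (x + t *\<^sub>R v) + w x - t\<^sup>2 * (u \<bullet> (J *v v))\<bar>
      \<le> e * t\<^sup>2" for u v
    by (rule second_difference_bound[OF d _ J e]) (rule g)
  note this[of u v] this[of v u]
  ultimately have "\<forall>\<^sub>F t in at_right (0::real). False"
  proof eventually_elim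
    case (elim t)
    have c: "x + t *\<^sub>R u + t *\<^sub>R v = x + t *\<^sub>R v + t *\<^sub>R u" by simp
    have "\<bar>t\<^sup>2 * (u \<bullet> (J *v v)) - t\<^sup>2 * (v \<bullet> (J *v u))\<bar> \<le> 2 * (e * t\<^sup>2)"
      using elim(2,3) unfolding c by linarith
    then have "t\<^sup>2 * \<bar>u \<bullet> (J *v v) - v \<bullet> (J *v u)\<bar> \<le> t\<^sup>2 * (2 * e)"
      unfolding right_diff_distrib[symmetric] abs_mult by (simp add: mult_ac)
    then have "\<bar>u \<bullet> (J *v v) - v \<bullet> (J *v u)\<bar> \<le> 2 * e" using elim(1) by simp
    then show False using e by (simp add: e_def)
  qed
  then show False by simp
qed

text \<open>Were the form positive along \<open>v\<close>, the linearisation of \<open>G\<close>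
  would give \<open>w\<close> minus its tangent plane a positive slope at every small distance along
  \<open>v\<close>, and \<open>w\<close> would rise above the plane.\<close>

lemma hessian_nonpos_at_touching:
  fixes w :: "real^'n::finite \<Rightarrow> real"
  assumes d: "0 < d" and g: "\<And>y. y \<in> ball x d \<Longrightarrow> (w has_derivative (\<lambda>h. G y \<bullet> h)) (at y)"
    and J: "(G has_derivative (\<lambda>h. J *v h)) (at x)"
    and touch: "\<And>y. y \<in> ball x d \<Longrightarrow> w y \<le> w x + G x \<bullet> (y - x)"
  shows "v \<bullet> (J *v v) \<le> 0"
proof (rule ccontr)
  assume "\<not> v \<bullet> (J *v v) \<le> 0"
  then have pos: "0 < v \<bullet> (J *v v)" by simp
  have v: "v \<noteq> 0" using pos by auto
  \<comment> \<open>Lets the linearisation error consume at most half of the positive form.\<close>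
  define e where "e = (v \<bullet> (J *v v)) / (2 * (norm v)\<^sup>2)"
  have e: "0 < e" using pos v by (simp add: e_def)
  obtain d1 where d1: "0 < d1" "\<And>y. norm (y - x) < d1 \<Longrightarrow> norm (G y - G x - J *v (y - x)) \<le> e * norm (y - x)"
    using J e unfolding has_derivative_at_alt by blast
  define t where "t = min d d1 / (2 * norm v)"
  have t: "0 < t" "t * norm v < min d d1" using d d1 v by (auto simp: t_def)
  have der: "((\<lambda>s. w (x + s *\<^sub>R v) - s * (G x \<bullet> v)) has_real_derivative ((G (x + s *\<^sub>R v) - G x) \<bullet> v)) (at s)"
    if s: "0 \<le> s" "s \<le> t" for s
  proof -
    have "s * norm v \<le> t * norm v" using s by (intro mult_right_mono) auto
    then have "norm (s *\<^sub>R v) < d" using s t by simp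
    then have "(w has_derivative (\<lambda>h. G (x + s *\<^sub>R v) \<bullet> h)) (at (x + s *\<^sub>R v))"
      by (intro g) (simp add: dist_norm)
    then have "((\<lambda>s. w (x + s *\<^sub>R v)) has_derivative (\<lambda>h. G (x + s *\<^sub>R v) \<bullet> (h *\<^sub>R v))) (at s)"
      by (rule has_derivative_compose[rotated]) (auto intro!: derivative_eq_intros)
    then have "((\<lambda>s. w (x + s *\<^sub>R v)) has_real_derivative (G (x + s *\<^sub>R v) \<bullet> v)) (at s)"
      by (simp add: has_field_derivative_def mult.commute[of _ "_ \<bullet> _"])
    then show ?thesis by (auto intro!: derivative_eq_intros simp: inner_diff_left)
  qed
  obtain z where z: "0 < z" "z < t"
    and eq: "(w (x + t *\<^sub>R v) - t * (G x \<bullet> v)) - (w (x + 0 *\<^sub>R v) - 0 * (G x \<bullet> v)) = (t - 0) * ((G (x + z *\<^sub>R v) - G x) \<bullet> v)"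
    using MVT2[OF t(1), of "\<lambda>s. w (x + s *\<^sub>R v) - s * (G x \<bullet> v)" "\<lambda>s. (G (x + s *\<^sub>R v) - G x) \<bullet> v"] der by auto
  have zn: "norm (z *\<^sub>R v) < d1"
  proof -
    have "z * norm v \<le> t * norm v" using z by (intro mult_right_mono) auto
    then show ?thesis using z t by simp
  qed
  define r where "r = G (x + z *\<^sub>R v) - G x - J *v (z *\<^sub>R v)"
  have "norm r \<le> e * (z * norm v)"
    using d1(2)[of "x + z *\<^sub>R v"] zn z unfolding r_def by simp
  then have "\<bar>r \<bullet> v\<bar> \<le> e * (z * norm v) * norm v"
    by (intro order_trans[OF Cauchy_Schwarz_ineq2] mult_right_mono) auto
  also have "\<dots> = z * (v \<bullet> (J *v v)) / 2" using v by (simp add: e_def power2_eq_square)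
  finally have rv: "\<bar>r \<bullet> v\<bar> \<le> z * (v \<bullet> (J *v v)) / 2" .
  have "(G (x + z *\<^sub>R v) - G x) \<bullet> v = z * (v \<bullet> (J *v v)) + r \<bullet> v"
    by (simp add: r_def matrix_vector_mult_scaleR inner_diff_left inner_diff_right inner_commute)
  then have "0 < (G (x + z *\<^sub>R v) - G x) \<bullet> v"
    using rv mult_pos_pos[OF z(1) pos] by linarith
  then have "w (x + t *\<^sub>R v) - t * (G x \<bullet> v) - w x > 0" using eq t(1) by simp
  moreover have "w (x + t *\<^sub>R v) \<le> w x + G x \<bullet> (t *\<^sub>R v)"
    using touch[of "x + t *\<^sub>R v"] t by (simp add: dist_norm)
  ultimately show False by simp
qed

section \<open>Weak derivatives and ellipticity\<close>

text \<open>Functions in \<open>Lp_on\<close> are Lebesgue measurable and live on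
  \<open>\<Omega>\<close>, whereas mollification works with Borel functions on the whole space; a
  Borel version of the extension by zero gives the same integrals.\<close>

lemma set_integral_borel_rep:
  fixes f f' k :: "real^'n::finite \<Rightarrow> real"
  assumes f: "set_borel_measurable lebesgue \<Omega> f" and f' [measurable]: "f' \<in> borel_measurable borel"
    and ae: "AE x in lebesgue. f' x = indicator \<Omega> x * f x" and k [measurable]: "k \<in> borel_measurable borel"
  shows "(LINT x:\<Omega>|lebesgue. f x * k x) = (LINT x|lborel. f' x * k x)"
proof -
  have kl [measurable]: "k \<in> borel_measurable lebesgue" "f' \<in> borel_measurable lebesgue"
    using k f' by (auto intro: measurable_completion)
  have "(LINT x:\<Omega>|lebesgue. f x * k x) = (LINT x|lebesgue. (indicator \<Omega> x *\<^sub>R f x) * k x)"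
    unfolding set_lebesgue_integral_def by (simp add: mult.assoc)
  also have "\<dots> = (LINT x|lebesgue. f' x * k x)"
  proof (rule integral_cong_AE)
    show "(\<lambda>x. indicator \<Omega> x *\<^sub>R f x * k x) \<in> borel_measurable lebesgue"
      using f kl unfolding set_borel_measurable_def by (intro borel_measurable_times)
    show "AE x in lebesgue. indicator \<Omega> x *\<^sub>R f x * k x = f' x * k x"
      using ae by eventually_elim simp
  qed simp
  also have "\<dots> = (LINT x|lborel. f' x * k x)"
    by (rule integral_completion) simp
  finally show ?thesis .
qed

lemma Lp_on_ex_borel_rep:
  assumes "Lp_on \<Omega> p f"
  obtains f' where "f' \<in> borel_measurable borel" "AE x in lebesgue. f' x = indicator \<Omega> x * f x"
proof -
  have "(\<lambda>x. indicator \<Omega> x *\<^sub>R f x) \<in> borel_measurable lebesgue"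
    using assms by (simp add: Lp_on_def set_borel_measurable_def)
  from completion_ex_borel_measurable_real[OF this] obtain f' where
    f': "f' \<in> borel_measurable lborel" "AE x in lborel. indicator \<Omega> x *\<^sub>R f x = f' x" by blast
  have "AE x in lebesgue. f' x = indicator \<Omega> x * f x"
    using AE_completion[OF f'(2)] by eventually_elim simp
  then show ?thesis using that f'(1) by simp
qed

text \<open>On a set of finite measure L^p lies in L^1, because a nonnegative number is at most 1
  plus its p-th power.\<close>

lemma Lp_on_rep_integrable:
  fixes f f' :: "real^'n::finite \<Rightarrow> real"
  assumes f: "Lp_on \<Omega> (real (Suc m)) f" and \<Omega>: "open \<Omega>" "bounded \<Omega>"
    and f' [measurable]: "f' \<in> borel_measurable borel"
    and ae: "AE x in lebesgue. f' x = indicator \<Omega> x * f x"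
  shows "integrable lborel (\<lambda>x. \<bar>f' x\<bar> ^ Suc m)" "integrable lborel f'"
proof -
  have [measurable]: "f' \<in> borel_measurable lebesgue"
    using f' by (auto intro: measurable_completion)
  have "integrable lebesgue (\<lambda>x. indicator \<Omega> x *\<^sub>R (\<bar>f x\<bar> powr real (Suc m)))"
    using f by (simp add: Lp_on_def set_integrable_def)
  moreover have "AE x in lebesgue. indicator \<Omega> x *\<^sub>R (\<bar>f x\<bar> powr real (Suc m)) = \<bar>f' x\<bar> ^ Suc m"
    using ae
  proof eventually_elim
    case (elim x)
    have "\<bar>f x\<bar> powr real (Suc m) = \<bar>f x\<bar> ^ Suc m"
      by (cases "f x = 0") (auto simp: powr_realpow simp del: of_nat_Suc)
    then show ?case using elim by (auto simp: indicator_def)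
  qed
  ultimately have "integrable lebesgue (\<lambda>x. \<bar>f' x\<bar> ^ Suc m)"
    by (subst integrable_cong_AE_imp[rotated 2]) (auto elim: eventually_mono)
  then show 1: "integrable lborel (\<lambda>x. \<bar>f' x\<bar> ^ Suc m)"
    by (simp add: integrable_completion)
  have "emeasure lborel \<Omega> < \<infinity>" using \<Omega>(2) by (rule emeasure_bounded_finite)
  then have 2: "integrable lborel (indicator \<Omega> :: real^'n \<Rightarrow> real)"
    using \<Omega>(1) by (intro integrable_real_indicator) auto
  show "integrable lborel f'"
  proof (rule Bochner_Integration.integrable_bound)
    show "integrable lborel (\<lambda>x. indicator \<Omega> x + \<bar>f' x\<bar> ^ Suc m)"
      using 1 2 by (rule Bochner_Integration.integrable_add[rotated])
    have "AE x in lborel. f' x = indicator \<Omega> x * f x"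
      using ae by (simp add: AE_completion_iff)
    then show "AE x in lborel. norm (f' x) \<le> norm (indicator \<Omega> x + \<bar>f' x\<bar> ^ Suc m)"
    proof eventually_elim
      case (elim x)
      show ?case
      proof (cases "x \<in> \<Omega>")
        case True
        have "\<bar>f' x\<bar> \<le> 1 + \<bar>f' x\<bar> ^ Suc m"
        proof (cases "\<bar>f' x\<bar> \<le> 1")
          case False
          then have "\<bar>f' x\<bar> ^ 1 \<le> \<bar>f' x\<bar> ^ Suc m" by (intro power_increasing) auto
          then show ?thesis by simp
        qed (simp add: add_increasing2)
        then show ?thesis using True by (simp add: abs_if split: if_splits)
      qed (use elim in auto)
    qed
  qed simp
qed

text \<open>The test function is the kernel centred at \<open>x\<close>, supported in
  \<open>cball x t\<close>; differentiating it in \<open>y\<close> instead of \<open>x\<close> flips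
  the sign and cancels the minus in \<open>weak_partial\<close>.\<close>

lemma weak_partial_bump:
  fixes u g u' g' :: "real^'n::finite \<Rightarrow> real"
  assumes wp: "weak_partial \<Omega> i u g" and t: "0 < t" "cball x t \<subseteq> \<Omega>"
    and u: "set_borel_measurable lebesgue \<Omega> u" "u' \<in> borel_measurable borel" "AE x in lebesgue. u' x = indicator \<Omega> x * u x"
    and g: "set_borel_measurable lebesgue \<Omega> g" "g' \<in> borel_measurable borel" "AE x in lebesgue. g' x = indicator \<Omega> x * g x"
  shows "(LINT y|lborel. u' y * bump_grad t (x - y) $ i) = (LINT y|lborel. g' y * bump t (x - y))"
proof -
  define phi where "phi = (\<lambda>y. bump t (x - y))"
  define dphi where "dphi = (\<lambda>y. - bump_grad t (x - y))"
  have 1: "GDERIV phi y :> dphi y" for y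
  proof -
    have "((\<lambda>y. bump t (x - y)) has_derivative (\<lambda>h. bump_grad t (x - y) \<bullet> (- h))) (at y)"
      by (rule has_derivative_compose[where f="\<lambda>y. x - y" and g="bump t" and f'="\<lambda>h. - h"])
         (use t in \<open>auto intro!: derivative_eq_intros has_derivative_bump\<close>)
    then show ?thesis by (simp add: gderiv_def phi_def dphi_def inner_commute)
  qed
  have 2: "continuous_on UNIV dphi" unfolding dphi_def by (intro continuous_intros)
  have 3: "phi y = 0" if "y \<notin> cball x t" for y
    using that t by (auto simp: phi_def dist_norm intro!: bump_eq_0)
  have "(LINT y:\<Omega>|lebesgue. u y * dphi y $ i) = - (LINT y:\<Omega>|lebesgue. g y * phi y)"
    using wp[unfolded weak_partial_def, rule_format, of phi dphi "cball x t"] 1 2 3 t(2) compact_cball by blast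
  moreover have "(LINT y:\<Omega>|lebesgue. u y * dphi y $ i) = (LINT y|lborel. u' y * dphi y $ i)"
    using 2 by (intro set_integral_borel_rep u borel_measurable_continuous_onI continuous_intros)
  moreover have "(LINT y:\<Omega>|lebesgue. g y * phi y) = (LINT y|lborel. g' y * phi y)"
    unfolding phi_def by (intro set_integral_borel_rep g borel_measurable_continuous_onI continuous_intros)
  ultimately show ?thesis by (simp add: dphi_def phi_def)
qed

text \<open>An ellipticity constant at most \<open>e\<close> at a single point, with the quotient
  multiplied out so that the zero vector is no exception.\<close>

definition elliptic_matrix :: "real \<Rightarrow> real^'n::finite^'n \<Rightarrow> bool" where
  "elliptic_matrix e B \<longleftrightarrow> psd B \<and> 0 < trace B \<and> (\<forall>x. trace B * (x \<bullet> x) \<le> e * (x \<bullet> (B *v x)))"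

definition contraction :: "real^'n::finite^'n \<Rightarrow> real^'n^'n \<Rightarrow> real" where
  "contraction A B = (\<Sum>i\<in>UNIV. \<Sum>j\<in>UNIV. A $ i $ j * B $ i $ j)"

lemma contraction_add: "contraction A (B + C) = contraction A B + contraction A C"
  by (simp add: contraction_def distrib_left sum.distrib)

lemma contraction_scaleR: "contraction A (c *\<^sub>R B) = c * contraction A B"
  by (simp add: contraction_def sum_distrib_left mult_ac)

lemma contraction_minus: "contraction A (- B) = - contraction A B"
  by (simp add: contraction_def sum_negf)

lemma contraction_diff: "contraction A (B - C) = contraction A B - contraction A C"
  by (simp add: contraction_def right_diff_distrib sum_subtractf)

lemma contraction_mat: "contraction A (mat c) = c * trace A"
  by (simp add: contraction_def mat_def trace_def if_distrib sum_distrib_left mult.commute cong: if_cong)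

lemma mat_vector_mult: "mat c *v x = c *\<^sub>R (x :: real^'n::finite)"
  by (simp add: vec_eq_iff matrix_vector_mult_def mat_def if_distrib[of "\<lambda>z. z * _"] cong: if_cong)

text \<open>By ellipticity \<open>e *\<^sub>R A - mat (trace A)\<close> has a nonnegative form, and
  contracting such a matrix with a \<open>psd\<close> one gives a nonnegative number.\<close>

lemma trace_le_contraction:
  assumes A: "elliptic_matrix e A" and B: "psd B"
  shows "trace A * trace B \<le> e * contraction A B"
proof -
  have "0 \<le> contraction (e *\<^sub>R A - mat (trace A)) B"
    unfolding contraction_def
  proof (rule psd_contraction_nonneg[OF _ B])
    fix x
    have "x \<bullet> ((e *\<^sub>R A - mat (trace A)) *v x) = e * (x \<bullet> (A *v x)) - trace A * (x \<bullet> x)"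
      by (simp add: mat_vector_mult matrix_vector_mult_diff_rdistrib scaleR_matrix_vector_assoc[symmetric] inner_diff_right)
    then show "0 \<le> x \<bullet> ((e *\<^sub>R A - mat (trace A)) *v x)"
      using A by (simp add: elliptic_matrix_def)
  qed
  also have "\<dots> = e * contraction A B - trace A * trace B"
  proof -
    have "contraction (e *\<^sub>R A - mat c) B = e * contraction A B - c * trace B" for c
      by (simp add: contraction_def mat_def trace_def left_diff_distrib right_diff_distrib sum_subtractf sum_distrib_left
          if_distrib[of "\<lambda>z. z * _"] if_distrib[of "\<lambda>z. _ * z"] mult_ac cong: if_cong)
    then show ?thesis .
  qed
  finally show ?thesis by simp
qed

text \<open>The trace of \<open>A\<close> is a factor on both sides and cancels. Hence only
  \<open>e\<close> matters, and the bound is uniform over all points although the coefficients are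
  merely measurable.\<close>

lemma entry_sum_le_contraction:
  fixes A B E :: "real^'n::finite^'n"
  assumes A: "elliptic_matrix e A" and e: "0 < e" and B: "psd B" and le: "contraction A B \<le> contraction A E"
  shows "entry_sum B \<le> (real CARD('n))\<^sup>2 * e * entry_sum E"
proof -
  have tA: "0 < trace A" "psd A" using A by (auto simp: elliptic_matrix_def)
  have "contraction A E \<le> trace A * entry_sum E"
    unfolding contraction_def entry_sum_def sum_distrib_left
  proof (intro sum_mono)
    fix i j
    have "A $ i $ j * E $ i $ j \<le> \<bar>A $ i $ j\<bar> * \<bar>E $ i $ j\<bar>" by (metis abs_ge_self abs_mult)
    also have "\<dots> \<le> trace A * \<bar>E $ i $ j\<bar>"
      using tA by (intro mult_right_mono psd_entry_le_trace) auto
    finally show "A $ i $ j * E $ i $ j \<le> trace A * \<bar>E $ i $ j\<bar>" .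
  qed
  then have "trace A * trace B \<le> e * (trace A * entry_sum E)"
    using trace_le_contraction[OF A B] le e by (smt (verit) mult_left_mono)
  then have "trace A * trace B \<le> trace A * (e * entry_sum E)" by (simp add: mult_ac)
  then have "trace B \<le> e * entry_sum E" using tA by simp
  moreover have "entry_sum B \<le> (real CARD('n))\<^sup>2 * trace B"
  proof -
    have "entry_sum B \<le> (\<Sum>i\<in>(UNIV::'n set). \<Sum>j\<in>(UNIV::'n set). trace B)"
      unfolding entry_sum_def by (intro sum_mono psd_entry_le_trace B)
    then show ?thesis by (simp add: power2_eq_square mult_ac)
  qed
  ultimately show ?thesis
    by (smt (verit) mult.assoc mult_left_mono zero_le_power2)
qed

lemma sum_power_le:
  fixes a :: "'i \<Rightarrow> real"
  assumes "finite S" "S \<noteq> {}" "\<And>i. i \<in> S \<Longrightarrow> 0 \<le> a i"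
  shows "(\<Sum>i\<in>S. a i) ^ n \<le> real (card S) ^ n * (\<Sum>i\<in>S. a i ^ n)"
proof -
  define M where "M = Max (a ` S)"
  have M: "a i \<le> M" if "i \<in> S" for i using assms that by (simp add: M_def)
  have "M \<in> a ` S" unfolding M_def using assms by (intro Max_in) auto
  then obtain k where k: "k \<in> S" "M = a k" by auto
  have "(\<Sum>i\<in>S. a i) ^ n \<le> (real (card S) * M) ^ n"
    using assms M by (intro power_mono sum_nonneg) (auto intro: sum_bounded_above)
  also have "\<dots> = real (card S) ^ n * a k ^ n" by (simp add: power_mult_distrib k)
  also have "\<dots> \<le> real (card S) ^ n * (\<Sum>i\<in>S. a i ^ n)"
    using assms k by (intro mult_left_mono member_le_sum) auto
  finally show ?thesis .
qed

lemma entry_sum_power_le: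
  fixes E :: "real^'n::finite^'n"
  shows "entry_sum E ^ k \<le> real (CARD('n) * CARD('n)) ^ k * (\<Sum>i\<in>UNIV. \<Sum>j\<in>UNIV. \<bar>E $ i $ j\<bar> ^ k)"
  using sum_power_le[of "UNIV \<times> UNIV :: ('n \<times> 'n) set" "\<lambda>(i, j). \<bar>E $ i $ j\<bar>" k]
  by (simp add: entry_sum_def sum.cartesian_product split_def card_cartesian_product)

section \<open>Touching from above by smooth functions\<close>

definition has_hessian ::
  "(real^'n::finite) set \<Rightarrow> (real^'n \<Rightarrow> real) \<Rightarrow> (real^'n \<Rightarrow> real^'n) \<Rightarrow> (real^'n \<Rightarrow> real^'n^'n) \<Rightarrow> bool" where
  "has_hessian U f g H \<longleftrightarrow> continuous_on U H \<and>
     (\<forall>x\<in>U. (f has_derivative (\<lambda>h. g x \<bullet> h)) (at x) \<and> (g has_derivative (\<lambda>h. H x *v h)) (at x))"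

lemma has_derivative_mollify_weak:
  fixes u' :: "real^'n::finite \<Rightarrow> real"
  assumes u': "integrable lborel u'" and t: "0 < t"
    and ibp: "\<And>i. (LINT y|lborel. u' y * bump_grad t (x - y) $ i) = (LINT y|lborel. d i y * bump t (x - y))"
  shows "(mollify t u' has_derivative (\<lambda>h. (\<chi> i. mollify t (d i) x) \<bullet> h)) (at x)"
  using has_derivative_mollify[OF u' t, of x] by (simp add: ibp mollify_def mollifier_def)

text \<open>The Alexandrov-Bakelman-Pucci argument. If \<^term>\<open>u - \<phi>\<close> had a local maximum at \<^term>\<open>z\<close>, then for the
  mollified and slightly perturbed difference \<^term>\<open>w\<close> the gradient would map the contact set \<^term>\<open>S\<close> onto
  a fixed ball. On the contact set the Hessian \<^term>\<open>J\<close> is nonpositive, and because \<^term>\<open>u\<close> is a subsolution its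
  entries are bounded by the mollification error \<^term>\<open>Err\<close> of the second derivatives, which tends to 0 in
  \<open>L\<^sup>n\<close>; so the image has arbitrarily small measure.\<close>

lemma no_interior_touching:
  fixes u \<phi> :: "real^'n::finite \<Rightarrow> real"
  assumes \<Omega>: "open \<Omega>" "bounded \<Omega>" and W: "W2_with \<Omega> (real CARD('n)) u D2" and cu: "continuous_on \<Omega> u"
    and e1: "0 < e1" and ell: "\<And>x. x \<in> \<Omega> \<Longrightarrow> elliptic_matrix e1 (A x)"
    and sub: "AE x in lebesgue. x \<in> \<Omega> \<longrightarrow> - (\<Sum>i\<in>UNIV. \<Sum>j\<in>UNIV. A x $ i $ j * D2 i j x) \<le> 0"
    and U: "open U" "U \<subseteq> \<Omega>" "z \<in> U" and hess: "has_hessian U \<phi> g H"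
    and \<kappa>: "0 < \<kappa>" and strict: "\<And>x. x \<in> U \<Longrightarrow> contraction (A x) (H x) + \<kappa> * trace (A x) \<le> 0"
    and mx: "\<And>x. x \<in> U \<Longrightarrow> u x - \<phi> x \<le> u z - \<phi> z"
  shows False
proof -
  \<comment> \<open>The L^p lemmas are stated for exponents \<open>Suc m\<close>; the exponent here
    is the dimension.\<close>
  obtain m where m: "CARD('n) = Suc m" using gr0_implies_Suc[of "CARD('n)"] by auto
  obtain \<rho>0 where \<rho>0: "0 < \<rho>0" "cball z \<rho>0 \<subseteq> U" using U(1,3) open_contains_cball by blast
  define \<rho> where "\<rho> = \<rho>0 / 2"
  have \<rho>: "0 < \<rho>" "cball z (2 * \<rho>) \<subseteq> U" using \<rho>0 by (auto simp: \<rho>_def)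
  define K where "K = cball z \<rho>"
  \<comment> \<open>The paraboloid with factor \<open>c\<close> has Hessian
    \<open>mat \<kappa>\<close>, exactly the slack in \<open>strict\<close>. Subtracting it lets the
    maximum at \<open>z\<close> beat the sphere of radius \<open>\<rho>\<close> by
    \<open>c * \<rho>\<^sup>2\<close>. Slopes up to \<open>q\<close> and mollification errors
    \<open>\<omega>\<close> use up only half of this, as \<open>2 * \<omega> + q * \<rho>\<close> is
    \<open>c * \<rho>\<^sup>2 / 2\<close>.\<close>
  define c where "c = \<kappa> / 2"
  have c: "0 < c" using \<kappa> by (simp add: c_def)
  define q where "q = c * \<rho> / 4"
  define \<omega> where "\<omega> = c * \<rho>\<^sup>2 / 8"
  have q: "0 < q" and \<omega>: "0 < \<omega>" using c \<rho> by (auto simp: q_def \<omega>_def)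
  have cK: "compact K" and KU: "K \<subseteq> U" and zK: "z \<in> K" using \<rho> by (auto simp: K_def)

  \<comment> \<open>Borel representatives of the weak derivatives\<close>
  obtain D1 where D1: "\<And>j. Lp_on \<Omega> (real (Suc m)) (D1 j)" "\<And>j. weak_partial \<Omega> j u (D1 j)"
    and D2: "\<And>i j. Lp_on \<Omega> (real (Suc m)) (D2 i j)" "\<And>i j. weak_partial \<Omega> i (D1 j) (D2 i j)"
    and Lu: "Lp_on \<Omega> (real (Suc m)) u"
    using W unfolding W2_with_def m by blast
  have "\<exists>d. d \<in> borel_measurable borel \<and> (AE x in lebesgue. d x = indicator \<Omega> x * D1 j x)" for j
    using Lp_on_ex_borel_rep[OF D1(1)] by metis
  then obtain d1 where d1: "\<And>j. d1 j \<in> borel_measurable borel"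
    "\<And>j. AE x in lebesgue. d1 j x = indicator \<Omega> x * D1 j x" by metis
  have "\<exists>d. d \<in> borel_measurable borel \<and> (AE x in lebesgue. d x = indicator \<Omega> x * D2 i j x)" for i j
    using Lp_on_ex_borel_rep[OF D2(1)] by metis
  then obtain d2 where d2: "\<And>i j. d2 i j \<in> borel_measurable borel"
    "\<And>i j. AE x in lebesgue. d2 i j x = indicator \<Omega> x * D2 i j x" by metis
  define u' where "u' = (\<lambda>x. indicator \<Omega> x * u x)"
  have u': "u' \<in> borel_measurable borel" "AE x in lebesgue. u' x = indicator \<Omega> x * u x"
  proof -
    have "(\<lambda>x. indicator \<Omega> x *\<^sub>R u x) \<in> borel_measurable borel"
      using \<Omega>(1) cu by (intro borel_measurable_continuous_on_indicator) auto
    then show "u' \<in> borel_measurable borel" by (simp add: u'_def)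
  qed (simp add: u'_def)
  note iu = Lp_on_rep_integrable(2)[OF Lu \<Omega> u']
  note id1 = Lp_on_rep_integrable(2)[OF D1(1) \<Omega> d1]
  note id2 = Lp_on_rep_integrable(2)[OF D2(1) \<Omega> d2] and id2p = Lp_on_rep_integrable(1)[OF D2(1) \<Omega> d2]
  have sbm: "set_borel_measurable lebesgue \<Omega> u" "set_borel_measurable lebesgue \<Omega> (D1 j)"
    "set_borel_measurable lebesgue \<Omega> (D2 i j)" for i j
    using Lu D1(1) D2(1) by (auto simp: Lp_on_def)

  have cb: "cball x t \<subseteq> \<Omega>" if "x \<in> ball z (\<rho> + \<rho> / 2)" "t < \<rho> / 2" for x t
  proof -
    have "cball x t \<subseteq> cball z (2 * \<rho>)"
    proof
      fix y assume "y \<in> cball x t"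
      then show "y \<in> cball z (2 * \<rho>)" using that dist_triangle[of z y x] by auto
    qed
    then show ?thesis using \<rho> U by blast
  qed

  \<comment> \<open>The mollified difference and its two derivatives\<close>
  define w where "w = (\<lambda>t x. mollify t u' x - \<phi> x - c * ((x - z) \<bullet> (x - z)))"
  define G where "G = (\<lambda>t x. (\<chi> i. mollify t (d1 i) x) - g x - (2 * c) *\<^sub>R (x - z))"
  \<comment> \<open>Rows of the Jacobian belong to components of the gradient and columns to
    directions, so the entry in row \<open>i\<close> and column \<open>j\<close> is the derivative
    in direction \<open>j\<close> of the component \<open>i\<close>, which is
    \<open>d2 j i\<close>.\<close>
  define Err where "Err = (\<lambda>t x. (\<chi> i j. mollify t (d2 j i) x - d2 j i x) :: real^'n^'n)"
  define J where "J = (\<lambda>t x. (\<chi> i j. mollify t (d2 j i) x) - H x - mat \<kappa> :: real^'n^'n)"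

  have dw: "(w t has_derivative (\<lambda>h. G t x \<bullet> h)) (at x)" and dG: "(G t has_derivative (\<lambda>h. J t x *v h)) (at x)"
    if x: "x \<in> ball z (\<rho> + \<rho> / 2)" and t: "0 < t" "t < \<rho> / 2" for x t
  proof -
    note cbx = cb[OF x t(2)]
    have xU: "x \<in> U" using x \<rho> by (intro subsetD[OF \<rho>(2)]) auto
    have h\<phi>: "(\<phi> has_derivative (\<lambda>h. g x \<bullet> h)) (at x)" "(g has_derivative (\<lambda>h. H x *v h)) (at x)"
      using hess xU by (auto simp: has_hessian_def)
    have "(mollify t u' has_derivative (\<lambda>h. (\<chi> i. mollify t (d1 i) x) \<bullet> h)) (at x)"
      by (rule has_derivative_mollify_weak[OF iu t(1) weak_partial_bump[OF D1(2) t(1) cbx sbm(1) u' sbm(2) d1]])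
    then have "(w t has_derivative (\<lambda>h. (\<chi> i. mollify t (d1 i) x) \<bullet> h - g x \<bullet> h - c * (h \<bullet> (x - z) + (x - z) \<bullet> h))) (at x)"
      unfolding w_def by (auto intro!: derivative_eq_intros h\<phi>(1))
    then show "(w t has_derivative (\<lambda>h. G t x \<bullet> h)) (at x)"
      by (simp add: G_def inner_diff_left inner_commute algebra_simps)
    have dm: "(mollify t (d1 j) has_derivative (\<lambda>h. (\<chi> i. mollify t (d2 i j) x) \<bullet> h)) (at x)" for j
      by (rule has_derivative_mollify_weak[OF id1 t(1) weak_partial_bump[OF D2(2) t(1) cbx sbm(2) d1 sbm(3) d2]])
    have "((\<lambda>x. (\<chi> j. mollify t (d1 j) x) :: real^'n) has_derivative (\<lambda>h. (\<chi> i j. mollify t (d2 j i) x) *v h)) (at x)"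
    proof (subst has_derivative_componentwise_within, rule ballI)
      fix b :: "real^'n" assume "b \<in> Basis"
      then obtain j where b: "b = axis j 1" by (auto simp: Basis_vec_def)
      have c: "v \<bullet> axis j 1 = v $ j" for v :: "real^'n" by (simp add: inner_axis)
      have "(\<lambda>h. ((\<chi> i j. mollify t (d2 j i) x) *v h) $ j) = (\<lambda>h. (\<chi> i. mollify t (d2 i j) x) \<bullet> h)"
        by (simp add: matrix_vector_mult_def inner_vec_def)
      then show "((\<lambda>x. (\<chi> j. mollify t (d1 j) x) \<bullet> b) has_derivative
          (\<lambda>h. ((\<chi> i j. mollify t (d2 j i) x) *v h) \<bullet> b)) (at x)"
        unfolding b c using dm[of j] by simp
    qed
    then have "(G t has_derivative (\<lambda>h. (\<chi> i j. mollify t (d2 j i) x) *v h - H x *v h - (2 * c) *\<^sub>R h)) (at x)"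
      unfolding G_def by (auto intro!: derivative_eq_intros h\<phi>(2))
    then show "(G t has_derivative (\<lambda>h. J t x *v h)) (at x)"
      by (simp add: J_def mat_vector_mult matrix_vector_mult_diff_rdistrib c_def)
  qed

  have "uniformly_continuous_on (cball z (2 * \<rho>)) u"
    using \<rho>(2) U(2) by (intro compact_uniformly_continuous continuous_on_subset[OF cu]) auto
  then obtain t1 where t1: "0 < t1"
    "\<And>x y. x \<in> cball z (2 * \<rho>) \<Longrightarrow> y \<in> cball z (2 * \<rho>) \<Longrightarrow> dist y x < t1 \<Longrightarrow> dist (u y) (u x) < \<omega>"
    unfolding uniformly_continuous_on_def using \<omega> by meson

  \<comment> \<open>The upper contact set and its gradient image\<close>
  define S where "S = (\<lambda>t. {x \<in> K. norm (G t x) \<le> q \<and> (\<forall>y\<in>K. w t y \<le> w t x + G t x \<bullet> (y - x))})"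

  have KB: "K \<subseteq> ball z (\<rho> + \<rho> / 2)" using \<rho>(1) by (auto simp: K_def)
  have contG: "continuous_on K (G t)" "continuous_on K (w t)" if "0 < t" "t < \<rho> / 2" for t
    by (intro continuous_at_imp_continuous_on ballI has_derivative_continuous[OF dG] has_derivative_continuous[OF dw];
        use that KB in blast)+
  have contJ: "continuous_on K (J t)" if "0 < t" for t
    unfolding J_def using hess KU that id2
    by (intro continuous_intros continuous_on_mollify)
       (auto simp: has_hessian_def intro: continuous_on_subset)

  have near: "\<bar>mollify t u' x - u x\<bar> \<le> \<omega>" if t: "0 < t" "t < \<rho> / 2" "t < t1" and x: "x \<in> K" for t x
  proof (rule abs_mollify_diff_le[OF iu t(1)])
    fix y assume y: "norm (x - y) < t"
    have "dist z y \<le> dist z x + dist x y" by (rule dist_triangle)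
    also have "\<dots> \<le> 2 * \<rho>" using x y t(2) \<rho>(1) by (simp add: K_def dist_norm)
    finally have y2: "y \<in> cball z (2 * \<rho>)" by simp
    then have "y \<in> \<Omega>" using \<rho>(2) U(2) by blast
    moreover have "dist (u y) (u x) < \<omega>"
      using x y y2 t \<rho>(1) by (intro t1(2)) (auto simp: K_def dist_norm norm_minus_commute)
    ultimately show "\<bar>u' y - u x\<bar> \<le> \<omega>" by (simp add: u'_def dist_real_def)
  qed

  have inner_pt: "norm (x - z) < \<rho>"
    if t: "0 < t" "t < \<rho> / 2" "t < t1" and x: "x \<in> K" and p: "norm p \<le> q"
      and tz: "w t z \<le> w t x + p \<bullet> (z - x)" for t x p
  proof (rule ccontr)
    assume "\<not> norm (x - z) < \<rho>"
    then have nx: "norm (x - z) = \<rho>" using x by (simp add: K_def dist_norm norm_minus_commute)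
    have "w t x \<le> u x + \<omega> - \<phi> x - c * \<rho>\<^sup>2"
      using near[OF t x] nx by (simp add: w_def flip: power2_norm_eq_inner)
    moreover have "u x - \<phi> x \<le> u z - \<phi> z" using mx x KU by blast
    moreover have "u z - \<phi> z - \<omega> \<le> w t z" using near[OF t zK] by (simp add: w_def)
    moreover have "p \<bullet> (z - x) \<le> q * \<rho>"
    proof -
      have "p \<bullet> (z - x) \<le> norm p * norm (z - x)" by (rule norm_cauchy_schwarz)
      also have "\<dots> \<le> q * \<rho>" using p nx q by (intro mult_mono) (auto simp: norm_minus_commute)
      finally show ?thesis .
    qed
    ultimately have "c * \<rho>\<^sup>2 \<le> 2 * \<omega> + q * \<rho>" using tz by linarith
    also have "\<dots> = c * \<rho>\<^sup>2 / 2" by (simp add: \<omega>_def q_def power2_eq_square)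
    finally show False using c \<rho>(1) by simp
  qed

  \<comment> \<open>A plane of slope \<open>p\<close> lowered from above first meets the graph of
    \<open>w t\<close> at a maximum of \<open>w t y - p \<bullet> y\<close>; by
    \<open>inner_pt\<close> this is an interior point, so the gradient there is
    \<open>p\<close>.\<close>
  have cover: "cball 0 q \<subseteq> G t ` S t" if t: "0 < t" "t < \<rho> / 2" "t < t1" for t
  proof
    fix p :: "real^'n" assume "p \<in> cball 0 q"
    then have p: "norm p \<le> q" by simp
    have "continuous_on K (\<lambda>y. w t y - p \<bullet> y)"
      using contG[OF t(1,2)] by (intro continuous_intros)
    then obtain x where x: "x \<in> K" "\<And>y. y \<in> K \<Longrightarrow> w t y - p \<bullet> y \<le> w t x - p \<bullet> x"
      using continuous_attains_sup[OF cK, of "\<lambda>y. w t y - p \<bullet> y"] zK by blast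
    have touch: "w t y \<le> w t x + p \<bullet> (y - x)" if "y \<in> K" for y
      using x(2)[OF that] by (simp add: inner_diff_right)
    have nx: "norm (x - z) < \<rho>" by (rule inner_pt[OF t x(1) p touch[OF zK]])
    have xb: "x \<in> ball z (\<rho> + \<rho> / 2)" using x(1) KB by blast
    have "((\<lambda>y. w t y - p \<bullet> y) has_derivative (\<lambda>h. G t x \<bullet> h - p \<bullet> h)) (at x)"
      by (auto intro!: derivative_eq_intros dw xb t)
    then have "(\<lambda>h. G t x \<bullet> h - p \<bullet> h) = (\<lambda>h. 0)"
      by (rule differential_zero_maxmin[of x "ball z \<rho>", rotated 2])
         (use nx x in \<open>auto simp: K_def dist_norm norm_minus_commute\<close>)
    then have "(G t x - p) \<bullet> (G t x - p) = 0"
      by (metis inner_diff_left)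
    then have "G t x = p" by simp
    then show "p \<in> G t ` S t" using x(1) touch p by (intro image_eqI[of _ _ x]) (auto simp: S_def)
  qed

  have psdS: "psd (- J t x)" if t: "0 < t" "t < \<rho> / 2" "t < t1" and x: "x \<in> S t" for t x
  proof -
    have xK: "x \<in> K" and tch: "\<And>y. y \<in> K \<Longrightarrow> w t y \<le> w t x + G t x \<bullet> (y - x)" and nG: "norm (G t x) \<le> q"
      using x by (auto simp: S_def)
    have nx: "norm (x - z) < \<rho>" by (rule inner_pt[OF t xK nG tch[OF zK]])
    define d where "d = \<rho> - norm (x - z)"
    have d: "0 < d" using nx by (simp add: d_def)
    have bK: "ball x d \<subseteq> K"
    proof
      fix y assume "y \<in> ball x d"
      then show "y \<in> K" using dist_triangle[of z y x] by (simp add: K_def d_def dist_norm norm_minus_commute)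
    qed
    have der: "(w t has_derivative (\<lambda>h. G t y \<bullet> h)) (at y)" if "y \<in> ball x d" for y
      using that bK KB by (intro dw t) blast
    have derG: "(G t has_derivative (\<lambda>h. J t x *v h)) (at x)"
      using xK KB by (intro dG t) blast
    have sym: "J t x $ i $ j = J t x $ j $ i" for i j
      using hessian_symmetric[OF d _ derG, of "w t" "axis i 1" "axis j 1"] der
      by (simp add: inner_axis' matrix_vector_mult_basis column_def)
    have "v \<bullet> (J t x *v v) \<le> 0" for v
      by (rule hessian_nonpos_at_touching[OF d _ derG]) (use der tch bK in auto)
    then have "0 \<le> v \<bullet> ((- J t x) *v v)" for v
      by (simp add: inner_mult_vec sum_negf)
    then show ?thesis using sym by (simp add: psd_def)
  qed

  \<comment> \<open>The differential inequality on the contact set\<close>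
  have ae: "AE x in lebesgue. x \<in> K \<longrightarrow> 0 \<le> contraction (A x) (\<chi> i j. d2 j i x)"
  proof -
    have "AE x in lebesgue. \<forall>i j. d2 i j x = indicator \<Omega> x * D2 i j x"
      using d2(2) by (simp add: eventually_all_finite)
    with sub show ?thesis
    proof eventually_elim
      case (elim x)
      show ?case
      proof
        assume "x \<in> K"
        then have x: "x \<in> \<Omega>" using KU U by blast
        have "A x $ i $ j = A x $ j $ i" for i j using ell[OF x] by (simp add: elliptic_matrix_def psd_def)
        then have "contraction (A x) (\<chi> i j. d2 j i x) = (\<Sum>i\<in>UNIV. \<Sum>j\<in>UNIV. A x $ j $ i * D2 j i x)"
          using elim(2) x by (simp add: contraction_def)
        also have "\<dots> = (\<Sum>i\<in>UNIV. \<Sum>j\<in>UNIV. A x $ i $ j * D2 i j x)" by (rule sum.swap)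
        finally show "0 \<le> contraction (A x) (\<chi> i j. d2 j i x)" using elim(1) x by simp
      qed
    qed
  qed

  define C where "C = ((real CARD('n))\<^sup>2 * e1) ^ CARD('n) * real (CARD('n) * CARD('n)) ^ CARD('n)"
  have C: "0 \<le> C" using e1 by (simp add: C_def)
  have bound: "AE x in lborel. x \<in> S t \<longrightarrow>
      entry_sum (J t x) ^ CARD('n) \<le> C * (\<Sum>i\<in>UNIV. \<Sum>j\<in>UNIV. \<bar>Err t x $ i $ j\<bar> ^ CARD('n))"
    if t: "0 < t" "t < \<rho> / 2" "t < t1" for t
    using ae unfolding AE_completion_iff
  proof eventually_elim
    case (elim x)
    show ?case
    proof
      assume x: "x \<in> S t"
      then have xK: "x \<in> K" by (simp add: S_def)
      have x\<Omega>: "x \<in> \<Omega>" using xK KU U by blast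
      \<comment> \<open>After contraction with \<open>A x\<close> the first two terms contribute at
        most 0 by \<open>strict\<close>, and the third at most 0 because \<open>u\<close> is a
        subsolution; so \<open>- J t x\<close> is controlled by the error alone.\<close>
      have "- J t x = H x + mat \<kappa> - (\<chi> i j. d2 j i x) - Err t x"
        by (simp add: J_def Err_def vec_eq_iff)
      then have "contraction (A x) (- J t x)
          = contraction (A x) (H x) + \<kappa> * trace (A x) - contraction (A x) (\<chi> i j. d2 j i x) - contraction (A x) (Err t x)"
        by (simp only: contraction_diff contraction_add contraction_mat)
      also have "\<dots> \<le> contraction (A x) (- Err t x)"
        using strict[of x] elim xK KU by (auto simp: contraction_minus)
      finally have "entry_sum (- J t x) \<le> (real CARD('n))\<^sup>2 * e1 * entry_sum (- Err t x)"
        by (rule entry_sum_le_contraction[OF ell[OF x\<Omega>] e1 psdS[OF t x]])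
      then have "entry_sum (J t x) \<le> (real CARD('n))\<^sup>2 * e1 * entry_sum (Err t x)"
        by (simp add: entry_sum_def)
      then have "entry_sum (J t x) ^ CARD('n) \<le> ((real CARD('n))\<^sup>2 * e1 * entry_sum (Err t x)) ^ CARD('n)"
        by (intro power_mono) (auto simp: entry_sum_nonneg)
      also have "\<dots> = ((real CARD('n))\<^sup>2 * e1) ^ CARD('n) * entry_sum (Err t x) ^ CARD('n)"
        by (simp add: power_mult_distrib)
      also have "\<dots> \<le> ((real CARD('n))\<^sup>2 * e1) ^ CARD('n) * (real (CARD('n) * CARD('n)) ^ CARD('n)
          * (\<Sum>i\<in>UNIV. \<Sum>j\<in>UNIV. \<bar>Err t x $ i $ j\<bar> ^ CARD('n)))"
        using e1 by (intro mult_left_mono entry_sum_power_le) auto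
      finally show "entry_sum (J t x) ^ CARD('n) \<le> C * (\<Sum>i\<in>UNIV. \<Sum>j\<in>UNIV. \<bar>Err t x $ i $ j\<bar> ^ CARD('n))"
        by (simp add: C_def mult.assoc)
    qed
  qed

  \<comment> \<open>Choice of the mollification radius and contradiction of volumes\<close>
  define V where "V = measure lborel (cball (0 :: real^'n) q)"
  have V: "0 < V" unfolding V_def using content_cball_pos[OF q] by simp
  define N where "N = fact CARD('n) * C * (real CARD('n) * real CARD('n))"
  have N: "0 \<le> N" using C by (simp add: N_def)
  \<comment> \<open>Neither the volume \<open>V\<close> of the slope ball nor \<open>N\<close>
    depends on \<open>t\<close>, so the accuracy \<open>\<epsilon>\<close> with
    \<open>N * \<epsilon> < V\<close> can be prescribed before \<open>t\<close> is chosen.\<close>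
  define \<epsilon> where "\<epsilon> = V / (N + 1)"
  have \<epsilon>: "0 < \<epsilon>" using V N by (simp add: \<epsilon>_def)
  have "\<exists>d>0. \<forall>t. 0 < t \<longrightarrow> t < d \<longrightarrow>
      (\<integral>\<^sup>+x. ennreal (\<bar>mollify t (d2 i j) x - d2 i j x\<bar> ^ Suc m) * indicator K x \<partial>lborel) \<le> ennreal \<epsilon>" for i j
  proof -
    obtain d where "0 < d" "\<And>t. 0 < t \<Longrightarrow> t < d \<Longrightarrow>
      (\<integral>\<^sup>+x. ennreal (\<bar>mollify t (d2 i j) x - d2 i j x\<bar> ^ Suc m) * indicator (cball z \<rho>) x \<partial>lborel) \<le> ennreal \<epsilon>"
      by (rule mollify_Lp_convergence[OF id2 id2p \<epsilon>]) blast
    then show ?thesis unfolding K_def by blast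
  qed
  then have "\<forall>p. \<exists>d. 0 < d \<and> (\<forall>t. 0 < t \<longrightarrow> t < d \<longrightarrow>
      (\<integral>\<^sup>+x. ennreal (\<bar>mollify t (d2 (fst p) (snd p)) x - d2 (fst p) (snd p) x\<bar> ^ Suc m) * indicator K x \<partial>lborel) \<le> ennreal \<epsilon>)"
    by blast
  from choice[OF this] obtain dd where dd: "\<And>p. 0 < dd p" "\<And>p t. 0 < t \<Longrightarrow> t < dd p \<Longrightarrow>
      (\<integral>\<^sup>+x. ennreal (\<bar>mollify t (d2 (fst p) (snd p)) x - d2 (fst p) (snd p) x\<bar> ^ Suc m) * indicator K x \<partial>lborel) \<le> ennreal \<epsilon>"
    by blast
  define t where "t = min (Min (range dd)) (min (\<rho> / 2) t1) / 2"
  have mpos: "0 < Min (range dd)" using dd(1) by (subst Min_gr_iff) auto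
  have tpos: "0 < t" using mpos \<rho> t1 by (simp add: t_def)
  have tlt: "t < Min (range dd)" "t < \<rho> / 2" "t < t1"
    using mpos \<rho> t1 by (auto simp: t_def min_def)
  have tdd: "t < dd p" for p
    by (rule less_le_trans[OF tlt(1) Min_le]) auto
  have Lp: "(\<integral>\<^sup>+x. ennreal (\<bar>mollify t (d2 i j) x - d2 i j x\<bar> ^ Suc m) * indicator K x \<partial>lborel) \<le> ennreal \<epsilon>" for i j
    using dd(2)[OF tpos tdd, of "(i, j)"] by simp
  note t = tpos tlt(2,3)

  have SK: "S t \<subseteq> K" by (auto simp: S_def)
  have cS: "compact (S t)"
  proof -
    have eq: "S t = K \<inter> ({x \<in> K. norm (G t x) \<le> q} \<inter> (\<Inter>y\<in>K. {x \<in> K. w t y \<le> w t x + G t x \<bullet> (y - x)}))"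
      using zK by (auto simp: S_def)
    show ?thesis
      unfolding eq using cK contG[OF t(1,2)]
      by (intro compact_Int_closed closed_Int closed_INT ballI continuous_on_closed_Collect_le continuous_intros)
         (auto intro: compact_imp_closed)
  qed
  have mS: "S t \<in> sets borel" using cS by (simp add: borel_compact)
  have derS: "(G t has_derivative (\<lambda>h. J t x *v h)) (at x within S t)" if "x \<in> S t" for x
  proof -
    have "x \<in> ball z (\<rho> + \<rho> / 2)" using that SK KB by blast
    then show ?thesis by (rule has_derivative_at_withinI[OF dG[OF _ t(1,2)]])
  qed
  have cJS: "continuous_on (S t) (J t)" using contJ[OF t(1)] SK by (rule continuous_on_subset)
  have cGS: "compact (G t ` S t)"
    using cS contG(1)[OF t(1,2)] SK by (intro compact_continuous_image) (auto intro: continuous_on_subset)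
  define I where "I = (LINT x:S t|lborel. entry_sum (J t x) ^ CARD('n))"
  have "V \<le> measure lborel (G t ` S t)"
    unfolding V_def using cover[OF t] cGS
    by (intro measure_mono_fmeasurable) (auto simp: borel_compact fmeasurable_compact)
  also have "\<dots> \<le> fact CARD('n) * I"
    unfolding I_def by (rule measure_image_le[OF cS cJS derS])
  finally have VI: "V \<le> fact CARD('n) * I" .
  have [measurable]: "d2 i j \<in> borel_measurable borel" "mollify t (d2 i j) \<in> borel_measurable borel" for i j
    using d2(1) continuous_on_mollify[OF id2 t(1)] by (auto intro: borel_measurable_continuous_onI)
  have [measurable]: "K \<in> sets borel" by (simp add: K_def)
  have "set_integrable lborel (S t) (\<lambda>x. entry_sum (J t x) ^ CARD('n))"
    using cJS by (intro set_integrable_lborel_compact[OF cS] continuous_intros)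
  then have "ennreal I = (\<integral>\<^sup>+x. ennreal (indicator (S t) x *\<^sub>R entry_sum (J t x) ^ CARD('n)) \<partial>lborel)"
    unfolding I_def set_integrable_def set_lebesgue_integral_def
    by (intro nn_integral_eq_integral[symmetric]) (auto simp: entry_sum_nonneg)
  also have "\<dots> \<le> (\<integral>\<^sup>+x. ennreal C * (\<Sum>i\<in>UNIV. \<Sum>j\<in>UNIV.
      ennreal (\<bar>mollify t (d2 j i) x - d2 j i x\<bar> ^ Suc m) * indicator K x) \<partial>lborel)"
  proof (rule nn_integral_mono_AE)
    show "AE x in lborel. ennreal (indicator (S t) x *\<^sub>R entry_sum (J t x) ^ CARD('n))
      \<le> ennreal C * (\<Sum>i\<in>UNIV. \<Sum>j\<in>UNIV. ennreal (\<bar>mollify t (d2 j i) x - d2 j i x\<bar> ^ Suc m) * indicator K x)"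
      using bound[OF t]
    proof eventually_elim
      case (elim x)
      show ?case
      proof (cases "x \<in> S t")
        case True
        then have "ennreal (entry_sum (J t x) ^ CARD('n)) \<le> ennreal (C * (\<Sum>i\<in>UNIV. \<Sum>j\<in>UNIV. \<bar>Err t x $ i $ j\<bar> ^ CARD('n)))"
          using elim by (intro ennreal_leI) blast
        also have "\<dots> = ennreal C * (\<Sum>i\<in>UNIV. \<Sum>j\<in>UNIV. ennreal (\<bar>mollify t (d2 j i) x - d2 j i x\<bar> ^ Suc m))"
          using C by (simp add: ennreal_mult sum_nonneg sum_ennreal Err_def m del: power_Suc)
        finally show ?thesis using True SK by (simp add: subset_iff)
      qed simp
    qed
  qed
  also have "\<dots> = ennreal C * (\<Sum>i\<in>UNIV. \<Sum>j\<in>UNIV.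
      (\<integral>\<^sup>+x. ennreal (\<bar>mollify t (d2 j i) x - d2 j i x\<bar> ^ Suc m) * indicator K x \<partial>lborel))"
  proof -
    define F where "F = (\<lambda>i j x. ennreal (\<bar>mollify t (d2 j i) x - d2 j i x\<bar> ^ Suc m) * indicator K x)"
    have [measurable]: "F i j \<in> borel_measurable lborel" for i j unfolding F_def by measurable
    have "(\<integral>\<^sup>+x. ennreal C * (\<Sum>i\<in>UNIV. \<Sum>j\<in>UNIV. F i j x) \<partial>lborel)
        = ennreal C * (\<Sum>i\<in>UNIV. \<Sum>j\<in>UNIV. (\<integral>\<^sup>+x. F i j x \<partial>lborel))"
      by (simp add: nn_integral_cmult nn_integral_sum)
    then show ?thesis by (simp only: F_def)
  qed
  also have "\<dots> \<le> ennreal C * (\<Sum>i\<in>(UNIV::'n set). \<Sum>j\<in>(UNIV::'n set). ennreal \<epsilon>)"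
    by (intro mult_left_mono sum_mono Lp) auto
  also have "\<dots> = ennreal (C * (real CARD('n) * real CARD('n) * \<epsilon>))"
    using C \<epsilon> by (simp add: ennreal_mult ennreal_of_nat_eq_real_of_nat mult.assoc)
  finally have "I \<le> C * (real CARD('n) * real CARD('n) * \<epsilon>)"
    using C \<epsilon> by (simp add: ennreal_le_iff)
  then have "V \<le> fact CARD('n) * (C * (real CARD('n) * real CARD('n) * \<epsilon>))"
    using VI by (meson fact_ge_zero mult_left_mono order_trans)
  also have "\<dots> = N * \<epsilon>" by (simp add: N_def)
  also have "\<dots> < V" using V N by (simp add: \<epsilon>_def field_simps)
  finally show False by simp
qed

section \<open>Barriers and growth lemmas\<close>

lemma has_hessian_subset: "has_hessian U f g H \<Longrightarrow> V \<subseteq> U \<Longrightarrow> has_hessian V f g H"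
  by (auto simp: has_hessian_def intro: continuous_on_subset)

lemma has_hessian_const: "has_hessian U (\<lambda>x. c) (\<lambda>x. 0) (\<lambda>x. 0)"
  by (simp add: has_hessian_def)

lemma has_hessian_add:
  assumes "has_hessian U f g H" "has_hessian U f' g' H'"
  shows "has_hessian U (\<lambda>x. f x + f' x) (\<lambda>x. g x + g' x) (\<lambda>x. H x + H' x)"
  using assms unfolding has_hessian_def
  by (auto intro!: continuous_intros derivative_eq_intros simp: inner_add_left matrix_vector_mult_add_rdistrib)

lemma has_hessian_cmult:
  assumes "has_hessian U f g H"
  shows "has_hessian U (\<lambda>x. c * f x) (\<lambda>x. c *\<^sub>R g x) (\<lambda>x. c *\<^sub>R H x)"
  using assms unfolding has_hessian_def
  by (auto intro!: continuous_intros derivative_eq_intros simp: scaleR_matrix_vector_assoc)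

lemma has_hessian_sum:
  assumes "finite I" "\<And>i. i \<in> I \<Longrightarrow> has_hessian U (f i) (g i) (H i)"
  shows "has_hessian U (\<lambda>x. \<Sum>i\<in>I. f i x) (\<lambda>x. \<Sum>i\<in>I. g i x) (\<lambda>x. \<Sum>i\<in>I. H i x)"
  using assms
proof (induction I rule: finite_induct)
  case empty then show ?case by (simp add: has_hessian_const)
next
  case (insert i I)
  then show ?case using has_hessian_add[of U "f i" "g i" "H i"] by simp
qed

lemma has_hessian_square:
  "has_hessian U (\<lambda>x. (x - z) \<bullet> (x - z)) (\<lambda>x. 2 *\<^sub>R (x - z)) (\<lambda>x. mat 2)"
  unfolding has_hessian_def
  by (auto intro!: continuous_intros derivative_eq_intros simp: mat_vector_mult inner_commute)

lemma has_derivative_norm_powr: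
  fixes x y :: "real^'n::finite"
  assumes "x \<noteq> y"
  shows "((\<lambda>x. norm (x - y) powr a) has_derivative (\<lambda>h. (a * norm (x - y) powr (a - 2)) * ((x - y) \<bullet> h))) (at x)"
proof -
  have n: "0 < norm (x - y)" using assms by simp
  have "((\<lambda>x. norm (x - y)) has_derivative (\<lambda>h. sgn (x - y) \<bullet> h)) (at x)"
  proof (rule has_derivative_compose[where f="\<lambda>x. x - y" and f'="\<lambda>h. h" and g=norm])
    show "(norm has_derivative (\<lambda>h. sgn (x - y) \<bullet> h)) (at (x - y))"
      using GDERIV_norm[of "x - y"] assms by (simp add: gderiv_def inner_commute)
  qed (auto intro!: derivative_eq_intros)
  moreover have "((\<lambda>r. r powr a) has_derivative (\<lambda>h. (a * norm (x - y) powr (a - 1)) * h)) (at (norm (x - y)))"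
    using has_real_derivative_powr[OF n, of a] by (simp add: has_field_derivative_def)
  ultimately have "((\<lambda>x. norm (x - y) powr a) has_derivative
      (\<lambda>h. (a * norm (x - y) powr (a - 1)) * (sgn (x - y) \<bullet> h))) (at x)"
    by (rule has_derivative_compose)
  moreover have "norm (x - y) powr (a - 1) * (sgn (x - y) \<bullet> h) = norm (x - y) powr (a - 2) * ((x - y) \<bullet> h)" for h
  proof -
    have "norm (x - y) powr (a - 1) = norm (x - y) powr (a - 2) * norm (x - y)"
      using n powr_add[of "norm (x - y)" "a - 2" 1] by simp
    then show ?thesis using n by (simp add: sgn_div_norm)
  qed
  ultimately show ?thesis by (simp add: mult.assoc)
qed

text \<open>The Hessian of the power \<open>- s\<close> of the norm, away from the origin.\<close>

definition riesz_hess :: "real \<Rightarrow> real^'n::finite \<Rightarrow> real^'n^'n" where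
  "riesz_hess s v = (s * (s + 2) * norm v powr (- s - 4)) *\<^sub>R (\<chi> i j. v $ i * v $ j)
     - mat (s * norm v powr (- s - 2))"

lemma has_hessian_riesz:
  fixes y :: "real^'n::finite"
  assumes "y \<notin> U"
  shows "has_hessian U (\<lambda>x. norm (x - y) powr (- s)) (\<lambda>x. (- s * norm (x - y) powr (- s - 2)) *\<^sub>R (x - y))
    (\<lambda>x. riesz_hess s (x - y))"
  unfolding has_hessian_def
proof (intro conjI ballI)
  have 0: "norm (x - y) \<noteq> 0" if "x \<in> U" for x using that assms by auto
  have m: "continuous_on U (\<lambda>x. mat (f x) :: real^'n^'n)" if "continuous_on U f" for f
    unfolding mat_def
  proof (intro continuous_on_vec_lambda)
    show "continuous_on U (\<lambda>x. if i = j then f x else 0)" for i j :: 'n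
      using that by (cases "i = j") auto
  qed
  show "continuous_on U (\<lambda>x. riesz_hess s (x - y))"
    unfolding riesz_hess_def using 0 by (intro continuous_intros m) auto
  fix x assume x: "x \<in> U"
  then have xy: "x \<noteq> y" using assms by auto
  show "((\<lambda>x. norm (x - y) powr (- s)) has_derivative
      (\<lambda>h. ((- s * norm (x - y) powr (- s - 2)) *\<^sub>R (x - y)) \<bullet> h)) (at x)"
    using has_derivative_norm_powr[OF xy, of "- s"] by simp
  have "((\<lambda>x. (- s * norm (x - y) powr (- s - 2)) *\<^sub>R (x - y)) has_derivative
    (\<lambda>h. (- s * norm (x - y) powr (- s - 2)) *\<^sub>R h
      + (- s * ((- s - 2) * norm (x - y) powr (- s - 2 - 2) * ((x - y) \<bullet> h))) *\<^sub>R (x - y))) (at x)"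
    by (rule derivative_eq_intros has_derivative_norm_powr[OF xy] refl)+ simp
  also have "(\<lambda>h. (- s * norm (x - y) powr (- s - 2)) *\<^sub>R h
      + (- s * ((- s - 2) * norm (x - y) powr (- s - 2 - 2) * ((x - y) \<bullet> h))) *\<^sub>R (x - y))
     = (\<lambda>h. riesz_hess s (x - y) *v h)"
  proof
    fix h
    have "(- s * norm v powr (- s - 2)) *\<^sub>R h + (- s * ((- s - 2) * norm v powr (- s - 2 - 2) * (v \<bullet> h))) *\<^sub>R v
      = riesz_hess s v *v h" for v :: "real^'n"
    proof -
      have "(\<chi> i j. v $ i * v $ j) *v h = (v \<bullet> h) *\<^sub>R v"
        by (simp add: vec_eq_iff matrix_vector_mult_def inner_vec_def sum_distrib_right sum_distrib_left mult_ac)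
      then show ?thesis
        by (simp add: riesz_hess_def matrix_vector_mult_diff_rdistrib mat_vector_mult scaleR_matrix_vector_assoc[symmetric]
            algebra_simps)
    qed
    then show "(- s * norm (x - y) powr (- s - 2)) *\<^sub>R h
      + (- s * ((- s - 2) * norm (x - y) powr (- s - 2 - 2) * ((x - y) \<bullet> h))) *\<^sub>R (x - y) = riesz_hess s (x - y) *v h" .
  qed
  finally show "((\<lambda>x. (- s * norm (x - y) powr (- s - 2)) *\<^sub>R (x - y)) has_derivative (\<lambda>h. riesz_hess s (x - y) *v h)) (at x)" .
qed

text \<open>Ellipticity bounds the radial term \<open>v \<bullet> (A *v v)\<close> below by a
  multiple of the trace. The bracket is nonnegative from \<open>s = e - 2\<close> on, which is what
  capacities use, and equals \<open>2 / e\<close> for \<open>s = e\<close>, the strict case behind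
  \<open>growth\<close>.\<close>

lemma contraction_riesz_ge:
  fixes v :: "real^'n::finite"
  assumes A: "elliptic_matrix e A" and e: "0 < e" and s: "0 < s" and v: "v \<noteq> 0"
  shows "s * norm v powr (- s - 2) * ((s + 2) / e - 1) * trace A \<le> contraction A (riesz_hess s v)"
proof -
  have n: "0 < norm v" using v by simp
  have c: "contraction A (riesz_hess s v) = s * (s + 2) * norm v powr (- s - 4) * (v \<bullet> (A *v v)) - s * norm v powr (- s - 2) * trace A"
    by (simp add: riesz_hess_def contraction_diff contraction_scaleR contraction_mat)
       (simp add: contraction_def inner_mult_vec)
  have "trace A * (norm v)\<^sup>2 / e \<le> v \<bullet> (A *v v)"
    using A e by (simp add: elliptic_matrix_def power2_norm_eq_inner divide_le_eq mult.commute)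
  then have le: "s * (s + 2) * norm v powr (- s - 4) * (trace A * (norm v)\<^sup>2 / e) \<le> s * (s + 2) * norm v powr (- s - 4) * (v \<bullet> (A *v v))"
    using s by (intro mult_left_mono) auto
  have "norm v powr (- s - 4) * (norm v)\<^sup>2 = norm v powr (- s - 2)"
  proof -
    have "- s - 4 + 2 = - s - 2" by simp
    then have "norm v powr (- s - 2) = norm v powr (- s - 4) * norm v powr 2" by (metis powr_add)
    then show ?thesis using n by (simp add: powr_numeral)
  qed
  then have eq: "norm v powr (- s - 4) * (norm v)\<^sup>2 = norm v powr (- s - 2)" .
  have "s * (s + 2) * norm v powr (- s - 4) * (trace A * (norm v)\<^sup>2 / e)
      = s * ((s + 2) / e) * (norm v powr (- s - 4) * (norm v)\<^sup>2) * trace A"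
    by (simp add: mult_ac)
  then have "s * (s + 2) * norm v powr (- s - 4) * (trace A * (norm v)\<^sup>2 / e) = s * norm v powr (- s - 2) * ((s + 2) / e) * trace A"
    unfolding eq by (simp add: mult_ac)
  then show ?thesis using le unfolding c by (simp add: algebra_simps)
qed

text \<open>\<open>M\<close> is any upper bound and need not be the supremum: the barriers only use
  \<open>u \<le> M\<close>, and an unbounded \<open>u\<close> makes the final inequality
  trivial.\<close>

locale oblique_subsolution =
  fixes \<Omega> \<Gamma>1 \<Gamma>2 :: "(real^'n::finite) set" and A :: "real^'n \<Rightarrow> real^'n^'n" and l :: "real^'n \<Rightarrow> real^'n"
    and u :: "real^'n \<Rightarrow> real" and e1 M :: real
  assumes dom: "bounded_domain \<Omega>"
    and front: "frontier \<Omega> = \<Gamma>1 \<union> {0} \<union> \<Gamma>2"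
    and e1: "0 < e1" and ell: "\<And>x. x \<in> \<Omega> \<Longrightarrow> elliptic_matrix e1 (A x)"
    and outward: "\<And>x. x \<in> \<Gamma>2 \<Longrightarrow> \<forall>\<^sub>F t in at_right 0. x - t *\<^sub>R l x \<in> \<Omega>"
    and sub: "sub_elliptic \<Omega> \<Gamma>2 A u" and cont: "continuous_on (\<Omega> \<union> \<Gamma>1 \<union> \<Gamma>2) u"
    and pos: "\<And>x. x \<in> \<Omega> \<Longrightarrow> 0 < u x" and \<Gamma>1: "\<And>x. x \<in> \<Gamma>1 \<Longrightarrow> u x \<le> 0"
    and obl: "oblique_deriv_le_0 \<Gamma>2 l u" and M: "\<And>x. x \<in> \<Omega> \<Longrightarrow> u x \<le> M"
begin

lemma open_\<Omega>: "open \<Omega>" and bounded_\<Omega>: "bounded \<Omega>"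
  using dom by (auto simp: bounded_domain_def)

lemma M_pos: "0 < M"
proof -
  obtain x where "x \<in> \<Omega>" using dom by (auto simp: bounded_domain_def)
  then show ?thesis using pos M by force
qed

lemma cont_\<Omega>: "continuous_on \<Omega> u"
  by (rule continuous_on_subset[OF cont]) auto

lemma closure_cases: "x \<in> closure \<Omega> \<Longrightarrow> x \<noteq> 0 \<Longrightarrow> x \<in> \<Omega> \<union> \<Gamma>1 \<union> \<Gamma>2"
  using front by (auto simp: closure_Un_frontier)

lemma touching_interior:
  assumes U: "open U" "U \<subseteq> \<Omega>" "z \<in> U" and hess: "has_hessian U \<phi> g H"
    and \<kappa>: "0 < \<kappa>" and strict: "\<And>x. x \<in> U \<Longrightarrow> contraction (A x) (H x) + \<kappa> * trace (A x) \<le> 0"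
    and mx: "\<And>x. x \<in> U \<Longrightarrow> u x - \<phi> x \<le> u z - \<phi> z"
  shows False
proof -
  obtain D2 where D2: "W2_with \<Omega> (real CARD('n)) u D2"
    "AE x in lebesgue. x \<in> \<Omega> \<longrightarrow> - (\<Sum>i\<in>UNIV. \<Sum>j\<in>UNIV. A x $ i $ j * D2 i j x) \<le> 0"
    using sub by (auto simp: sub_elliptic_def)
  show False
    by (rule no_interior_touching[OF open_\<Omega> bounded_\<Omega> D2(1) cont_\<Omega> e1 ell D2(2) U hess \<kappa> strict mx])
qed

text \<open>Since \<open>u - \<phi>\<close> is largest at \<open>z\<close>, the backward difference
  quotient of \<open>\<phi>\<close> along \<open>l z\<close> is at most that of \<open>u\<close>. In
  the limit \<open>g \<bullet> l z\<close> is at most the oblique derivative of \<open>u\<close>,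
  which is nonpositive.\<close>

lemma touching_oblique:
  assumes z: "z \<in> \<Gamma>2" and V: "open V" "z \<in> V" and d\<phi>: "(\<phi> has_derivative (\<lambda>h. g \<bullet> h)) (at z)"
    and gl: "0 < g \<bullet> l z" and mx: "\<And>x. x \<in> V \<inter> \<Omega> \<Longrightarrow> u x - \<phi> x \<le> u z - \<phi> z"
  shows False
proof -
  obtain d where d: "d \<le> 0" "((\<lambda>t. (u z - u (z - t *\<^sub>R l z)) / t) \<longlongrightarrow> d) (at_right 0)"
    using obl z unfolding oblique_deriv_le_0_def has_oblique_deriv_def by blast
  have "((\<lambda>t. \<phi> (z - t *\<^sub>R l z)) has_derivative (\<lambda>h. g \<bullet> (- (h *\<^sub>R l z)))) (at 0)"
    by (rule has_derivative_compose[where f="\<lambda>t. z - t *\<^sub>R l z" and g=\<phi> and f'="\<lambda>h. - (h *\<^sub>R l z)"])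
       (use d\<phi> in \<open>auto intro!: derivative_eq_intros\<close>)
  then have "((\<lambda>t. \<phi> (z - t *\<^sub>R l z)) has_real_derivative (- (g \<bullet> l z))) (at 0)"
    unfolding has_field_derivative_def by (rule has_derivative_eq_rhs) (simp add: fun_eq_iff)
  then have "((\<lambda>t. (\<phi> (z - t *\<^sub>R l z) - \<phi> z) / t) \<longlongrightarrow> - (g \<bullet> l z)) (at 0)"
    by (simp add: DERIV_def)
  then have "((\<lambda>t. - ((\<phi> (z - t *\<^sub>R l z) - \<phi> z) / t)) \<longlongrightarrow> g \<bullet> l z) (at_right 0)"
    using tendsto_minus filterlim_at_split by force
  then have lim: "((\<lambda>t. (\<phi> z - \<phi> (z - t *\<^sub>R l z)) / t) \<longlongrightarrow> g \<bullet> l z) (at_right 0)"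
    by (simp add: minus_divide_left)
  have "((\<lambda>t. z - t *\<^sub>R l z) \<longlongrightarrow> z - 0 *\<^sub>R l z) (at_right 0)"
    by (intro tendsto_intros)
  then have inV: "\<forall>\<^sub>F t in at_right 0. z - t *\<^sub>R l z \<in> V"
    using V by (intro topological_tendstoD) auto
  have "\<forall>\<^sub>F t::real in at_right 0. 0 < t" by (simp add: eventually_at_right_less)
  with inV outward[OF z] have "\<forall>\<^sub>F t in at_right 0. (\<phi> z - \<phi> (z - t *\<^sub>R l z)) / t \<le> (u z - u (z - t *\<^sub>R l z)) / t"
  proof eventually_elim
    case (elim t)
    then have "u (z - t *\<^sub>R l z) - \<phi> (z - t *\<^sub>R l z) \<le> u z - \<phi> z" by (intro mx) auto
    then show ?case using elim(3) by (intro divide_right_mono) auto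
  qed
  then have "g \<bullet> l z \<le> d"
    by (rule tendsto_le[OF _ d(2) lim, rotated]) simp
  then show False using gl d(1) by simp
qed

lemma le_on_closure:
  assumes x: "x \<in> closure \<Omega>" "x \<in> \<Omega> \<union> \<Gamma>1 \<union> \<Gamma>2"
  shows "u x \<le> M"
proof (cases "x \<in> \<Omega>")
  case False
  have "(u \<longlongrightarrow> u x) (at x within \<Omega>)"
    using cont x(2) by (auto simp: continuous_on_def intro: tendsto_within_subset)
  moreover have "at x within \<Omega> \<noteq> bot"
    using x False by (auto simp: trivial_limit_within islimpt_in_closure)
  moreover have "\<forall>\<^sub>F y in at x within \<Omega>. u y \<le> M"
    by (auto simp: eventually_at_topological M)
  ultimately show ?thesis by (auto intro: tendsto_upperbound)
qed (rule M)

text \<open>Comparison on an annulus with a barrier \<open>\<phi>\<close> that equals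
  \<open>M\<close> on the outer sphere and is at least \<open>m0\<close> throughout. At a positive
  maximum of \<open>u - \<phi>\<close> the outer sphere is excluded by \<open>u \<le> M\<close>, the
  inner one by \<open>inner\<close>, \<open>\<Gamma>1\<close> by \<open>u \<le> 0\<close>, and the
  rest by the two touching lemmas. Between \<open>r\<close> and \<open>\<rho>\<close> the annulus
  may reach \<open>\<Gamma>2\<close>; there \<open>angle\<close> makes the barrier increase along
  \<open>l\<close>.\<close>

lemma growth:
  assumes b: "0 < b" "b < r" "r < \<rho>" and z0: "0 \<notin> cball z \<rho>"
    and \<Gamma>2r: "\<Gamma>2 \<inter> ball z r = {}"
    and angle: "\<And>y. y \<in> \<Gamma>2 \<inter> ball z \<rho> \<Longrightarrow> 0 < (y - z) \<bullet> l y"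
    and m0: "0 \<le> m0" "m0 \<le> M" and inner: "\<And>x. x \<in> \<Omega> \<inter> cball z b \<Longrightarrow> u x \<le> m0"
    and x: "x \<in> \<Omega> \<inter> ball z r"
  shows "u x \<le> M - (M - m0) * (b powr e1 * (r powr (- e1) - \<rho> powr (- e1)))"
proof -
  \<comment> \<open>With this factor \<open>\<phi>\<close> is
    \<open>m0 + k * \<rho> powr (- e1)\<close> on the inner sphere and \<open>M\<close> on the outer
    one.\<close>
  define k where "k = (M - m0) * b powr e1"
  define \<phi> where "\<phi> = (\<lambda>x. (M + k * \<rho> powr (- e1)) + (- k) * norm (x - z) powr (- e1))"
  define g where "g = (\<lambda>x. 0 + (- k) *\<^sub>R ((- e1 * norm (x - z) powr (- e1 - 2)) *\<^sub>R (x - z)))"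
  define H where "H = (\<lambda>x. 0 + (- k) *\<^sub>R riesz_hess e1 (x - z))"
  have k: "0 \<le> k" using m0 by (simp add: k_def)
  have bb: "b powr e1 * b powr (- e1) = 1" using b by (simp add: powr_minus field_simps)
  have anti: "q powr (- e1) \<le> p powr (- e1)" if "0 < p" "p \<le> q" for p q :: real
    using that e1 by (intro powr_mono2') auto
  have \<phi>low: "m0 \<le> \<phi> y" if "b \<le> norm (y - z)" for y
  proof -
    have "k * norm (y - z) powr (- e1) \<le> k * b powr (- e1)"
      using that b k by (intro mult_left_mono anti) auto
    also have "\<dots> = M - m0" using bb by (simp add: k_def mult.assoc)
    finally have "k * norm (y - z) powr (- e1) \<le> M - m0" .
    moreover have "0 \<le> k * \<rho> powr (- e1)" using k by simp
    ultimately show ?thesis by (simp add: \<phi>_def)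
  qed
  have target: "M - (M - m0) * (b powr e1 * (r powr (- e1) - \<rho> powr (- e1))) = M - k * r powr (- e1) + k * \<rho> powr (- e1)"
    by (simp add: k_def algebra_simps)
  define K where "K = closure \<Omega> \<inter> (cball z \<rho> - ball z b)"
  have cK: "compact K"
  proof -
    have "compact (closure \<Omega>)" using bounded_\<Omega> by (simp add: compact_closure)
    moreover have "closed (cball z \<rho> - ball z b)" by (intro closed_Diff) auto
    ultimately show ?thesis unfolding K_def by (rule compact_Int_closed)
  qed
  have Ksub: "K \<subseteq> \<Omega> \<union> \<Gamma>1 \<union> \<Gamma>2"
  proof
    fix y assume "y \<in> K"
    then have "y \<in> closure \<Omega>" "y \<noteq> 0" using z0 by (auto simp: K_def)
    then show "y \<in> \<Omega> \<union> \<Gamma>1 \<union> \<Gamma>2" by (rule closure_cases)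
  qed
  have Kn: "b \<le> norm (y - z)" "norm (y - z) \<le> \<rho>" if "y \<in> K" for y
    using that by (auto simp: K_def dist_norm norm_minus_commute)
  have "continuous_on K (\<lambda>y. norm (y - z) powr (- e1))"
    using Kn(1) b by (intro continuous_intros) force
  then have cw: "continuous_on K (\<lambda>y. u y - \<phi> y)"
    unfolding \<phi>_def using continuous_on_subset[OF cont Ksub]
    by (intro continuous_on_diff continuous_on_add continuous_on_mult continuous_on_const)
  have le: "u y \<le> \<phi> y" if yK: "y \<in> K" for y
  proof (rule ccontr)
    assume "\<not> u y \<le> \<phi> y"
    obtain w where w: "w \<in> K" "\<And>y. y \<in> K \<Longrightarrow> u y - \<phi> y \<le> u w - \<phi> w"
      using continuous_attains_sup[OF cK _ cw] yK by blast
    then have wpos: "\<phi> w < u w" using yK \<open>\<not> u y \<le> \<phi> y\<close> by force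
    have "w \<in> closure \<Omega>" using w(1) by (simp add: K_def)
    then have uM: "u w \<le> M" using w(1) Ksub by (intro le_on_closure) auto
    have low: "m0 \<le> \<phi> w" using \<phi>low Kn[OF w(1)] by blast
    have "w \<notin> \<Gamma>1" using \<Gamma>1[of w] wpos low m0 by auto
    then have w2: "w \<in> \<Omega> \<or> w \<in> \<Gamma>2" using w(1) Ksub by auto
    have "norm (w - z) \<noteq> \<rho>"
    proof
      assume "norm (w - z) = \<rho>"
      then have "\<phi> w = M" by (simp add: \<phi>_def)
      then show False using wpos uM by simp
    qed
    moreover have "norm (w - z) \<noteq> b"
    proof
      assume nb: "norm (w - z) = b"
      then have "w \<notin> \<Gamma>2" using \<Gamma>2r b by (auto simp: dist_norm norm_minus_commute)
      then have "u w \<le> m0" using w2 nb by (intro inner) (auto simp: dist_norm norm_minus_commute)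
      then show False using wpos low by simp
    qed
    ultimately have wV: "w \<in> ball z \<rho> - cball z b" using Kn[OF w(1)] by (auto simp: dist_norm norm_minus_commute)
    have M0: "0 < k"
    proof -
      have "m0 < M" using wpos low uM by simp
      then show ?thesis using b by (simp add: k_def)
    qed
    have hess: "has_hessian (ball z \<rho> - cball z b) \<phi> g H"
      unfolding \<phi>_def g_def H_def using b
      by (intro has_hessian_add has_hessian_const has_hessian_cmult has_hessian_riesz) auto
    have mx: "u y - \<phi> y \<le> u w - \<phi> w" if "y \<in> (ball z \<rho> - cball z b) \<inter> \<Omega>" for y
      using that closure_subset[of \<Omega>] by (intro w(2)) (auto simp: K_def)
    show False
    proof (cases "w \<in> \<Omega>")
      case True
      \<comment> \<open>The surplus of \<open>contraction_riesz_ge\<close> at \<open>s = e1\<close>,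
        where \<open>e1 * ((e1 + 2) / e1 - 1) = 2\<close>, with the norm replaced by its largest
        value \<open>\<rho>\<close>.\<close>
      define \<kappa> where "\<kappa> = 2 * k * \<rho> powr (- e1 - 2)"
      show False
      proof (rule touching_interior)
        show "open ((ball z \<rho> - cball z b) \<inter> \<Omega>)" using open_\<Omega> by (intro open_Int open_Diff) auto
        show "w \<in> (ball z \<rho> - cball z b) \<inter> \<Omega>" using wV True by auto
        show "has_hessian ((ball z \<rho> - cball z b) \<inter> \<Omega>) \<phi> g H"
          using hess by (rule has_hessian_subset) auto
        show "0 < \<kappa>" using M0 b by (simp add: \<kappa>_def)
        fix y assume y: "y \<in> (ball z \<rho> - cball z b) \<inter> \<Omega>"
        then have yz: "y - z \<noteq> 0" and yn: "norm (y - z) \<le> \<rho>" using b by (auto simp: dist_norm norm_minus_commute)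
        have tr: "0 < trace (A y)" using ell[of y] y by (simp add: elliptic_matrix_def)
        have "2 * \<rho> powr (- e1 - 2) * trace (A y) \<le> e1 * norm (y - z) powr (- e1 - 2) * ((e1 + 2) / e1 - 1) * trace (A y)"
        proof -
          have "\<rho> powr (- e1 - 2) \<le> norm (y - z) powr (- e1 - 2)"
            using yz yn e1 by (intro powr_mono2') auto
          then show ?thesis using tr e1 by (simp add: field_simps)
        qed
        also have "\<dots> \<le> contraction (A y) (riesz_hess e1 (y - z))"
          using y by (intro contraction_riesz_ge ell e1 yz) auto
        finally have "k * (2 * \<rho> powr (- e1 - 2) * trace (A y)) \<le> k * contraction (A y) (riesz_hess e1 (y - z))"
          using k by (intro mult_left_mono)
        then show "contraction (A y) (H y) + \<kappa> * trace (A y) \<le> 0"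
          by (simp add: H_def contraction_minus contraction_scaleR \<kappa>_def mult_ac)
      qed (use mx in auto)
    next
      case False
      then have w\<Gamma>: "w \<in> \<Gamma>2" using w2 by blast
      show False
      proof (rule touching_oblique[OF w\<Gamma> _ wV])
        show "open (ball z \<rho> - cball z b)" by (intro open_Diff) auto
        show "(\<phi> has_derivative (\<lambda>h. g w \<bullet> h)) (at w)" using hess wV by (simp add: has_hessian_def)
        have "w \<noteq> z" using wV b by auto
        moreover have "0 < (w - z) \<bullet> l w" using angle w\<Gamma> wV by auto
        ultimately show "0 < g w \<bullet> l w" using M0 e1 by (simp add: g_def)
      qed (rule mx)
    qed
  qed
  show ?thesis
  proof (cases "x \<in> cball z b")
    case True
    have "u x \<le> m0" using x True by (intro inner) auto
    also have "m0 \<le> M - k * r powr (- e1) + k * \<rho> powr (- e1)"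
    proof -
      have "k * r powr (- e1) \<le> k * b powr (- e1)" using b k by (intro mult_left_mono anti) auto
      also have "\<dots> = M - m0" using bb by (simp add: k_def mult.assoc)
      finally have "k * r powr (- e1) \<le> M - m0" .
      moreover have "0 \<le> k * \<rho> powr (- e1)" using k by simp
      ultimately show ?thesis by simp
    qed
    finally show ?thesis unfolding target .
  next
    case False
    have "x \<in> K" using x False b closure_subset[of \<Omega>] by (auto simp: K_def)
    then have "u x \<le> \<phi> x" by (rule le)
    moreover have "k * r powr (- e1) \<le> k * norm (x - z) powr (- e1)"
      using x False b k by (intro mult_left_mono anti) (auto simp: dist_norm norm_minus_commute)
    ultimately show ?thesis unfolding target by (simp add: \<phi>_def)
  qed
qed

end

text \<open>A finite cover by balls of radius \<open>d / 2\<close>, made disjoint. It serves twice: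
  to replace a measure by point masses, and to cut the first ball into pieces.\<close>

lemma finite_borel_partition:
  fixes B :: "(real^'n::finite) set"
  assumes "bounded B" "0 < d"
  obtains n :: nat and Q where "\<And>i. Q i \<in> sets borel" "disjoint_family Q" "B \<subseteq> (\<Union>i<n. Q i)"
    "\<And>i x y. x \<in> Q i \<Longrightarrow> y \<in> Q i \<Longrightarrow> dist x y < d"
proof -
  have "compact (closure B)" using assms by (simp add: compact_closure)
  moreover have "closure B \<subseteq> (\<Union>c\<in>closure B. ball c (d / 2))" using assms by auto
  ultimately obtain C where C: "C \<subseteq> closure B" "finite C" "closure B \<subseteq> (\<Union>c\<in>C. ball c (d / 2))"
    using compactE_image[of "closure B" "closure B" "\<lambda>c. ball c (d / 2)"] by (metis open_ball)
  obtain h where h: "bij_betw h {0..<card C} C" using ex_bij_betw_nat_finite[OF C(2)] by blast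
  define R where "R = (\<lambda>i. if i < card C then ball (h i) (d / 2) else {})"
  have sub: "disjointed R i \<subseteq> R i" for i by (rule disjointed_subset)
  show ?thesis
  proof (rule that[of "disjointed R" "card C"])
    show "disjointed R i \<in> sets borel" for i
      unfolding disjointed_def R_def by auto
    show "disjoint_family (disjointed R)" by (rule disjoint_family_disjointed)
    show "B \<subseteq> (\<Union>i<card C. disjointed R i)"
    proof
      fix x assume "x \<in> B"
      then obtain c where c: "c \<in> C" "x \<in> ball c (d / 2)" using C(3) closure_subset[of B] by blast
      have "c \<in> h ` {0..<card C}" using c(1) bij_betw_imp_surj_on[OF h] by simp
      then obtain i where "i < card C" "h i = c" by auto
      then have "x \<in> (\<Union>i. R i)" using c(2) by (intro UN_I[of i]) (simp_all add: R_def)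
      then have "x \<in> (\<Union>i. disjointed R i)" using UN_disjointed_eq[of R] by simp
      then obtain j where j: "x \<in> disjointed R j" by blast
      then have "j < card C" using sub[of j] by (auto simp: R_def split: if_splits)
      then show "x \<in> (\<Union>i<card C. disjointed R i)" using j by blast
    qed
    fix i x y assume "x \<in> disjointed R i" "y \<in> disjointed R i"
    then have "dist (h i) x < d / 2" "dist (h i) y < d / 2"
      using sub[of i] by (auto simp: R_def split: if_splits)
    then show "dist x y < d" using dist_triangle_half_r by blast
  qed
qed

lemma contraction_sum: "contraction A (\<Sum>i\<in>I. f i) = (\<Sum>i\<in>I. contraction A (f i))"
  by (induction I rule: infinite_finite_induct) (simp_all add: contraction_add, simp_all add: contraction_def)

text \<open>The potential of \<^term>\<open>\<mu>\<close> on \<^term>\<open>P\<close> is replaced by a finite sum of point potentials \<^term>\<open>V\<close>, which is smooth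
  in the domain. The sum blows up at its poles, so the comparison is made only on the set \<^term>\<open>K\<close> where
  \<^term>\<open>u\<close> is at least \<^term>\<open>\<epsilon>\<close>: it has positive distance from \<^term>\<open>P\<close>, and there the sum is at most twice the
  potential.\<close>

lemma (in oblique_subsolution) capacity_growth:
  assumes r: "0 < r" and 0: "0 \<notin> cball y0 (4 * r)" and \<Gamma>2: "\<Gamma>2 \<inter> cball y0 (4 * r) = {}"
    and s: "0 < s" "e1 - 2 \<le> s"
    and \<mu>: "sets \<mu> = sets (restrict_space borel H)" and P: "P \<in> sets \<mu>" "P \<subseteq> \<Gamma>1 \<inter> ball y0 r"
    and pot: "\<And>x. x \<in> \<Omega> \<Longrightarrow> (\<integral>\<^sup>+ y. ennreal (1 / norm (x - y) powr s) * indicator P y \<partial>\<mu>) \<le> 1"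
    and fin: "emeasure \<mu> P < \<infinity>" and x: "x \<in> \<Omega> \<inter> ball y0 r"
  shows "u x \<le> M * (1 - ((2 * r) powr (- s) - (3 * r) powr (- s)) * measure \<mu> P / 2)"
proof (rule field_le_epsilon)
  fix e :: real assume e: "0 < e"
  define m where "m = measure \<mu> P"
  have m: "0 \<le> m" by (simp add: m_def)
  \<comment> \<open>The total error \<open>e\<close> is shared between the cutoff level
    \<open>\<epsilon>\<close> and the quadratic correction; \<open>\<epsilon> \<le> u x\<close> puts
    the point \<open>x\<close> into \<open>K\<close>.\<close>
  define \<epsilon> where "\<epsilon> = min (u x) (e / 2)"
  have \<epsilon>: "0 < \<epsilon>" "\<epsilon> \<le> u x" "\<epsilon> \<le> e / 2" using e pos x by (auto simp: \<epsilon>_def)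
  define \<kappa> where "\<kappa> = e / (2 * (4 * r)\<^sup>2)"
  have \<kappa>: "0 < \<kappa>" "\<kappa> * (4 * r)\<^sup>2 = e / 2" using e r by (auto simp: \<kappa>_def)
  define K0 where "K0 = closure \<Omega> \<inter> cball y0 (4 * r)"
  have K0: "K0 \<subseteq> \<Omega> \<union> \<Gamma>1"
  proof
    fix y assume y: "y \<in> K0"
    then have "y \<noteq> 0" using 0 by (auto simp: K0_def)
    then show "y \<in> \<Omega> \<union> \<Gamma>1" using closure_cases[of y] y \<Gamma>2 by (auto simp: K0_def)
  qed
  have cK0: "compact K0" unfolding K0_def using bounded_\<Omega> by (intro compact_Int_closed) (auto simp: compact_closure)
  define K where "K = {y \<in> K0. \<epsilon> \<le> u y}"
  have contK0: "continuous_on K0 u" using cont K0 by (auto intro: continuous_on_subset)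
  have "closed K" unfolding K_def
    by (intro continuous_on_closed_Collect_le contK0 continuous_intros compact_imp_closed cK0)
  then have cK: "compact K" using cK0 compact_Int_closed[of K0 K] by (simp add: K_def Int_def conj_ac cong: conj_cong)
  have K\<Omega>: "K \<subseteq> \<Omega>" using K0 \<Gamma>1 \<epsilon>(1) by (force simp: K_def)
  have clP: "closure P \<subseteq> \<Gamma>1"
  proof
    fix y assume y: "y \<in> closure P"
    have "P \<subseteq> frontier \<Omega>" using P(2) front by auto
    then have "closure P \<subseteq> frontier \<Omega>" by (rule closure_minimal) (rule frontier_closed)
    moreover have "closure P \<subseteq> cball y0 r" using P(2) by (intro closure_minimal) auto
    ultimately have "y \<in> frontier \<Omega>" "y \<in> cball y0 (4 * r)" using y r by (auto dest!: subsetD)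
    then show "y \<in> \<Gamma>1" using front 0 \<Gamma>2 by auto
  qed
  then have "K \<inter> closure P = {}" using \<Gamma>1 \<epsilon>(1) by (force simp: K_def)
  then obtain d0 where d0: "0 < d0" "\<And>y z. y \<in> K \<Longrightarrow> z \<in> closure P \<Longrightarrow> d0 \<le> dist y z"
    using separate_compact_closed[OF cK closed_closure] by meson
  have d0P: "d0 \<le> norm (y - z)" if "y \<in> K" "z \<in> P" for y z
    using d0(2)[of y z] that closure_subset[of P] by (auto simp: dist_norm)
  \<comment> \<open>Shrinking a distance by the factor \<open>\<beta>\<close> doubles the kernel of
    order \<open>s\<close>. With the mesh \<open>(1 - \<beta>) * d0\<close>, moving the mass of a
    piece to its pole \<open>c i\<close> shrinks distances to \<open>K\<close> by no more than this
    factor.\<close>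
  define \<beta> where "\<beta> = (2::real) powr (- 1 / s)"
  have \<beta>: "0 < \<beta>" "\<beta> < 1" "\<beta> powr (- s) = 2"
    using s by (auto simp: \<beta>_def powr_powr powr_less_one)
  have "bounded P" using P(2) bounded_subset[OF bounded_ball[of y0 r]] by blast
  then obtain n :: nat and Q where Q: "\<And>i. Q i \<in> sets borel" "disjoint_family Q" "P \<subseteq> (\<Union>i<n. Q i)"
    "\<And>i x y. x \<in> Q i \<Longrightarrow> y \<in> Q i \<Longrightarrow> dist x y < (1 - \<beta>) * d0"
    by (rule finite_borel_partition[of P "(1 - \<beta>) * d0"]) (use \<beta> d0 in auto)
  define I where "I = {i. i < n \<and> P \<inter> Q i \<noteq> {}}"
  have fI: "finite I" by (simp add: I_def)
  have "\<forall>i\<in>I. \<exists>y. y \<in> P \<inter> Q i" by (auto simp: I_def)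
  then obtain c where c: "\<And>i. i \<in> I \<Longrightarrow> c i \<in> P \<inter> Q i" by metis
  have PQ: "P \<inter> Q i \<in> sets \<mu>" for i
  proof -
    have PH: "P \<subseteq> H" using P(1) \<mu> by (auto simp: sets_restrict_space)
    have "H \<inter> Q i \<in> sets \<mu>" using Q(1) unfolding \<mu> by (auto simp: sets_restrict_space)
    then have "P \<inter> (H \<inter> Q i) \<in> sets \<mu>" using P(1) by blast
    moreover have "P \<inter> (H \<inter> Q i) = P \<inter> Q i" using PH by auto
    ultimately show ?thesis by simp
  qed
  have finPQ: "emeasure \<mu> (P \<inter> Q i) < \<infinity>" for i
    using emeasure_mono[of "P \<inter> Q i" P \<mu>] P(1) fin by (simp add: order_le_less_trans)
  define a where "a = (\<lambda>i. measure \<mu> (P \<inter> Q i))"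
  have a: "0 \<le> a i" for i by (simp add: a_def)
  have un: "P = (\<Union>i\<in>I. P \<inter> Q i)" 
  proof (intro equalityI subsetI)
    fix z assume z: "z \<in> P"
    then have "z \<in> (\<Union>i<n. Q i)" using Q(3) by (rule subsetD[rotated])
    then obtain i where i: "i < n" "z \<in> Q i" by auto
    then have "i \<in> I" using z by (auto simp: I_def)
    then show "z \<in> (\<Union>i\<in>I. P \<inter> Q i)" using z i by (intro UN_I[of i]) auto
  qed auto
  have disj: "P \<inter> Q i \<inter> (P \<inter> Q j) = {}" if "i \<noteq> j" for i j
    using Q(2) that by (auto simp: disjoint_family_on_def)
  have suma: "(\<Sum>i\<in>I. a i) = m"
  proof -
    have "measure \<mu> (\<Union>i\<in>I. P \<inter> Q i) = (\<Sum>i\<in>I. measure \<mu> (P \<inter> Q i))"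
      using PQ finPQ disj fI by (intro measure_UNION') (auto simp: fmeasurable_def pairwise_def disjnt_def)
    then show ?thesis using un by (simp add: a_def m_def)
  qed
  define V where "V = (\<lambda>y. \<Sum>i\<in>I. a i * norm (y - c i) powr (- s))"
  have V2: "V y \<le> 2" if y: "y \<in> K" for y
  proof -
    let ?F = "\<lambda>z. ennreal (1 / norm (y - z) powr s)"
    have Fm [measurable]: "?F \<in> borel_measurable \<mu>"
    proof -
      have "?F \<in> borel_measurable (restrict_space borel H)"
        by (intro measurable_restrict_space1) measurable
      then show ?thesis by (simp cong: measurable_cong_sets add: \<mu>)
    qed
    have "ennreal (V y) = (\<Sum>i\<in>I. ennreal (a i * norm (y - c i) powr (- s)))"
      unfolding V_def using a by (intro sum_ennreal[symmetric]) auto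
    also have "\<dots> \<le> (\<Sum>i\<in>I. \<integral>\<^sup>+z. ennreal 2 * (?F z * indicator (P \<inter> Q i) z) \<partial>\<mu>)"
    proof (rule sum_mono)
      fix i assume i: "i \<in> I"
      have "ennreal (a i * norm (y - c i) powr (- s)) = ennreal (norm (y - c i) powr (- s)) * emeasure \<mu> (P \<inter> Q i)"
        using finPQ[of i] by (simp add: a_def ennreal_mult emeasure_eq_ennreal_measure mult.commute less_top)
      also have "\<dots> = (\<integral>\<^sup>+z. ennreal (norm (y - c i) powr (- s)) * indicator (P \<inter> Q i) z \<partial>\<mu>)"
        using PQ by (simp add: nn_integral_cmult_indicator)
      also have "\<dots> \<le> (\<integral>\<^sup>+z. ennreal 2 * (?F z * indicator (P \<inter> Q i) z) \<partial>\<mu>)"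
      proof (rule nn_integral_mono)
        fix z
        show "ennreal (norm (y - c i) powr (- s)) * indicator (P \<inter> Q i) z \<le> ennreal 2 * (?F z * indicator (P \<inter> Q i) z)"
        proof (cases "z \<in> P \<inter> Q i")
          case True
          have yz: "d0 \<le> norm (y - z)" using d0P y True by auto
          have "norm (z - c i) < (1 - \<beta>) * d0" using Q(4)[of z i "c i"] True c[OF i] by (auto simp: dist_norm)
          also have "\<dots> \<le> (1 - \<beta>) * norm (y - z)" using yz \<beta> by (intro mult_left_mono) auto
          finally have "\<beta> * norm (y - z) \<le> norm (y - c i)"
            using norm_triangle_ineq4[of "y - c i" "z - c i"] by (simp add: algebra_simps)
          then have "norm (y - c i) powr (- s) \<le> (\<beta> * norm (y - z)) powr (- s)"
            using s by (intro powr_mono2' mult_pos_pos \<beta>(1) less_le_trans[OF d0(1) yz]) auto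
          also have "\<dots> = 2 * (1 / norm (y - z) powr s)"
            unfolding powr_mult \<beta>(3) by (simp add: powr_minus_divide)
          finally have "ennreal (norm (y - c i) powr (- s)) \<le> ennreal (2 * (1 / norm (y - z) powr s))"
            by (rule ennreal_leI)
          also have "\<dots> = ennreal 2 * ?F z" by (rule ennreal_mult) auto
          finally have "ennreal (norm (y - c i) powr (- s)) \<le> ennreal 2 * ?F z" .
          then show ?thesis using True by simp
        qed simp
      qed
      finally show "ennreal (a i * norm (y - c i) powr (- s)) \<le> (\<integral>\<^sup>+z. ennreal 2 * (?F z * indicator (P \<inter> Q i) z) \<partial>\<mu>)" .
    qed
    also have "\<dots> = (\<integral>\<^sup>+z. ennreal 2 * (\<Sum>i\<in>I. ?F z * indicator (P \<inter> Q i) z) \<partial>\<mu>)"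
      using PQ by (simp add: nn_integral_cmult nn_integral_sum sum_distrib_left)
    also have "\<dots> = (\<integral>\<^sup>+z. ennreal 2 * (?F z * indicator P z) \<partial>\<mu>)"
    proof (rule nn_integral_cong)
      fix z
      have "(\<Sum>i\<in>I. indicator (P \<inter> Q i) z) = (indicator (\<Union>i\<in>I. P \<inter> Q i) z :: ennreal)"
        using disj by (intro indicator_UN_disjoint[symmetric] fI) (auto simp: disjoint_family_on_def)
      then show "ennreal 2 * (\<Sum>i\<in>I. ?F z * indicator (P \<inter> Q i) z) = ennreal 2 * (?F z * indicator P z)"
        using un by (simp flip: sum_distrib_left)
    qed
    also have "\<dots> = ennreal 2 * (\<integral>\<^sup>+z. ?F z * indicator P z \<partial>\<mu>)"
      using P(1) by (simp add: nn_integral_cmult)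
    also have "\<dots> \<le> ennreal 2 * 1" using pot y K\<Omega> by (intro mult_left_mono) auto
    finally have "ennreal (V y) \<le> ennreal 2" by simp
    then show ?thesis by (subst (asm) ennreal_le_iff) auto
  qed
  \<comment> \<open>The constants match three bounds for \<open>V\<close>: at most 2 on
    \<open>K\<close>, whence \<open>0 \<le> \<phi>\<close> there; at most
    \<open>m * (3 * r) powr (- s)\<close> at distance \<open>4 * r\<close>, whence
    \<open>M \<le> \<phi>\<close> there; at least \<open>m * (2 * r) powr (- s)\<close> at
    \<open>x\<close>, the gain. The quadratic term makes the supersolution strict even for
    \<open>s = e1 - 2\<close>.\<close>
  define \<phi> where "\<phi> = (\<lambda>y. (M * (1 + (3 * r) powr (- s) * m / 2) + \<kappa> * (4 * r)\<^sup>2)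
      + ((- M / 2) * V y + (- \<kappa>) * ((y - y0) \<bullet> (y - y0))))"
  define g where "g = (\<lambda>y. 0 + ((- M / 2) *\<^sub>R (\<Sum>i\<in>I. a i *\<^sub>R ((- s * norm (y - c i) powr (- s - 2)) *\<^sub>R (y - c i)))
      + (- \<kappa>) *\<^sub>R (2 *\<^sub>R (y - y0))))"
  define Hs where "Hs = (\<lambda>y. 0 + ((- M / 2) *\<^sub>R (\<Sum>i\<in>I. a i *\<^sub>R riesz_hess s (y - c i)) + (- \<kappa>) *\<^sub>R mat 2))"
  have c\<Gamma>: "c i \<in> \<Gamma>1" "norm (c i - y0) < r" if "i \<in> I" for i
    using c[OF that] P(2) by (auto simp: dist_norm norm_minus_commute)
  have \<Gamma>1\<Omega>: "\<Gamma>1 \<inter> \<Omega> = {}" using front open_\<Omega> by (auto simp: frontier_def interior_open)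
  have hess: "has_hessian \<Omega> \<phi> g Hs"
    unfolding \<phi>_def g_def Hs_def V_def using c\<Gamma>(1) \<Gamma>1\<Omega>
    by (intro has_hessian_add has_hessian_const has_hessian_cmult has_hessian_sum has_hessian_riesz has_hessian_square fI) auto
  have sq: "(y - y0) \<bullet> (y - y0) \<le> (4 * r)\<^sup>2" if "y \<in> cball y0 (4 * r)" for y
    using that unfolding power2_norm_eq_inner[symmetric] by (intro power_mono) (auto simp: dist_norm norm_minus_commute)
  have le: "u y - \<phi> y \<le> \<epsilon>" if yK: "y \<in> K" for y
  proof (rule ccontr)
    assume "\<not> u y - \<phi> y \<le> \<epsilon>"
    have "continuous_on K \<phi>"
      using hess K\<Omega> unfolding has_hessian_def
      by (intro continuous_at_imp_continuous_on ballI) (blast intro: has_derivative_continuous)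
    then have "continuous_on K (\<lambda>y. u y - \<phi> y)"
      using continuous_on_subset[OF cont_\<Omega> K\<Omega>] by (intro continuous_intros)
    then obtain w where w: "w \<in> K" "\<And>y. y \<in> K \<Longrightarrow> u y - \<phi> y \<le> u w - \<phi> w"
      using continuous_attains_sup[OF cK] yK by blast
    then have wpos: "\<epsilon> < u w - \<phi> w" using yK \<open>\<not> u y - \<phi> y \<le> \<epsilon>\<close> by force
    have w\<Omega>: "w \<in> \<Omega>" and wb: "w \<in> cball y0 (4 * r)" using w(1) K\<Omega> by (auto simp: K_def K0_def)
    have \<kappa>w: "\<kappa> * ((w - y0) \<bullet> (w - y0)) \<le> \<kappa> * (4 * r)\<^sup>2" using \<kappa>(1) sq[OF wb] by (intro mult_left_mono) auto
    have "0 \<le> \<phi> w"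
    proof -
      have "M * V w \<le> M * 2" using V2[OF w(1)] M_pos by (intro mult_left_mono) auto
      moreover have "0 \<le> M * ((3 * r) powr (- s) * m / 2)" using M_pos m by simp
      ultimately show ?thesis unfolding \<phi>_def using \<kappa>w by (simp add: algebra_simps)
    qed
    then have uw: "\<epsilon> < u w" using wpos by simp
    have "w \<in> ball y0 (4 * r)"
    proof (rule ccontr)
      assume "w \<notin> ball y0 (4 * r)"
      then have nw: "4 * r \<le> norm (w - y0)" by (simp add: dist_norm norm_minus_commute)
      have "V w \<le> (\<Sum>i\<in>I. a i * (3 * r) powr (- s))"
        unfolding V_def
      proof (intro sum_mono mult_left_mono a powr_mono2')
        fix i assume "i \<in> I"
        then show "3 * r \<le> norm (w - c i)"
          using nw c\<Gamma>(2)[of i] norm_triangle_ineq[of "w - c i" "c i - y0"] by simp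
      qed (use r s in auto)
      also have "\<dots> = m * (3 * r) powr (- s)" by (simp add: suma sum_distrib_right[symmetric])
      finally have "M * V w \<le> M * (m * (3 * r) powr (- s))" using M_pos by (intro mult_left_mono) auto
      then have "M \<le> \<phi> w" unfolding \<phi>_def using \<kappa>w by (simp add: algebra_simps)
      then show False using M[OF w\<Omega>] wpos \<epsilon>(1) by simp
    qed
    \<comment> \<open>An open set inside \<open>K\<close> that contains \<open>w\<close>: the level
      \<open>u = \<epsilon>\<close> and the sphere of radius \<open>4 * r\<close> have just been
      excluded.\<close>
    define U where "U = {y \<in> \<Omega>. \<epsilon> < u y} \<inter> ball y0 (4 * r)"
    have UK: "U \<subseteq> K" using closure_subset[of \<Omega>] by (auto simp: U_def K_def K0_def)
    show False
    proof (rule touching_interior)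
      have "open (\<Omega> \<inter> u -` {\<epsilon><..})" by (rule continuous_open_preimage[OF cont_\<Omega> open_\<Omega>]) simp
      moreover have "\<Omega> \<inter> u -` {\<epsilon><..} = {y \<in> \<Omega>. \<epsilon> < u y}" by auto
      ultimately show "open U" by (simp add: U_def open_Int)
      show "U \<subseteq> \<Omega>" by (auto simp: U_def)
      show "w \<in> U" using \<open>w \<in> ball y0 (4 * r)\<close> uw w\<Omega> by (auto simp: U_def)
      show "has_hessian U \<phi> g Hs" using hess by (rule has_hessian_subset) (auto simp: U_def)
      show "0 < 2 * \<kappa>" using \<kappa> by simp
      fix y assume "y \<in> U"
      then have y\<Omega>: "y \<in> \<Omega>" by (simp add: U_def)
      have tr: "0 < trace (A y)" using ell[OF y\<Omega>] by (simp add: elliptic_matrix_def)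
      have "0 \<le> contraction (A y) (riesz_hess s (y - c i))" if i: "i \<in> I" for i
      proof -
        have yc: "y - c i \<noteq> 0" using c\<Gamma>(1)[OF i] y\<Omega> \<Gamma>1\<Omega> by auto
        have "0 \<le> s * norm (y - c i) powr (- s - 2) * ((s + 2) / e1 - 1) * trace (A y)"
          using s e1 tr by (intro mult_nonneg_nonneg) auto
        also have "\<dots> \<le> contraction (A y) (riesz_hess s (y - c i))"
          by (rule contraction_riesz_ge[OF ell[OF y\<Omega>] e1 s(1) yc])
        finally show ?thesis .
      qed
      then have "0 \<le> (\<Sum>i\<in>I. a i * contraction (A y) (riesz_hess s (y - c i)))"
        using a by (intro sum_nonneg mult_nonneg_nonneg) auto
      then have "0 \<le> M / 2 * (\<Sum>i\<in>I. a i * contraction (A y) (riesz_hess s (y - c i)))"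
        using M_pos by (intro mult_nonneg_nonneg) auto
      moreover have "contraction (A y) (Hs y) = - (M / 2 * (\<Sum>i\<in>I. a i * contraction (A y) (riesz_hess s (y - c i)))) - 2 * \<kappa> * trace (A y)"
        by (simp add: Hs_def contraction_add contraction_diff contraction_scaleR contraction_minus contraction_sum contraction_mat)
      ultimately show "contraction (A y) (Hs y) + 2 * \<kappa> * trace (A y) \<le> 0" by simp
    qed (use w(2) UK in blast)
  qed
  have xK: "x \<in> K" using x \<epsilon>(2) r closure_subset[of \<Omega>] by (auto simp: K_def K0_def)
  have "(2 * r) powr (- s) * m \<le> V x"
  proof -
    have "(2 * r) powr (- s) * m = (\<Sum>i\<in>I. a i * (2 * r) powr (- s))"
      unfolding suma[symmetric] sum_distrib_left by (simp add: mult.commute)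
    also have "\<dots> \<le> V x" unfolding V_def
    proof (intro sum_mono mult_left_mono a powr_mono2')
      fix i assume i: "i \<in> I"
      have "norm (x - y0) < r" using x by (simp add: dist_norm norm_minus_commute)
      then show "norm (x - c i) \<le> 2 * r"
        using c\<Gamma>(2)[OF i] norm_triangle_ineq4[of "x - y0" "c i - y0"] by simp
      show "0 < norm (x - c i)" using c\<Gamma>(1)[OF i] x \<Gamma>1\<Omega> by auto
    qed (use s in auto)
    finally show ?thesis .
  qed
  then have "M * ((2 * r) powr (- s) * m) \<le> M * V x" using M_pos by (intro mult_left_mono) auto
  moreover define q where "q = (x - y0) \<bullet> (x - y0)"
  moreover have "0 \<le> \<kappa> * q" using \<kappa>(1) by (simp add: q_def)
  ultimately have "\<phi> x \<le> M * (1 - ((2 * r) powr (- s) - (3 * r) powr (- s)) * m / 2) + e / 2"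
    unfolding \<phi>_def \<kappa>(2) q_def[symmetric] by (simp add: algebra_simps diff_divide_distrib)
  then show "u x \<le> M * (1 - ((2 * r) powr (- s) - (3 * r) powr (- s)) * measure \<mu> P / 2) + e"
    using le[OF xK] \<epsilon>(3) by (simp add: m_def)
qed

section \<open>Lipschitz graphs and oblique fields\<close>

lemma horiz_add: "horiz k (x + y) = horiz k x + horiz k (y :: real^'n::finite)"
  by (simp add: horiz_def vec_eq_iff)

lemma horiz_diff: "horiz k (x - y) = horiz k x - horiz k (y :: real^'n::finite)"
  by (simp add: horiz_def vec_eq_iff)

lemma horiz_scaleR: "horiz k (c *\<^sub>R x) = c *\<^sub>R horiz k (x :: real^'n::finite)"
  by (simp add: horiz_def vec_eq_iff)

lemma horiz_axis [simp]: "horiz k (axis k c) = (0 :: real^'n::finite)"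
  by (simp add: horiz_def vec_eq_iff axis_def)

lemma horiz_horiz [simp]: "horiz k (horiz k x) = horiz k (x :: real^'n::finite)"
  by (simp add: horiz_def vec_eq_iff)

lemma horiz_nth [simp]: "horiz k x $ k = 0"
  by (simp add: horiz_def)

lemma continuous_on_horiz [continuous_intros]:
  "continuous_on S f \<Longrightarrow> continuous_on S (\<lambda>x. horiz k (f x :: real^'n::finite))"
  unfolding horiz_def
proof (intro continuous_on_vec_lambda)
  fix i assume "continuous_on S f"
  then show "continuous_on S (\<lambda>x. if i = k then 0 else f x $ i)"
    by (cases "i = k") (auto intro!: continuous_intros)
qed

lemma horiz_decomp: "x = horiz k x + axis k (x $ k)"
  by (simp add: horiz_def vec_eq_iff axis_def)

lemma norm_horiz_sq: "(norm x)\<^sup>2 = (norm (horiz k x))\<^sup>2 + (x $ k :: real)\<^sup>2"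
proof -
  have "(norm x)\<^sup>2 = (\<Sum>i\<in>UNIV. (x $ i)\<^sup>2)"
    unfolding power2_norm_eq_inner inner_vec_def by (simp add: power2_eq_square)
  also have "\<dots> = (x $ k)\<^sup>2 + (\<Sum>i\<in>UNIV - {k}. (x $ i)\<^sup>2)" by (simp add: sum.remove)
  also have "(\<Sum>i\<in>UNIV - {k}. (x $ i)\<^sup>2) = (\<Sum>i\<in>UNIV - {k}. (horiz k x $ i)\<^sup>2)"
    by (intro sum.cong) (auto simp: horiz_def)
  also have "\<dots> = (\<Sum>i\<in>UNIV. (horiz k x $ i)\<^sup>2)"
    by (simp add: sum.remove[of UNIV k])
  also have "\<dots> = (norm (horiz k x))\<^sup>2"
    unfolding power2_norm_eq_inner inner_vec_def by (simp add: power2_eq_square)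
  finally show ?thesis by simp
qed

lemma norm_horiz_le: "norm (horiz k x) \<le> norm (x :: real^'n::finite)"
proof (rule power2_le_imp_le)
  show "(norm (horiz k x))\<^sup>2 \<le> (norm x)\<^sup>2" using norm_horiz_sq[of x k] by simp
qed simp

lemma norm_le_horiz: "norm x \<le> norm (horiz k x) + \<bar>x $ k\<bar>"
  for x :: "real^'n::finite"
proof -
  have "norm x = norm (horiz k x + axis k (x $ k))" by (subst horiz_decomp[symmetric]) simp
  also have "\<dots> \<le> norm (horiz k x) + norm (axis k (x $ k))" by (rule norm_triangle_ineq)
  also have "axis k (x $ k) = (x $ k) *\<^sub>R axis k 1" by (simp add: axis_def vec_eq_iff)
  finally show ?thesis by (simp add: norm_axis_1)
qed

text \<open>For \<open>b = arccot L - \<epsilon>\<close> nonnegative, \<open>b < arccot L\<close>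
  means \<open>L * sin b < cos b\<close>, and the difference is the margin \<open>m\<close>. A
  negative \<open>b\<close> admits no vector at all. The margin depends only on \<open>L\<close> and
  \<open>\<epsilon>\<close>, so it is available before the domain is given.\<close>

lemma oblique_cone:
  fixes k :: "'n::finite" and L \<epsilon> :: real
  assumes L: "0 \<le> L" and \<epsilon>: "0 < \<epsilon>"
  obtains m where "0 < m" "\<And>v :: real^'n. norm v = 1 \<Longrightarrow> vec_angle v (axis k 1) \<le> arccot L - \<epsilon> \<Longrightarrow> m + L * norm (horiz k v) \<le> v $ k"
proof -
  define b where "b = arccot L - \<epsilon>"
  have ang: "vec_angle v (axis k 1) = arccos (v $ k)" and vk: "\<bar>v $ k\<bar> \<le> 1" if "norm v = 1" for v :: "real^'n"
    using that component_le_norm_cart[of v k] by (auto simp: vec_angle_def inner_axis norm_axis_1)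
  show ?thesis
  proof (cases "b < 0")
    case True
    show ?thesis
    proof (rule that[of 1])
      fix v :: "real^'n" assume v: "norm v = 1" "vec_angle v (axis k 1) \<le> arccot L - \<epsilon>"
      have "0 \<le> arccos (v $ k)" using vk[OF v(1)] by (intro arccos_lbound) auto
      then show "1 + L * norm (horiz k v) \<le> v $ k" using v(2) True ang[OF v(1)] by (simp add: b_def)
    qed simp
  next
    case False
    have bpi: "b < pi / 2" "arctan L < pi / 2 - b"
    proof -
      have "0 \<le> arctan L" using L by simp
      then show "b < pi / 2" "arctan L < pi / 2 - b" using \<epsilon> unfolding b_def arccot_def by linarith+
    qed
    have sb: "0 \<le> sin b" using False bpi pi_gt_zero by (intro sin_ge_zero) auto
    have mpos: "L * sin b < cos b"
    proof (cases "b = 0")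
      case b0: False
      have "L = tan (arctan L)" by (simp add: tan_arctan)
      also have "\<dots> < tan (pi / 2 - b)"
        using bpi L b0 False zero_le_arctan_iff[of L] arctan_lbound[of L] by (intro tan_monotone) auto
      also have "\<dots> = cos b / sin b" by (simp add: tan_def sin_diff cos_diff)
      finally have "L < cos b / sin b" .
      moreover have "0 < sin b" using b0 False bpi pi_gt_zero by (intro sin_gt_zero) auto
      ultimately show ?thesis by (simp add: pos_less_divide_eq)
    qed simp
    show ?thesis
    proof (rule that[of "cos b - L * sin b"])
      show "0 < cos b - L * sin b" using mpos by simp
      fix v :: "real^'n" assume v: "norm v = 1" "vec_angle v (axis k 1) \<le> arccot L - \<epsilon>"
      have "arccos (v $ k) \<le> b" using v ang by (simp add: b_def)
      moreover have "b \<le> pi" using bpi(1) pi_gt_zero by linarith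
      ultimately have "cos b \<le> cos (arccos (v $ k))"
        using vk[OF v(1)] by (intro cos_monotone_0_pi_le arccos_lbound) auto
      then have c: "cos b \<le> v $ k" using vk[OF v(1)] by (simp add: cos_arccos_abs)
      have "0 \<le> cos b" using False bpi by (intro cos_ge_zero) auto
      then have "(cos b)\<^sup>2 \<le> (v $ k)\<^sup>2" using c by (intro power_mono)
      then have "(norm (horiz k v))\<^sup>2 \<le> (sin b)\<^sup>2"
        using norm_horiz_sq[of v k] v(1) by (simp add: sin_squared_eq)
      then have "norm (horiz k v) \<le> sin b" using sb by (rule power2_le_imp_le)
      then have "L * norm (horiz k v) \<le> L * sin b" using L by (rule mult_left_mono)
      then show "cos b - L * sin b + L * norm (horiz k v) \<le> v $ k" using c by simp
    qed
  qed
qed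

locale graph_boundary =
  fixes \<Omega> \<Gamma>1 \<Gamma>2 :: "(real^'n::finite) set" and k :: 'n and L r0 :: real and f :: "real^'n \<Rightarrow> real"
  assumes open_dom: "open \<Omega>" and fr: "frontier \<Omega> = \<Gamma>1 \<union> {0} \<union> \<Gamma>2"
    and sep: "closure \<Gamma>1 \<inter> closure \<Gamma>2 = {0}" and lip: "L-lipschitz_on {y. y $ k = 0} f"
    and graph: "\<Gamma>2 \<inter> ball 0 r0 \<subseteq> {x. x $ k = f (horiz k x)}"
    and below: "\<Omega> \<inter> ball 0 r0 \<subseteq> {x. x $ k < f (horiz k x)}"
begin

lemma L_nonneg: "0 \<le> L" using lip by (rule lipschitz_on_nonneg)

lemma f_diff: "\<bar>f (horiz k x) - f (horiz k y)\<bar> \<le> L * norm (horiz k (x - y))"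
  using lipschitz_onD[OF lip, of "horiz k x" "horiz k y"] by (simp add: dist_norm horiz_diff)

lemma continuous_on_graph_fun: "continuous_on S (\<lambda>x. f (horiz k x))"
  by (rule continuous_on_compose2[OF lipschitz_on_continuous_on[OF lip]]) (auto intro!: continuous_intros)

text \<open>A local converse to \<open>graph\<close>, which only says that \<open>\<Gamma>2\<close>
  lies on the graph. A thin slab \<open>N\<close> under the graph near \<open>y\<close> is
  connected, misses the frontier and meets \<open>\<Omega>\<close>, hence lies in it. Graph points
  above it are limits of \<open>\<Omega>\<close> outside \<open>\<Omega>\<close>, and near
  \<open>y\<close> the frontier is \<open>\<Gamma>2\<close>.\<close>

lemma graph_near_in_\<Gamma>2:
  assumes y: "y \<in> \<Gamma>2" "y \<in> ball 0 r0" "y \<noteq> 0"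
  obtains d where "0 < d" "\<And>x. x \<in> ball y d \<Longrightarrow> x $ k = f (horiz k x) \<Longrightarrow> x \<in> \<Gamma>2"
proof -
  have "y \<notin> closure \<Gamma>1" using y sep closure_subset[of \<Gamma>2] by auto
  then have "open (ball 0 r0 \<inter> - closure \<Gamma>1 - {0})" "y \<in> ball 0 r0 \<inter> - closure \<Gamma>1 - {0}"
    using y by auto
  then obtain d0 where d0: "0 < d0" "ball y d0 \<subseteq> ball 0 r0 \<inter> - closure \<Gamma>1 - {0}"
    using openE by blast
  have frd: "frontier \<Omega> \<inter> ball y d0 \<subseteq> \<Gamma>2"
    using d0(2) fr closure_subset[of \<Gamma>1] by auto
  \<comment> \<open>Slab points are within \<open>\<delta>\<close> of \<open>y\<close> horizontally
    and \<open>\<delta> + L * \<delta>\<close> vertically, in total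
    \<open>(2 + L) * \<delta>\<close>, half of \<open>d0\<close>.\<close>
  define \<delta> where "\<delta> = d0 / (2 * (2 + L))"
  have L2: "0 < 2 + L" using L_nonneg by simp
  have \<delta>: "0 < \<delta>" using d0(1) L2 by (simp add: \<delta>_def)
  have "(2 + L) * \<delta> = d0 / 2" using L2 by (simp add: \<delta>_def field_simps)
  then have \<delta>2: "(2 + L) * \<delta> < d0" using d0(1) by simp
  note \<delta> = \<delta> \<delta>2
  have yg: "y $ k = f (horiz k y)" using graph y by auto
  define N where "N = {x. norm (horiz k (x - y)) < \<delta> \<and> f (horiz k x) - \<delta> < x $ k \<and> x $ k < f (horiz k x)}"
  have Nb: "x \<in> ball y d0" if "norm (horiz k (x - y)) < \<delta>" "f (horiz k x) - \<delta> < x $ k" "x $ k \<le> f (horiz k x)" for x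
  proof -
    have "\<bar>x $ k - f (horiz k x)\<bar> < \<delta>" using that(2,3) by simp
    moreover have "\<bar>f (horiz k x) - y $ k\<bar> \<le> L * \<delta>"
      using f_diff[of x y] yg mult_left_mono[OF less_imp_le[OF that(1)] L_nonneg] by simp
    ultimately have "\<bar>(x - y) $ k\<bar> < \<delta> + L * \<delta>" by simp
    then have "norm (x - y) < \<delta> + (\<delta> + L * \<delta>)" using norm_le_horiz[of "x - y" k] that(1) by linarith
    also have "\<dots> < d0" using \<delta>(2) by (simp add: algebra_simps)
    finally show ?thesis by (simp add: dist_norm norm_minus_commute)
  qed
  have "connected N"
  proof -
    \<comment> \<open>The straightened slab is convex; adding \<open>f\<close> in the vertical
      direction maps it continuously onto \<open>N\<close>.\<close>
    define C where "C = {x :: real^'n. norm (horiz k (x - y)) < \<delta>} \<inter> {x. - \<delta> < x $ k} \<inter> {x. x $ k < 0}"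
    have "convex {x :: real^'n. norm (horiz k (x - y)) < \<delta>}"
    proof (rule convexI)
      fix a b :: "real^'n" and s t :: real
      assume h: "a \<in> {x. norm (horiz k (x - y)) < \<delta>}" "b \<in> {x. norm (horiz k (x - y)) < \<delta>}" "0 \<le> s" "0 \<le> t" "s + t = 1"
      have "horiz k (s *\<^sub>R a + t *\<^sub>R b - y) = s *\<^sub>R horiz k (a - y) + t *\<^sub>R horiz k (b - y)"
      proof -
        have "s *\<^sub>R a + t *\<^sub>R b - y = s *\<^sub>R (a - y) + t *\<^sub>R (b - y)"
          using h(5) by (simp add: algebra_simps flip: scaleR_add_left)
        then show ?thesis by (simp add: horiz_add horiz_scaleR)
      qed
      then show "s *\<^sub>R a + t *\<^sub>R b \<in> {x. norm (horiz k (x - y)) < \<delta>}"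
        using convexD[OF convex_ball[of 0 \<delta>], of "horiz k (a - y)" "horiz k (b - y)" s t] h by (simp add: mem_ball_0)
    qed
    moreover have "convex {x :: real^'n. - \<delta> < x $ k}" "convex {x :: real^'n. x $ k < 0}"
      using convex_halfspace_gt[of "- \<delta>" "axis k 1 :: real^'n"] convex_halfspace_lt[of "axis k 1 :: real^'n" 0]
      by (simp_all add: inner_axis')
    ultimately have "convex C" unfolding C_def by (intro convex_Int)
    then have "connected C" by (rule convex_connected)
    moreover have "continuous_on C (\<lambda>x. x + f (horiz k x) *\<^sub>R axis k 1)"
      by (intro continuous_intros continuous_on_graph_fun)
    ultimately have "connected ((\<lambda>x. x + f (horiz k x) *\<^sub>R axis k 1) ` C)" by (rule connected_continuous_image[rotated])
    also have "(\<lambda>x. x + f (horiz k x) *\<^sub>R axis k 1) ` C = N"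
    proof (intro equalityI subsetI)
      fix x assume "x \<in> N"
      then show "x \<in> (\<lambda>x. x + f (horiz k x) *\<^sub>R axis k 1) ` C"
        by (intro image_eqI[of _ _ "x - f (horiz k x) *\<^sub>R axis k 1"])
           (auto simp: N_def C_def horiz_diff horiz_scaleR)
    qed (auto simp: N_def C_def horiz_diff horiz_add horiz_scaleR)
    finally show ?thesis .
  qed
  moreover have "N \<inter> frontier \<Omega> = {}"
  proof -
    have "x \<notin> frontier \<Omega>" if "x \<in> N" for x
    proof
      assume "x \<in> frontier \<Omega>"
      have xb: "x \<in> ball y d0" using that by (intro Nb) (auto simp: N_def)
      then have "x \<in> \<Gamma>2 \<inter> ball 0 r0" using \<open>x \<in> frontier \<Omega>\<close> frd d0(2) by auto
      then show False using graph that by (auto simp: N_def)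
    qed
    then show ?thesis by auto
  qed
  moreover have "N \<inter> \<Omega> \<noteq> {}"
  proof -
    \<comment> \<open>A point of \<open>\<Omega>\<close> this close to \<open>y\<close> differs in
      height from the graph by less than \<open>e + L * e = \<delta>\<close>.\<close>
    define e where "e = \<delta> / (1 + L)"
    have e: "0 < e" "e \<le> \<delta>" "(1 + L) * e = \<delta>" using \<delta>(1) L_nonneg by (auto simp: e_def field_simps)
    have "y \<in> closure \<Omega>" using y(1) fr by (auto simp: frontier_def)
    then obtain q where q: "q \<in> \<Omega>" "dist q y < e" using e(1) unfolding closure_approachable by blast
    have n: "norm (horiz k (q - y)) < e" "\<bar>q $ k - y $ k\<bar> < e"
      using q(2) norm_horiz_le[of k "q - y"] component_le_norm_cart[of "q - y" k] by (auto simp: dist_norm)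
    have "\<bar>f (horiz k q) - y $ k\<bar> \<le> L * e"
      using f_diff[of q y] yg mult_left_mono[OF less_imp_le[OF n(1)] L_nonneg] by simp
    then have "f (horiz k q) - \<delta> < q $ k" using n(2) e(3) by (simp add: algebra_simps)
    moreover have "e < d0"
    proof -
      have "0 \<le> L * \<delta>" using L_nonneg \<delta>(1) by simp
      then show ?thesis using e(2) \<delta> by (simp add: algebra_simps)
    qed
    then have "q \<in> ball y d0" using q(2) by (simp add: dist_commute)
    then have "q $ k < f (horiz k q)" using below q(1) d0(2) by auto
    ultimately have "q \<in> N \<inter> \<Omega>" using q(1) n(1) e(2) by (simp add: N_def)
    then show ?thesis by blast
  qed
  ultimately have N\<Omega>: "N \<subseteq> \<Omega>" using connected_Int_frontier[of N \<Omega>] by blast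
  show ?thesis
  proof (rule that[OF \<delta>(1)])
    fix x assume x: "x \<in> ball y \<delta>" "x $ k = f (horiz k x)"
    have hx: "norm (horiz k (x - y)) < \<delta>"
      using x(1) norm_horiz_le[of k "x - y"] by (simp add: dist_norm norm_minus_commute)
    have xb: "x \<in> ball y d0" using hx x(2) \<delta>(1) by (intro Nb) auto
    have "x \<in> closure \<Omega>"
      unfolding closure_approachable
    proof (intro allI impI)
      fix e :: real assume e: "0 < e"
      define t where "t = min e \<delta> / 2"
      have t: "0 < t" "t < e" "t < \<delta>" using e \<delta>(1) by (auto simp: t_def)
      have "x - t *\<^sub>R axis k 1 \<in> N"
        using t x(2) hx by (simp add: N_def horiz_diff horiz_scaleR)
      moreover have "dist (x - t *\<^sub>R axis k 1) x < e" using t by (simp add: dist_norm norm_axis_1)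
      ultimately show "\<exists>y\<in>\<Omega>. dist y x < e" using N\<Omega> by blast
    qed
    moreover have "x \<in> ball 0 r0" using xb d0(2) by blast
    then have "x \<notin> \<Omega>" using subsetD[OF below, of x] x(2) by auto
    ultimately have "x \<in> frontier \<Omega>" using open_dom by (simp add: frontier_def interior_open)
    then show "x \<in> \<Gamma>2" using frd xb by blast
  qed
qed

text \<open>Continuation along the graph curve over the segment from \<open>p\<close> to
  \<open>q\<close>: the parameters with value in \<open>\<Gamma>2\<close> form a closed set, as the
  closures of the two boundary parts meet only at 0, and an open one by the local converse. The
  curve stays within \<open>\<rho> + 2 * \<rho> + 2 * L * \<rho>\<close> of \<open>z\<close>, whence
  the condition on \<open>K\<close>.\<close>

lemma graph_points_in_\<Gamma>2:
  assumes p: "p \<in> \<Gamma>2" "p \<in> ball z \<rho>" and q: "q $ k = f (horiz k q)" "q \<in> ball z \<rho>"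
    and K: "(3 + 2 * L) * \<rho> \<le> K" "ball z K \<subseteq> ball 0 r0" "0 \<notin> ball z K"
  shows "q \<in> \<Gamma>2"
proof -
  have \<rho>: "0 < \<rho>" using p(2) zero_le_dist[of z p] by (simp del: zero_le_dist)
  have \<rho>K: "\<rho> \<le> K"
  proof -
    have "0 \<le> L * \<rho>" using L_nonneg \<rho> by simp
    then show ?thesis using K(1) \<rho> by (simp add: algebra_simps)
  qed
  have "p \<in> ball z K" using p(2) \<rho>K by simp
  then have pg: "p $ k = f (horiz k p)" using graph p(1) K(2) by blast
  define s where "s = (\<lambda>t::real. p + t *\<^sub>R (q - p))"
  define c where "c = (\<lambda>t. horiz k (s t) + f (horiz k (s t)) *\<^sub>R axis k 1)"
  have cc: "continuous_on {0..1} c"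
  proof -
    have cs: "continuous_on {0..1} s" unfolding s_def by (intro continuous_intros)
    have "continuous_on {0..1} (\<lambda>t. f (horiz k (s t)))"
      by (rule continuous_on_compose2[OF continuous_on_graph_fun[of UNIV] cs]) auto
    then show ?thesis using cs unfolding c_def by (intro continuous_intros)
  qed
  have hc: "horiz k (c t) = horiz k (s t)" "c t $ k = f (horiz k (c t))" for t
    by (simp_all add: c_def horiz_add horiz_scaleR)
  have eqI: "a = b" if "horiz k a = horiz k b" "a $ k = b $ k" for a b :: "real^'n"
    using horiz_decomp[of a k] horiz_decomp[of b k] that by metis
  have c0: "c 0 = p" by (rule eqI) (use hc[of 0] pg in \<open>simp_all add: s_def\<close>)
  have c1: "c 1 = q" by (rule eqI) (use hc[of 1] q(1) in \<open>simp_all add: s_def\<close>)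
  have cb: "c t \<in> ball z K" if t: "t \<in> {0..1}" for t
  proof -
    have "norm (q - p) < 2 * \<rho>"
      using p(2) q(2) dist_triangle2[of q p z] by (simp add: dist_norm norm_minus_commute)
    moreover have "norm (horiz k (c t - p)) \<le> norm (q - p)"
    proof -
      have "horiz k (c t - p) = t *\<^sub>R horiz k (q - p)"
        by (simp add: horiz_diff hc(1)) (simp add: s_def horiz_add horiz_scaleR horiz_diff)
      then have "norm (horiz k (c t - p)) = t * norm (horiz k (q - p))" using t by simp
      also have "\<dots> \<le> 1 * norm (q - p)" using t by (intro mult_mono norm_horiz_le) auto
      finally show ?thesis by simp
    qed
    ultimately have h: "norm (horiz k (c t - p)) < 2 * \<rho>" by simp
    have "\<bar>(c t - p) $ k\<bar> \<le> L * (2 * \<rho>)"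
      using f_diff[of "c t" p] mult_left_mono[OF less_imp_le[OF h] L_nonneg] hc(2)[of t] pg by simp
    then have "norm (c t - p) < 2 * \<rho> + L * (2 * \<rho>)" using norm_le_horiz[of "c t - p" k] h by linarith
    moreover have "dist z (c t) \<le> dist z p + dist p (c t)" by (rule dist_triangle)
    ultimately have "dist z (c t) < \<rho> + (2 * \<rho> + L * (2 * \<rho>))" using p(2) by (simp add: dist_norm norm_minus_commute)
    also have "\<dots> \<le> K" using K(1) by (simp add: algebra_simps)
    finally show ?thesis by simp
  qed
  define T where "T = {t \<in> {0..1}. c t \<in> \<Gamma>2}"
  have "closedin (top_of_set {0..1}) T"
  proof -
    have "c t \<in> \<Gamma>2" if t: "t \<in> {0..1}" and cl: "c t \<in> closure \<Gamma>2" for t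
    proof -
      have "closure \<Gamma>2 \<subseteq> frontier \<Omega>"
      proof (rule closure_minimal)
        show "\<Gamma>2 \<subseteq> frontier \<Omega>" using fr by auto
      qed (rule frontier_closed)
      then have "c t \<in> frontier \<Omega>" using cl by blast
      moreover have "c t \<noteq> 0" using cb[OF t] K(3) by auto
      moreover from this have "c t \<notin> \<Gamma>1" using cl sep closure_subset[of \<Gamma>1] by auto
      ultimately show ?thesis using fr by auto
    qed
    then have "T = {0..1} \<inter> c -` closure \<Gamma>2" using closure_subset[of \<Gamma>2] by (auto simp: T_def)
    then show ?thesis using continuous_closedin_preimage[OF cc closed_closure] by simp
  qed
  moreover have "openin (top_of_set {0..1}) T"
    unfolding openin_euclidean_subtopology_iff
  proof (intro conjI ballI)
    fix t assume t: "t \<in> T"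
    then have t01: "t \<in> {0..1}" and ct: "c t \<in> \<Gamma>2" by (auto simp: T_def)
    have "c t \<in> ball 0 r0" "c t \<noteq> 0" using cb[OF t01] K(2,3) by auto
    then obtain d where d: "0 < d" "\<And>x. x \<in> ball (c t) d \<Longrightarrow> x $ k = f (horiz k x) \<Longrightarrow> x \<in> \<Gamma>2"
      using graph_near_in_\<Gamma>2[OF ct] by blast
    then obtain e where e: "0 < e" "\<And>t'. t' \<in> {0..1} \<Longrightarrow> dist t' t < e \<Longrightarrow> dist (c t') (c t) < d"
      using cc t01 unfolding continuous_on_iff by blast
    have "t' \<in> T" if "t' \<in> {0..1}" "dist t' t < e" for t'
      using d(2)[of "c t'"] e(2)[OF that] hc(2)[of t'] that(1) by (simp add: T_def dist_commute)
    then show "\<exists>e>0. \<forall>x'\<in>{0..1}. dist x' t < e \<longrightarrow> x' \<in> T" using e(1) by blast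
  qed (auto simp: T_def)
  ultimately have "T = {} \<or> T = {0..1}"
    using iffD1[OF connected_clopen connected_Icc[of "0::real" 1]] by simp
  moreover have "0 \<in> T" using c0 p(1) by (simp add: T_def)
  ultimately have "T = {0..1}" by auto
  then have "1 \<in> T" by simp
  then show ?thesis using c1 by (simp add: T_def)
qed

text \<open>If \<open>v\<close> did not point away from \<open>z\<close>, tilting it by
  \<open>\<sigma>\<close> towards \<open>z\<close> would keep it in the cone above the graph and yet
  lead from \<open>y\<close> into the ball, which lies below the graph.\<close>

lemma oblique_angle_pos:
  assumes r: "0 < r" and x: "x \<in> \<Omega> \<inter> ball z r" and \<Gamma>2: "\<Gamma>2 \<inter> ball z r = {}"
    and \<tau>: "0 < \<tau>" "\<tau> \<le> 1" and K: "(6 + 4 * L) * r \<le> K" "ball z K \<subseteq> ball 0 r0" "0 \<notin> ball z K"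
    and m: "0 < m" and \<sigma>: "\<sigma> = m / (1 + L)" and \<tau>\<sigma>: "(1 + \<tau>)\<^sup>2 * (1 - \<sigma>\<^sup>2 / (1 + \<sigma>)\<^sup>2) \<le> 1"
    and y: "y \<in> \<Gamma>2 \<inter> ball z ((1 + \<tau>) * r)" and v: "norm v = 1" "m + L * norm (horiz k v) \<le> v $ k"
  shows "0 < (y - z) \<bullet> v"
proof (rule ccontr)
  assume neg: "\<not> 0 < (y - z) \<bullet> v"
  have \<sigma>0: "0 < \<sigma>" using m L_nonneg by (simp add: \<sigma>)
  have rK: "r \<le> K" "2 * r \<le> K"
  proof -
    have "0 \<le> L * r" using L_nonneg r by simp
    then show "r \<le> K" "2 * r \<le> K" using K(1) r by (auto simp: algebra_simps)
  qed
  have \<tau>r: "(1 + \<tau>) * r \<le> 2 * r" using \<tau> r by (intro mult_right_mono) auto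
  have y2: "y \<in> ball z (2 * r)" "y \<in> \<Gamma>2" using y \<tau>r by auto
  have "y \<in> ball z K" using y2(1) rK by simp
  then have yg: "y $ k = f (horiz k y)" using graph y2(2) K(2) by blast
  have nograph: "w $ k \<noteq> f (horiz k w)" if "w \<in> ball z r" for w
  proof
    assume "w $ k = f (horiz k w)"
    then have "w \<in> \<Gamma>2"
      using graph_points_in_\<Gamma>2[OF y2(2,1) _ _ _ K(2,3), of w] that K(1) r by (simp add: algebra_simps)
    then show False using that \<Gamma>2 by auto
  qed
  \<comment> \<open>The ball contains the point \<open>x\<close> below the graph and no graph point,
    so by connectedness all of it is below.\<close>
  have bel: "w $ k < f (horiz k w)" if w: "w \<in> ball z r" for w
  proof (rule ccontr)
    assume "\<not> w $ k < f (horiz k w)"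
    then have w1: "f (horiz k w) - w $ k \<le> 0" by simp
    have x1: "0 \<le> f (horiz k x) - x $ k" using below x K(2) rK by fastforce
    define h where "h = (\<lambda>w. f (horiz k w) - w $ k)"
    have "continuous_on (ball z r) h" unfolding h_def by (intro continuous_intros continuous_on_graph_fun)
    then have "connected (h ` ball z r)" by (rule connected_continuous_image) simp
    moreover have "h w \<in> h ` ball z r" "h x \<in> h ` ball z r" using w x by auto
    moreover have "h w \<le> 0" "0 \<le> h x" using w1 x1 by (auto simp: h_def)
    ultimately have "0 \<in> h ` ball z r" unfolding connected_iff_interval by blast
    then obtain w0 where "w0 \<in> ball z r" "h w0 = 0" by auto
    then show False using nograph[of w0] by (simp add: h_def)
  qed
  define n where "n = norm (y - z)"
  have n: "r \<le> n" "n < (1 + \<tau>) * r" using y \<Gamma>2 by (auto simp: n_def dist_norm norm_minus_commute)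
  have n0: "0 < n" using n r by simp
  define e where "e = (1 / n) *\<^sub>R (y - z)"
  have e: "norm e = 1" "y - z = n *\<^sub>R e" using n0 by (auto simp: e_def n_def)
  \<comment> \<open>The margin \<open>m = \<sigma> + L * \<sigma>\<close> is exactly what the tilt
    can cost in the cone inequality.\<close>
  define v' where "v' = v - \<sigma> *\<^sub>R e"
  \<comment> \<open>Minimises the bound \<open>n\<^sup>2 - 2 * t * n * \<sigma> + t\<^sup>2 * (1 +
    \<sigma>)\<^sup>2\<close> for the squared distance to \<open>z\<close>; by
    \<open>\<tau>\<sigma>\<close> the minimum is below \<open>r\<^sup>2\<close>.\<close>
  define t where "t = \<sigma> * n / (1 + \<sigma>)\<^sup>2"
  have t: "0 < t" using \<sigma>0 n0 by (simp add: t_def)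
  define w where "w = y + t *\<^sub>R v'"
  have nv': "norm v' \<le> 1 + \<sigma>"
    unfolding v'_def using norm_triangle_ineq4[of v "\<sigma> *\<^sub>R e"] v e \<sigma>0 by simp
  have ev: "e \<bullet> v' \<le> - \<sigma>"
  proof -
    have "e \<bullet> v \<le> 0" using neg n0 unfolding e(2) by (simp add: zero_less_mult_iff)
    moreover have "e \<bullet> e = 1" using e(1) by (simp add: dot_square_norm)
    ultimately show ?thesis by (simp add: v'_def inner_diff_right)
  qed
  have "(norm (w - z))\<^sup>2 = n\<^sup>2 + 2 * t * n * (e \<bullet> v') + t\<^sup>2 * (norm v')\<^sup>2"
  proof -
    have "w - z = n *\<^sub>R e + t *\<^sub>R v'" using e(2) by (simp add: w_def algebra_simps)
    moreover have "e \<bullet> e = 1" using e(1) by (simp add: dot_square_norm)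
    moreover have "(norm (n *\<^sub>R e + t *\<^sub>R v'))\<^sup>2 = n\<^sup>2 * (e \<bullet> e) + 2 * t * n * (e \<bullet> v') + t\<^sup>2 * (v' \<bullet> v')"
      unfolding power2_norm_eq_inner
      by (simp only: inner_add_left inner_add_right inner_scaleR_left inner_scaleR_right inner_commute[of v' e])
         (simp add: power2_eq_square algebra_simps)
    ultimately show ?thesis by (simp add: power2_norm_eq_inner)
  qed
  also have "\<dots> \<le> n\<^sup>2 + 2 * t * n * (- \<sigma>) + t\<^sup>2 * (1 + \<sigma>)\<^sup>2"
    using ev nv' t n0 by (intro add_mono mult_left_mono power_mono) auto
  also have "\<dots> = n\<^sup>2 * (1 - \<sigma>\<^sup>2 / (1 + \<sigma>)\<^sup>2)"
  proof -
    define P where "P = (1 + \<sigma>)\<^sup>2"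
    have "0 < P" using \<sigma>0 by (simp add: P_def)
    then show ?thesis unfolding t_def P_def[symmetric] by (simp add: power2_eq_square field_simps)
  qed
  also have "\<dots> < ((1 + \<tau>) * r)\<^sup>2 * (1 - \<sigma>\<^sup>2 / (1 + \<sigma>)\<^sup>2)"
  proof (rule mult_strict_right_mono)
    show "n\<^sup>2 < ((1 + \<tau>) * r)\<^sup>2" using n n0 by (intro power_strict_mono) auto
    have "\<sigma>\<^sup>2 < (1 + \<sigma>)\<^sup>2" using \<sigma>0 by (intro power_strict_mono) auto
    then show "0 < 1 - \<sigma>\<^sup>2 / (1 + \<sigma>)\<^sup>2" using \<sigma>0 by simp
  qed
  also have "\<dots> = r\<^sup>2 * ((1 + \<tau>)\<^sup>2 * (1 - \<sigma>\<^sup>2 / (1 + \<sigma>)\<^sup>2))" by (simp add: power_mult_distrib)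
  also have "\<dots> \<le> r\<^sup>2 * 1" using \<tau>\<sigma> by (intro mult_left_mono) auto
  finally have "norm (w - z) < r" using r by (simp add: power_less_imp_less_base)
  then have "w \<in> ball z r" by (simp add: dist_norm norm_minus_commute)
  then have wb: "w $ k < f (horiz k w)" by (rule bel)
  have "norm (horiz k v') \<le> norm (horiz k v) + \<sigma>"
  proof -
    have "norm (horiz k v') \<le> norm (horiz k v) + norm (horiz k (\<sigma> *\<^sub>R e))"
      unfolding v'_def horiz_diff by (rule norm_triangle_ineq4)
    also have "norm (horiz k (\<sigma> *\<^sub>R e)) \<le> norm (\<sigma> *\<^sub>R e)" by (rule norm_horiz_le)
    finally show ?thesis using e(1) \<sigma>0 by simp
  qed
  then have Lh: "L * norm (horiz k v') \<le> L * norm (horiz k v) + L * \<sigma>"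
    using mult_left_mono[OF _ L_nonneg] by (fastforce simp: distrib_left)
  have "v $ k - \<sigma> \<le> v' $ k"
  proof -
    have "\<bar>e $ k\<bar> \<le> 1" using component_le_norm_cart[of e k] e(1) by simp
    then have "\<sigma> * e $ k \<le> \<sigma> * 1" using \<sigma>0 by (intro mult_left_mono) auto
    then show ?thesis by (simp add: v'_def)
  qed
  moreover have "(1 + L) * \<sigma> = m" using L_nonneg by (simp add: \<sigma>)
  then have "m = \<sigma> + L * \<sigma>" by (simp add: distrib_right)
  ultimately have "L * norm (horiz k v') \<le> v' $ k" using v(2) Lh by linarith
  then have "t * (L * norm (horiz k v')) \<le> t * v' $ k" using t by (intro mult_left_mono) auto
  moreover have "f (horiz k w) \<le> f (horiz k y) + t * (L * norm (horiz k v'))"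
    using f_diff[of w y] t by (simp add: w_def horiz_scaleR mult_ac)
  ultimately have "f (horiz k w) \<le> w $ k" using yg by (simp add: w_def)
  then show False using wb by simp
qed

end

section \<open>Growth along chains of balls\<close>

text \<open>The share of a lower bound for \<open>M - u\<close> on the ball of radius
  \<open>b\<close> that survives on the ball of radius \<open>r\<close>, for a barrier that reaches
  \<open>M\<close> at radius \<open>\<rho>\<close>.\<close>

definition growth_factor :: "real \<Rightarrow> real \<Rightarrow> real \<Rightarrow> real \<Rightarrow> real" where
  "growth_factor e b r \<rho> = b powr e * (r powr (- e) - \<rho> powr (- e))"

text \<open>Scale invariance is what frees the final constant from \<open>R\<close>.\<close>

lemma growth_factor_scale:
  assumes "0 < c" "0 < b" "0 < r" "0 < \<rho>"
  shows "growth_factor e (b * c) (r * c) (\<rho> * c) = growth_factor e b r \<rho>"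
proof -
  have "c powr e * c powr (- e) = 1" using assms(1) by (simp add: powr_minus)
  moreover have "b powr e * c powr e * (x * c powr (- e)) = b powr e * x * (c powr e * c powr (- e))" for x
    by (simp only: mult_ac)
  ultimately have key: "b powr e * c powr e * (x * c powr (- e)) = b powr e * x" for x by simp
  show ?thesis unfolding growth_factor_def powr_mult right_diff_distrib key ..
qed

lemma growth_factor_bounds:
  assumes "0 < e" "0 < b" "b \<le> r" "r < \<rho>"
  shows "0 < growth_factor e b r \<rho>" "growth_factor e b r \<rho> < 1"
proof -
  have "\<rho> powr (- e) < r powr (- e)" using assms by (intro powr_less_mono2_neg) auto
  then show "0 < growth_factor e b r \<rho>" using assms by (simp add: growth_factor_def)
  have "growth_factor e b r \<rho> < b powr e * r powr (- e)"
    using assms by (simp add: growth_factor_def right_diff_distrib)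
  also have "\<dots> \<le> b powr e * b powr (- e)"
    using assms by (intro mult_left_mono powr_mono2') auto
  also have "\<dots> = 1" using assms by (simp add: powr_minus)
  finally show "growth_factor e b r \<rho> < 1" .
qed

lemma (in oblique_subsolution) growth':
  assumes "0 < b" "b < r" "r < \<rho>" "0 \<notin> cball z \<rho>" "\<Gamma>2 \<inter> ball z r = {}"
    "\<And>y. y \<in> \<Gamma>2 \<inter> ball z \<rho> \<Longrightarrow> 0 < (y - z) \<bullet> l y"
    and d: "0 \<le> d" "d \<le> M" and "\<And>x. x \<in> \<Omega> \<inter> cball z b \<Longrightarrow> u x \<le> M - d" "x \<in> \<Omega> \<inter> ball z r"
  shows "u x \<le> M - d * growth_factor e1 b r \<rho>"
  using growth[OF assms(1-6), of "M - d" x] assms(7-) by (simp add: growth_factor_def)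

text \<open>Consecutive centres are at most \<open>r / 2\<close> apart, so the ball of radius
  \<open>r / 4\<close> about the next centre lies in the ball of radius \<open>r\<close> about the
  previous one. The doubled balls miss \<open>\<Gamma>2\<close>, so the angle condition of
  \<open>growth'\<close> is vacuous.\<close>

lemma (in oblique_subsolution) growth_along_segment:
  assumes r: "0 < r" and n: "0 < n" "norm (y1 - y0) \<le> real n * (r / 2)"
    and seg: "\<And>p. p \<in> closed_segment y0 y1 \<Longrightarrow> 0 \<notin> cball p (2 * r) \<and> \<Gamma>2 \<inter> cball p (2 * r) = {}"
    and d: "0 \<le> d" "d \<le> M" and start: "\<And>x. x \<in> \<Omega> \<inter> ball y0 r \<Longrightarrow> u x \<le> M - d"
    and x: "x \<in> \<Omega> \<inter> ball y1 r"
  shows "u x \<le> M - d * growth_factor e1 (1/4) 1 2 ^ n"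
proof -
  let ?F = "growth_factor e1 (1/4) 1 2"
  have F: "0 < ?F" "?F < 1" using growth_factor_bounds[of e1 "1/4" 1 2] e1 by auto
  define p where "p = (\<lambda>i. y0 + (real i / real n) *\<^sub>R (y1 - y0))"
  have ps: "p i \<in> closed_segment y0 y1" if "i \<le> n" for i
    unfolding in_segment p_def using that n(1)
    by (intro exI[of _ "real i / real n"]) (auto simp: algebra_simps)
  have step: "dist (p i) (p (Suc i)) \<le> r / 2" for i
  proof -
    have "p (Suc i) - p i = (1 / real n) *\<^sub>R (y1 - y0)"
      by (simp add: p_def add_divide_distrib scaleR_add_left)
    then have "dist (p i) (p (Suc i)) = norm (y1 - y0) / real n"
      by (metis dist_commute dist_norm norm_scaleR abs_of_nonneg divide_inverse inverse_eq_divide mult.commute of_nat_0_le_iff zero_le_divide_1_iff)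
    then show ?thesis using n by (simp add: divide_le_eq mult.commute)
  qed
  have "\<forall>x\<in>\<Omega> \<inter> ball (p i) r. u x \<le> M - d * ?F ^ i" if "i \<le> n" for i
    using that
  proof (induction i)
    case 0 then show ?case using start by (simp add: p_def)
  next
    case (Suc i)
    have d': "0 \<le> d * ?F ^ i" "d * ?F ^ i \<le> M"
      using d F power_le_one[of ?F i] mult_left_mono[of "?F ^ i" 1 d] by auto
    show ?case
    proof
      fix x assume x: "x \<in> \<Omega> \<inter> ball (p (Suc i)) r"
      have "u x \<le> M - d * ?F ^ i * growth_factor e1 (1/4 * r) (1 * r) (2 * r)"
      proof (rule growth')
        show "0 \<notin> cball (p (Suc i)) (2 * r)" using seg[OF ps[OF Suc.prems]] by simp
        have g: "\<Gamma>2 \<inter> cball (p (Suc i)) (2 * r) = {}" using seg[OF ps[OF Suc.prems]] by simp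
        have "ball (p (Suc i)) (1 * r) \<subseteq> cball (p (Suc i)) (2 * r)" using r by auto
        then show "\<Gamma>2 \<inter> ball (p (Suc i)) (1 * r) = {}" using g by blast
        show "0 < (y - p (Suc i)) \<bullet> l y" if "y \<in> \<Gamma>2 \<inter> ball (p (Suc i)) (2 * r)" for y
          using that g ball_subset_cball by blast
        show "u y \<le> M - d * ?F ^ i" if y: "y \<in> \<Omega> \<inter> cball (p (Suc i)) (1/4 * r)" for y
        proof -
          have "dist (p i) y \<le> dist (p i) (p (Suc i)) + dist (p (Suc i)) y" by (rule dist_triangle)
          also have "\<dots> < r" using step[of i] y r by simp
          finally show ?thesis using Suc y by auto
        qed
      qed (use r d' x in auto)
      also have "growth_factor e1 (1/4 * r) (1 * r) (2 * r) = ?F"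
        using r by (intro growth_factor_scale) auto
      finally show "u x \<le> M - d * ?F ^ Suc i" by (simp add: mult_ac)
    qed
  qed
  moreover have "p n = y1" using n(1) by (simp add: p_def)
  ultimately show ?thesis using x by auto
qed

locale oblique_graph_subsolution = oblique_subsolution \<Omega> \<Gamma>1 \<Gamma>2 A l u e1 M + graph_boundary \<Omega> \<Gamma>1 \<Gamma>2 k L r0 f
  for \<Omega> \<Gamma>1 \<Gamma>2 :: "(real^'n::finite) set" and A l u e1 M k L r0 f +
  fixes m :: real
  assumes m: "0 < m" and cone: "\<And>y. y \<in> \<Gamma>2 \<Longrightarrow> norm (l y) = 1 \<and> m + L * norm (horiz k (l y)) \<le> l y $ k"
begin

text \<open>Near the sphere bounding the ball the oblique boundary may be arbitrarily close, so the estimate is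
  first pushed to the concentric ball of radius \<^term>\<open>(1 - \<beta>) * r\<close> and then to the small balls of radius
  \<^term>\<open>2 * \<beta> * r\<close> that touch the sphere from inside: only at that scale the graph is seen to stay above
  the ball.\<close>

lemma ball_step:
  assumes r: "0 < r" and \<gamma>: "0 < \<gamma>" "\<gamma> \<le> 1/2" and \<beta>: "0 < \<beta>" "\<beta> \<le> 1/4" "(6 + 4 * L) * (2 * \<beta>) \<le> \<zeta>"
    and ball: "ball z ((1 + \<zeta>) * r) \<subseteq> ball 0 r0" "0 \<notin> ball z ((1 + \<zeta>) * r)"
    and \<tau>: "0 < \<tau>" "\<tau> \<le> 1" "(1 + \<tau>)\<^sup>2 * (1 - (m / (1 + L))\<^sup>2 / (1 + m / (1 + L))\<^sup>2) \<le> 1"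
    and \<Gamma>2: "\<Gamma>2 \<inter> ball z r = {}" and d: "0 \<le> d" "d \<le> M"
    and start: "\<And>x. x \<in> \<Omega> \<inter> cball z (\<gamma> * r) \<Longrightarrow> u x \<le> M - d" and x: "x \<in> \<Omega> \<inter> ball z r"
  shows "u x \<le> M - d * (growth_factor e1 \<gamma> (1 - \<beta>) (1 - \<beta> / 2) * growth_factor e1 (\<beta> / 2) (2 * \<beta>) ((1 + \<tau>) * (2 * \<beta>)))"
proof -
  let ?F = "growth_factor e1 \<gamma> (1 - \<beta>) (1 - \<beta> / 2)"
  let ?F' = "growth_factor e1 (\<beta> / 2) (2 * \<beta>) ((1 + \<tau>) * (2 * \<beta>))"
  have F: "0 < ?F" "?F < 1" using growth_factor_bounds[of e1 \<gamma> "1 - \<beta>" "1 - \<beta> / 2"] e1 \<gamma> \<beta> by auto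
  have F': "0 < ?F'" "?F' < 1"
  proof -
    have "2 * \<beta> < (1 + \<tau>) * (2 * \<beta>)" using \<tau>(1) \<beta>(1) by (simp add: distrib_right)
    then show "0 < ?F'" "?F' < 1" using growth_factor_bounds[of e1 "\<beta> / 2" "2 * \<beta>" "(1 + \<tau>) * (2 * \<beta>)"] e1 \<beta>(1) by auto
  qed
  have dF: "0 \<le> d * ?F" "d * ?F \<le> M" using d F mult_left_mono[of ?F 1 d] by auto
  have L0: "0 \<le> L" by (rule L_nonneg)
  have \<zeta>: "0 < \<zeta>" "2 * \<beta> < \<zeta>"
  proof -
    have "6 * (2 * \<beta>) \<le> (6 + 4 * L) * (2 * \<beta>)" using L0 \<beta>(1) by (intro mult_right_mono) auto
    then show "0 < \<zeta>" "2 * \<beta> < \<zeta>" using \<beta> by linarith+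
  qed
  \<comment> \<open>The barrier stops at radius \<open>(1 - \<beta> / 2) * r\<close>, inside the
    ball free of \<open>\<Gamma>2\<close>, so no angle condition arises yet.\<close>
  have inner: "u y \<le> M - d * ?F" if y: "y \<in> \<Omega> \<inter> ball z ((1 - \<beta>) * r)" for y
  proof -
    have "u y \<le> M - d * growth_factor e1 (\<gamma> * r) ((1 - \<beta>) * r) ((1 - \<beta> / 2) * r)"
    proof (rule growth')
      have le1: "(1 - \<beta>) * r \<le> 1 * r" "(1 - \<beta> / 2) * r < 1 * r" "1 * r \<le> (1 + \<zeta>) * r"
        using r \<beta> \<zeta> by (auto intro!: mult_right_mono mult_strict_right_mono)
      show "0 \<notin> cball z ((1 - \<beta> / 2) * r)" using ball(2) le1 by auto
      show "\<Gamma>2 \<inter> ball z ((1 - \<beta>) * r) = {}" using \<Gamma>2 le1 by (auto simp: disjoint_iff)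
      show "0 < (w - z) \<bullet> l w" if "w \<in> \<Gamma>2 \<inter> ball z ((1 - \<beta> / 2) * r)" for w
        using that \<Gamma>2 le1 by (auto simp: disjoint_iff)
    qed (use r \<beta> \<gamma> d start y in auto)
    also have "growth_factor e1 (\<gamma> * r) ((1 - \<beta>) * r) ((1 - \<beta> / 2) * r) = ?F"
      using r \<gamma> \<beta> by (intro growth_factor_scale) auto
    finally show ?thesis .
  qed
  show ?thesis
  proof (cases "x \<in> ball z ((1 - \<beta>) * r)")
    case True
    have "u x \<le> M - d * ?F" using x True by (intro inner) auto
    also have "\<dots> \<le> M - d * (?F * ?F')"
    proof -
      have "?F * ?F' \<le> ?F * 1" using F F' by (intro mult_left_mono) auto
      then show ?thesis using mult_left_mono[of "?F * ?F'" ?F d] d by simp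
    qed
    finally show ?thesis .
  next
    case False
    define n where "n = norm (x - z)"
    have n: "(1 - \<beta>) * r \<le> n" "n < r" using False x by (auto simp: n_def dist_norm norm_minus_commute)
    have "0 < (1 - \<beta>) * r" using r \<beta> by simp
    then have n0: "0 < n" using n by linarith
    define e where "e = (1 / n) *\<^sub>R (x - z)"
    have e: "norm e = 1" "x - z = n *\<^sub>R e" using n0 by (auto simp: e_def n_def)
    \<comment> \<open>The ball of radius \<open>r1\<close> about \<open>z1\<close> touches the big
      sphere from inside on the ray through \<open>x\<close>, and contains \<open>x\<close> because
      \<open>(1 - \<beta>) * r \<le> n\<close>. Its core of radius \<open>\<beta> / 2 * r\<close>
      lies in the ball settled by \<open>inner\<close>.\<close>
    define r1 where "r1 = 2 * \<beta> * r"
    have r1: "0 < r1" "r1 \<le> r / 2" using r \<beta> by (auto simp: r1_def)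
    define z1 where "z1 = z + (r - r1) *\<^sub>R e"
    have dz1: "dist z z1 = r - r1" using r1 r e by (simp add: z1_def dist_norm)
    have xz1: "x \<in> ball z1 r1"
    proof -
      have "x = z + n *\<^sub>R e" using e(2) by (simp add: algebra_simps)
      then have "x - z1 = (n - (r - r1)) *\<^sub>R e" by (simp add: z1_def scaleR_diff_left)
      then have "dist z1 x = \<bar>n - (r - r1)\<bar>" using e(1) by (simp add: dist_norm norm_minus_commute)
      also have "\<dots> < r1"
      proof -
        have "0 < \<beta> * r" using \<beta> r by simp
        then show ?thesis using n by (simp add: r1_def algebra_simps abs_less_iff)
      qed
      finally show ?thesis by simp
    qed
    have sub1: "ball z1 r1 \<subseteq> ball z r"
    proof
      fix y assume "y \<in> ball z1 r1"
      then show "y \<in> ball z r" using dist_triangle[of z y z1] dz1 by simp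
    qed
    then have \<Gamma>21: "\<Gamma>2 \<inter> ball z1 r1 = {}" using \<Gamma>2 by blast
    \<comment> \<open>The range over which the graph is followed; \<open>\<beta>\<close> is so small
      that this ball stays inside the enlarged ball, which lies in \<open>ball 0 r0\<close> and
      misses 0.\<close>
    define K where "K = (6 + 4 * L) * r1"
    have Kr: "K \<le> \<zeta> * r"
    proof -
      have "K = (6 + 4 * L) * (2 * \<beta>) * r" by (simp add: K_def r1_def)
      also have "\<dots> \<le> \<zeta> * r" using \<beta>(3) r by (intro mult_right_mono) auto
      finally show ?thesis .
    qed
    have subK: "ball z1 K \<subseteq> ball z ((1 + \<zeta>) * r)"
    proof
      fix y assume "y \<in> ball z1 K"
      then have "dist z y < (r - r1) + \<zeta> * r" using dist_triangle[of z y z1] dz1 Kr by simp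
      then show "y \<in> ball z ((1 + \<zeta>) * r)" using r1 by (simp add: distrib_right)
    qed
    have \<tau>K: "(1 + \<tau>) * r1 < K"
    proof -
      have "(1 + \<tau>) * r1 \<le> 2 * r1" using \<tau> r1 by (intro mult_right_mono) auto
      also have "\<dots> < 6 * r1" using r1 by simp
      also have "\<dots> \<le> K" unfolding K_def using L0 r1 by (intro mult_right_mono) auto
      finally show ?thesis .
    qed
    have "u x \<le> M - d * ?F * growth_factor e1 (\<beta> / 2 * r) (2 * \<beta> * r) ((1 + \<tau>) * (2 * \<beta>) * r)"
    proof (rule growth')
      show "0 < \<beta> / 2 * r" "\<beta> / 2 * r < 2 * \<beta> * r" using \<beta> r by auto
      show "2 * \<beta> * r < (1 + \<tau>) * (2 * \<beta>) * r" using \<tau> \<beta> r by (simp add: distrib_right)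
      have rr: "(1 + \<tau>) * (2 * \<beta>) * r = (1 + \<tau>) * r1" by (simp add: r1_def)
      show "0 \<notin> cball z1 ((1 + \<tau>) * (2 * \<beta>) * r)" unfolding rr
      proof -
        have "cball z1 ((1 + \<tau>) * r1) \<subseteq> ball z1 K" using \<tau>K by auto
        then show "0 \<notin> cball z1 ((1 + \<tau>) * r1)" using ball(2) subK by blast
      qed
      show "\<Gamma>2 \<inter> ball z1 (2 * \<beta> * r) = {}" using \<Gamma>21 by (simp add: r1_def)
      show "0 < (y - z1) \<bullet> l y" if "y \<in> \<Gamma>2 \<inter> ball z1 ((1 + \<tau>) * (2 * \<beta>) * r)" for y
      proof (rule oblique_angle_pos[OF r1(1) _ \<Gamma>21 \<tau>(1,2) _ _ _ m refl \<tau>(3)])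
        show "x \<in> \<Omega> \<inter> ball z1 r1" using x xz1 by auto
        show "(6 + 4 * L) * r1 \<le> K" by (simp add: K_def)
        show "ball z1 K \<subseteq> ball 0 r0" using subK ball(1) by blast
        show "0 \<notin> ball z1 K" using subK ball(2) by blast
        show "y \<in> \<Gamma>2 \<inter> ball z1 ((1 + \<tau>) * r1)" using that unfolding rr .
        show "norm (l y) = 1" "m + L * norm (horiz k (l y)) \<le> l y $ k" using cone that by auto
      qed
      show "u y \<le> M - d * ?F" if y: "y \<in> \<Omega> \<inter> cball z1 (\<beta> / 2 * r)" for y
      proof (rule inner)
        have "dist z y \<le> dist z z1 + dist z1 y" by (rule dist_triangle)
        also have "\<dots> \<le> r - r1 + \<beta> / 2 * r" using dz1 y by simp
        also have "\<dots> < (1 - \<beta>) * r" using \<beta> r by (simp add: r1_def algebra_simps)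
        finally show "y \<in> \<Omega> \<inter> ball z ((1 - \<beta>) * r)" using y by simp
      qed
      show "x \<in> \<Omega> \<inter> ball z1 (2 * \<beta> * r)" using x xz1 by (simp add: r1_def)
    qed (use dF in auto)
    also have "growth_factor e1 (\<beta> / 2 * r) (2 * \<beta> * r) ((1 + \<tau>) * (2 * \<beta>) * r) = ?F'"
      using r \<beta> \<tau> by (intro growth_factor_scale) auto
    finally show ?thesis by (simp add: mult.assoc)
  qed
qed

end

section \<open>The ball carrying the capacity and the conclusion\<close>

text \<open>At an outside point within \<open>\<rho>\<close> of all of \<open>H\<close> the kernel
  is at least \<open>\<rho> powr (- s)\<close>, so the potential bound caps the total mass.\<close>

lemma capacity_measure_le:
  assumes \<mu>: "\<mu> \<in> capacity_measures s H" and x: "x \<notin> H" and s: "0 < s" and \<rho>: "0 < \<rho>"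
    and far: "\<And>y. y \<in> H \<Longrightarrow> norm (x - y) \<le> \<rho>"
  shows "emeasure \<mu> H \<le> ennreal (\<rho> powr s)"
proof -
  have sets: "sets \<mu> = sets (restrict_space borel H)" using \<mu> by (simp add: capacity_measures_def)
  have sp: "space \<mu> = H" using sets_eq_imp_space_eq[OF sets] by (simp add: space_restrict_space)
  have "ennreal (1 / \<rho> powr s) * emeasure \<mu> H = (\<integral>\<^sup>+y. ennreal (1 / \<rho> powr s) \<partial>\<mu>)"
    by (simp add: sp)
  also have "\<dots> \<le> (\<integral>\<^sup>+y. ennreal (1 / norm (x - y) powr s) \<partial>\<mu>)"
  proof (rule nn_integral_mono)
    fix y assume "y \<in> space \<mu>"
    then have y: "y \<in> H" by (simp add: sp)
    then have "0 < norm (x - y)" using x by auto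
    moreover have "norm (x - y) powr s \<le> \<rho> powr s"
      using far[OF y] s by (intro powr_mono2) auto
    ultimately show "ennreal (1 / \<rho> powr s) \<le> ennreal (1 / norm (x - y) powr s)"
      by (intro ennreal_leI divide_left_mono) (auto intro!: mult_pos_pos simp: \<rho>)
  qed
  also have "\<dots> \<le> 1" using \<mu> x by (simp add: capacity_measures_def)
  finally have le: "ennreal (1 / \<rho> powr s) * emeasure \<mu> H \<le> 1" .
  have "emeasure \<mu> H = ennreal (\<rho> powr s * (1 / \<rho> powr s)) * emeasure \<mu> H" using \<rho> by simp
  also have "\<dots> = ennreal (\<rho> powr s) * (ennreal (1 / \<rho> powr s) * emeasure \<mu> H)"
    by (subst ennreal_mult) (auto simp: mult.assoc)
  also have "\<dots> \<le> ennreal (\<rho> powr s) * 1" using le by (intro mult_left_mono) auto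
  finally show ?thesis by simp
qed

lemma capacity_le:
  assumes "x \<notin> H" "0 < s" "0 < \<rho>" "\<And>y. y \<in> H \<Longrightarrow> norm (x - y) \<le> \<rho>"
  shows "capacity s H \<le> ennreal (\<rho> powr s)"
  unfolding capacity_def by (intro SUP_least capacity_measure_le[OF _ assms])

text \<open>Restricting \<^term>\<open>\<mu>\<close> to a small piece of the ball keeps its potential at most 1 in the domain, although
  possibly not at the remaining points of the carrier of \<^term>\<open>\<mu>\<close>; only the domain matters.\<close>

lemma (in oblique_subsolution) first_ball_estimate:
  fixes Q :: "nat \<Rightarrow> (real^'n) set"
  assumes R: "0 < R" and \<theta>: "0 < \<theta>" and \<sigma>: "0 < \<sigma>" and s: "0 < s" "e1 - 2 \<le> s"
    and Q: "\<And>i. Q i \<in> sets borel" "disjoint_family Q" "ball 0 \<theta> \<subseteq> (\<Union>i<n0. Q i)"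
      "\<And>i x y. x \<in> Q i \<Longrightarrow> y \<in> Q i \<Longrightarrow> dist x y < \<sigma>"
    and n: "0 < n" "4 * \<theta> / \<sigma> \<le> real n"
    and region: "\<And>p. p \<in> ball \<xi> (\<theta> * R) \<Longrightarrow> 0 \<notin> cball p (4 * (\<sigma> * R)) \<and> \<Gamma>2 \<inter> cball p (4 * (\<sigma> * R)) = {}"
    and \<mu>: "\<mu> \<in> capacity_measures s (ball \<xi> (\<theta> * R) \<inter> \<Gamma>1)" and x: "x \<in> \<Omega> \<inter> ball \<xi> (\<theta> * R)"
  shows "M * (((2 * \<sigma>) powr (- s) - (3 * \<sigma>) powr (- s)) / 2 * growth_factor e1 (1/4) 1 2 ^ n / (real n0 + 1))
      * R powr (- s) * measure \<mu> (ball \<xi> (\<theta> * R) \<inter> \<Gamma>1) \<le> M - u x"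
    and "emeasure \<mu> (ball \<xi> (\<theta> * R) \<inter> \<Gamma>1) < \<infinity>"
proof -
  let ?F = "growth_factor e1 (1/4) 1 2"
  define H where "H = ball \<xi> (\<theta> * R) \<inter> \<Gamma>1"
  define r where "r = \<sigma> * R"
  have r: "0 < r" using \<sigma> R by (simp add: r_def)
  have \<mu>H: "sets \<mu> = sets (restrict_space borel H)" "\<mu> \<in> capacity_measures s H"
    and pot: "\<And>x. x \<notin> H \<Longrightarrow> (\<integral>\<^sup>+y. ennreal (1 / norm (x - y) powr s) \<partial>\<mu>) \<le> 1"
    using \<mu> by (auto simp: capacity_measures_def H_def)
  have sp: "space \<mu> = H" using sets_eq_imp_space_eq[OF \<mu>H(1)] by (simp add: space_restrict_space)
  have "0 \<notin> H" using region r unfolding H_def r_def[symmetric] by fastforce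
  then have "emeasure \<mu> H \<le> ennreal ((norm \<xi> + \<theta> * R) powr s)"
  proof (rule capacity_measure_le[OF \<mu>H(2) _ s(1)])
    show "0 < norm \<xi> + \<theta> * R" using \<theta> R by (simp add: add_nonneg_pos)
    fix y assume "y \<in> H"
    then have "norm (y - \<xi>) < \<theta> * R" by (simp add: H_def dist_norm norm_minus_commute)
    then show "norm (0 - y) \<le> norm \<xi> + \<theta> * R" using norm_triangle_sub[of y \<xi>] by simp
  qed
  then have fin: "emeasure \<mu> H < \<infinity>" using ennreal_less_top order_le_less_trans by (metis infinity_ennreal_def)
  then show "emeasure \<mu> (ball \<xi> (\<theta> * R) \<inter> \<Gamma>1) < \<infinity>" by (simp add: H_def)
  have \<Omega>H: "y \<notin> H" if "y \<in> \<Omega>" for y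
    using that front open_\<Omega> by (auto simp: H_def frontier_def interior_open)
  \<comment> \<open>A partition of the model ball of radius \<open>\<theta>\<close> is transported
    to the given ball, so the number \<open>n0\<close> of pieces depends neither on \<open>R\<close>
    nor on \<open>\<xi>\<close>.\<close>
  define P where "P = (\<lambda>i. H \<inter> (\<lambda>x. (1 / R) *\<^sub>R (x - \<xi>)) -` Q i)"
  have Pm: "P i \<in> sets \<mu>" for i
  proof -
    have "(\<lambda>x. (1 / R) *\<^sub>R (x - \<xi>)) \<in> borel_measurable borel" by measurable
    then have "(\<lambda>x. (1 / R) *\<^sub>R (x - \<xi>)) -` Q i \<in> sets borel"
      using measurable_sets_borel Q(1) by blast
    then show ?thesis unfolding \<mu>H(1) P_def by (auto simp: sets_restrict_space)
  qed
  have Pd: "P i \<inter> P j = {}" if "i \<noteq> j" for i j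
    using Q(2) that by (auto simp: P_def disjoint_family_on_def)
  have PH: "(\<Union>i<n0. P i) = H"
  proof (intro equalityI subsetI)
    fix y assume y: "y \<in> H"
    then have "norm (y - \<xi>) < \<theta> * R" by (simp add: H_def dist_norm norm_minus_commute)
    then have "(1 / R) *\<^sub>R (y - \<xi>) \<in> ball 0 \<theta>" using R by (simp add: divide_less_eq)
    then have "(1 / R) *\<^sub>R (y - \<xi>) \<in> (\<Union>i<n0. Q i)" using Q(3) by (rule subsetD[rotated])
    then show "y \<in> (\<Union>i<n0. P i)" using y by (auto simp: P_def)
  qed (auto simp: P_def)
  have finP: "emeasure \<mu> (P i) < \<infinity>" for i
  proof -
    have "H \<in> sets \<mu>" using sets.top[of \<mu>] by (simp add: sp)
    then have "emeasure \<mu> (P i) \<le> emeasure \<mu> H" by (intro emeasure_mono) (auto simp: P_def)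
    then show ?thesis using fin by (rule order_le_less_trans)
  qed
  define q where "q = ((2 * \<sigma>) powr (- s) - (3 * \<sigma>) powr (- s)) / 2 * R powr (- s)"
  have qr: "q = ((2 * r) powr (- s) - (3 * r) powr (- s)) / 2"
    by (simp add: q_def r_def powr_mult left_diff_distrib diff_divide_distrib)
  have q: "0 < q"
  proof -
    have "(3 * r) powr (- s) < (2 * r) powr (- s)" using r s by (intro powr_less_mono2_neg) auto
    then show ?thesis by (simp add: qr)
  qed
  have piece: "M * q * ?F ^ n * measure \<mu> (P i) \<le> M - u x" for i
  proof (cases "P i = {}")
    case True
    then show ?thesis using M x by simp
  next
    case False
    then obtain y0 where y0: "y0 \<in> P i" by blast
    have y0b: "y0 \<in> ball \<xi> (\<theta> * R)" "y0 \<in> \<Gamma>1" using y0 by (auto simp: P_def H_def)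
    have Psub: "P i \<subseteq> \<Gamma>1 \<inter> ball y0 r"
    proof
      fix y assume y: "y \<in> P i"
      then have "dist ((1 / R) *\<^sub>R (y0 - \<xi>)) ((1 / R) *\<^sub>R (y - \<xi>)) < \<sigma>" using y0 by (intro Q(4)[of _ i]) (auto simp: P_def)
      also have "dist ((1 / R) *\<^sub>R (y0 - \<xi>)) ((1 / R) *\<^sub>R (y - \<xi>)) = dist y0 y / R"
        using R by (simp add: dist_norm flip: scaleR_diff_right)
      finally show "y \<in> \<Gamma>1 \<inter> ball y0 r" using y R by (simp add: P_def H_def r_def divide_less_eq)
    qed
    define d where "d = M * (q * measure \<mu> (P i))"
    have start: "u y \<le> M - d" if y: "y \<in> \<Omega> \<inter> ball y0 r" for y
    proof -
      have "u y \<le> M * (1 - ((2 * r) powr (- s) - (3 * r) powr (- s)) * measure \<mu> (P i) / 2)"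
      proof (rule capacity_growth[OF r _ _ s \<mu>H(1) Pm Psub _ finP y])
        show "0 \<notin> cball y0 (4 * r)" "\<Gamma>2 \<inter> cball y0 (4 * r) = {}" using region[OF y0b(1)] by (auto simp: r_def)
        fix w assume w: "w \<in> \<Omega>"
        have "(\<integral>\<^sup>+y. ennreal (1 / norm (w - y) powr s) * indicator (P i) y \<partial>\<mu>)
            \<le> (\<integral>\<^sup>+y. ennreal (1 / norm (w - y) powr s) \<partial>\<mu>)"
          by (intro nn_integral_mono) (auto simp: indicator_def)
        also have "\<dots> \<le> 1" using pot \<Omega>H[OF w] by blast
        finally show "(\<integral>\<^sup>+y. ennreal (1 / norm (w - y) powr s) * indicator (P i) y \<partial>\<mu>) \<le> 1" .
      qed
      then show ?thesis by (simp add: d_def qr algebra_simps)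
    qed
    have d0: "0 \<le> d" using M_pos q by (simp add: d_def)
    \<comment> \<open>\<open>y0\<close> is a boundary point, so \<open>start\<close> applies at some
      point of \<open>\<Omega>\<close>; there \<open>u > 0\<close> forces \<open>d \<le> M\<close>,
      as \<open>growth_along_segment\<close> requires.\<close>
    have "y0 \<in> closure \<Omega>" using y0b(2) front by (auto simp: frontier_def)
    then obtain w where w: "w \<in> \<Omega>" "dist w y0 < r" using r unfolding closure_approachable by blast
    then have "0 < u w" "u w \<le> M - d" using pos start[of w] by (auto simp: dist_commute)
    then have dM: "d \<le> M" by simp
    have "u x \<le> M - d * ?F ^ n"
    proof (rule growth_along_segment[OF r n(1) _ _ d0 dM start])
      have "norm (x - y0) \<le> 2 * (\<theta> * R)"
        using x y0b(1) dist_triangle2[of x y0 \<xi>] by (simp add: dist_norm norm_minus_commute)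
      also have "\<dots> \<le> real n * (r / 2)"
        using n(2) \<sigma> R by (simp add: r_def divide_le_eq mult_ac)
      finally show "norm (x - y0) \<le> real n * (r / 2)" .
      show "x \<in> \<Omega> \<inter> ball x r" using x r by simp
      fix p assume "p \<in> closed_segment y0 x"
      then have "p \<in> ball \<xi> (\<theta> * R)" using closed_segment_subset[OF y0b(1) _ convex_ball] x by blast
      then have "0 \<notin> cball p (4 * r)" "\<Gamma>2 \<inter> cball p (4 * r) = {}" using region[of p] by (auto simp: r_def)
      moreover have "cball p (2 * r) \<subseteq> cball p (4 * r)" using r by auto
      ultimately show "0 \<notin> cball p (2 * r) \<and> \<Gamma>2 \<inter> cball p (2 * r) = {}" by blast
    qed
    then show ?thesis by (simp add: d_def mult_ac)
  qed
  have "M * q * ?F ^ n * measure \<mu> H = (\<Sum>i<n0. M * q * ?F ^ n * measure \<mu> (P i))"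
  proof -
    have "measure \<mu> (\<Union>i<n0. P i) = (\<Sum>i<n0. measure \<mu> (P i))"
      using Pm finP Pd by (intro measure_UNION') (auto simp: fmeasurable_def pairwise_def disjnt_def)
    then show ?thesis by (simp add: PH sum_distrib_left)
  qed
  \<comment> \<open>Every piece yields the same upper bound, so adding the pieces costs a factor
    \<open>n0\<close>; the added 1 in the next line keeps the divisor positive.\<close>
  also have "\<dots> \<le> (\<Sum>i<n0. M - u x)" by (intro sum_mono piece)
  also have "\<dots> \<le> (M - u x) * (real n0 + 1)" using M x by (simp add: algebra_simps)
  finally have "M * q * ?F ^ n * measure \<mu> H / (real n0 + 1) \<le> M - u x"
    by (simp add: divide_le_eq)
  then show "M * (((2 * \<sigma>) powr (- s) - (3 * \<sigma>) powr (- s)) / 2 * ?F ^ n / (real n0 + 1))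
      * R powr (- s) * measure \<mu> (ball \<xi> (\<theta> * R) \<inter> \<Gamma>1) \<le> M - u x"
    by (simp add: q_def H_def mult_ac)
qed

text \<open>The first claim follows from unit vectors by homogeneity. The second adds the inequality
  over the coordinate directions, where the form gives the diagonal entries; it forces
  \<open>e1 \<ge> 3\<close> and so \<open>s > 0\<close> in the theorem.\<close>

lemma elliptic_coeffs_imp_elliptic_matrix:
  fixes \<Omega> :: "(real^'n::finite) set"
  assumes A: "elliptic_coeffs \<Omega> A" "ellipticity_const \<Omega> A = ereal e1" and x: "x \<in> \<Omega>"
  shows "elliptic_matrix e1 (A x)" "real CARD('n) \<le> e1"
proof -
  have pd: "0 < v \<bullet> (A x *v v)" if "v \<noteq> 0" for v using A(1) x that by (simp add: elliptic_coeffs_def)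
  have "transpose (A x) = A x" using A(1) x by (simp add: elliptic_coeffs_def)
  then have sym: "A x $ i $ j = A x $ j $ i" for i j by (metis transpose_def vec_lambda_beta)
  have "0 \<le> v \<bullet> (A x *v v)" for v using pd[of v] by (cases "v = 0") auto
  then have psd: "psd (A x)" using sym by (simp add: psd_def)
  have diag: "A x $ i $ i = axis i 1 \<bullet> (A x *v axis i 1)" for i
    by (simp add: inner_axis' matrix_vector_mult_basis column_def)
  have dpos: "0 < A x $ i $ i" for i unfolding diag by (rule pd) (simp add: axis_eq_0_iff)
  have tr: "0 < trace (A x)" unfolding trace_def by (intro sum_pos dpos) auto
  have q: "trace (A x) * (v \<bullet> v) \<le> e1 * (v \<bullet> (A x *v v))" for v
  proof (cases "v = 0")
    case False
    define w where "w = (1 / norm v) *\<^sub>R v"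
    have w: "w \<in> sphere 0 1" "v = norm v *\<^sub>R w" using False by (auto simp: w_def)
    have "w \<noteq> 0" using w(1) by auto
    have "ereal (trace (A x) / (w \<bullet> (A x *v w))) \<le> ellipticity_const \<Omega> A"
      unfolding ellipticity_const_def using w(1) x by (intro SUP_upper2[of w] SUP_upper2[of x]) auto
    then have "trace (A x) / (w \<bullet> (A x *v w)) \<le> e1" by (simp add: A(2))
    then have "trace (A x) \<le> e1 * (w \<bullet> (A x *v w))" using pd[OF \<open>w \<noteq> 0\<close>] by (simp add: divide_le_eq)
    then have "(norm v)\<^sup>2 * trace (A x) \<le> (norm v)\<^sup>2 * (e1 * (w \<bullet> (A x *v w)))" by (intro mult_left_mono) auto
    moreover have "v \<bullet> (A x *v v) = (norm v)\<^sup>2 * (w \<bullet> (A x *v w))"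
      by (subst (1 2) w(2)) (simp add: matrix_vector_mult_scaleR power2_eq_square)
    ultimately show ?thesis by (simp add: dot_square_norm mult_ac)
  qed simp
  show "elliptic_matrix e1 (A x)" using psd tr q by (simp add: elliptic_matrix_def)
  have "real CARD('n) * trace (A x) = (\<Sum>i\<in>(UNIV::'n set). trace (A x))" by simp
  also have "\<dots> \<le> (\<Sum>i\<in>UNIV. e1 * A x $ i $ i)"
  proof (rule sum_mono)
    fix i show "trace (A x) \<le> e1 * A x $ i $ i" using q[of "axis i 1"] unfolding diag by (simp add: inner_axis)
  qed
  also have "\<dots> = e1 * trace (A x)" by (simp add: trace_def sum_distrib_left)
  finally show "real CARD('n) \<le> e1" using tr by simp
qed

text \<open>An edge of \<open>E\<close> says that the overlap contains the ball of radius
  \<open>\<delta> * R\<close> about the next centre, hence its core of radius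
  \<open>\<gamma> * (\<theta> * R)\<close>. From there \<open>ball_step\<close> spreads the bound
  over the whole next ball at the cost of the factor \<open>G\<close>.\<close>

lemma (in oblique_graph_subsolution) chain_estimate:
  fixes \<xi> :: "nat \<Rightarrow> real^'n"
  defines "E \<equiv> \<lambda>\<theta> \<delta> R N. {(i, j). i \<le> N \<and> j \<le> N \<and>
     ball (\<xi> j) (\<delta> * R) \<subseteq> ball (\<xi> i) (\<theta> * R) \<inter> ball (\<xi> j) (\<theta> * R) \<inter> \<Omega>}"
  assumes R: "0 < R" and \<theta>: "0 < \<theta>" and \<delta>: "0 < \<delta>"
    and \<gamma>: "0 < \<gamma>" "\<gamma> \<le> 1/2" "\<gamma> * \<theta> < \<delta>" and \<beta>: "0 < \<beta>" "\<beta> \<le> 1/4" "(6 + 4 * L) * (2 * \<beta>) \<le> \<zeta>"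
    and \<tau>: "0 < \<tau>" "\<tau> \<le> 1" "(1 + \<tau>)\<^sup>2 * (1 - (m / (1 + L))\<^sup>2 / (1 + m / (1 + L))\<^sup>2) \<le> 1"
    and ball: "\<And>j. j \<le> N \<Longrightarrow> ball (\<xi> j) ((1 + \<zeta>) * (\<theta> * R)) \<subseteq> ball 0 r0"
      "\<And>j. j \<le> N \<Longrightarrow> 0 \<notin> ball (\<xi> j) ((1 + \<zeta>) * (\<theta> * R))"
      "\<And>j. j \<le> N \<Longrightarrow> \<Gamma>2 \<inter> ball (\<xi> j) (\<theta> * R) = {}"
    and D: "0 \<le> D" and start: "\<And>x. x \<in> \<Omega> \<inter> ball (\<xi> 0) (\<theta> * R) \<Longrightarrow> u x \<le> M - D"
    and G: "G = growth_factor e1 \<gamma> (1 - \<beta>) (1 - \<beta> / 2) * growth_factor e1 (\<beta> / 2) (2 * \<beta>) ((1 + \<tau>) * (2 * \<beta>))" "0 \<le> G"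
    and path: "(0, j) \<in> E \<theta> \<delta> R N ^^ n" and x: "x \<in> \<Omega> \<inter> ball (\<xi> j) (\<theta> * R)"
  shows "u x \<le> M - D * G ^ n"
  using path x
proof (induction n arbitrary: j x)
  case 0
  then show ?case using start by simp
next
  case (Suc n)
  obtain i where i: "(0, i) \<in> E \<theta> \<delta> R N ^^ n" "(i, j) \<in> E \<theta> \<delta> R N" using Suc.prems(1) by (auto simp: relcomp_unfold)
  have jN: "j \<le> N" and sub: "ball (\<xi> j) (\<delta> * R) \<subseteq> ball (\<xi> i) (\<theta> * R) \<inter> ball (\<xi> j) (\<theta> * R) \<inter> \<Omega>"
    using i(2) by (auto simp: E_def)
  have "\<xi> j \<in> ball (\<xi> j) (\<delta> * R)" using \<delta> R by simp
  then have \<xi>j: "\<xi> j \<in> \<Omega> \<inter> ball (\<xi> i) (\<theta> * R)" using sub by blast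
  \<comment> \<open>The centre lies in \<open>\<Omega>\<close>, where \<open>u > 0\<close>; this
    yields \<open>D * G ^ n \<le> M\<close>, a hypothesis of the next
    \<open>ball_step\<close>.\<close>
  have "u (\<xi> j) \<le> M - D * G ^ n" by (rule Suc.IH[OF i(1) \<xi>j])
  then have DM: "D * G ^ n \<le> M" using pos[of "\<xi> j"] \<xi>j by auto
  have "u x \<le> M - D * G ^ n * G"
    unfolding G(1)
  proof (rule ball_step[OF _ \<gamma>(1,2) \<beta> ball(1,2)[OF jN] \<tau> ball(3)[OF jN]])
    show "0 < \<theta> * R" using \<theta> R by simp
    show "x \<in> \<Omega> \<inter> ball (\<xi> j) (\<theta> * R)" by (rule Suc.prems(2))
    show "0 \<le> D * (growth_factor e1 \<gamma> (1 - \<beta>) (1 - \<beta> / 2) * growth_factor e1 (\<beta> / 2) (2 * \<beta>) ((1 + \<tau>) * (2 * \<beta>))) ^ n"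
      using D G by simp
    show "D * (growth_factor e1 \<gamma> (1 - \<beta>) (1 - \<beta> / 2) * growth_factor e1 (\<beta> / 2) (2 * \<beta>) ((1 + \<tau>) * (2 * \<beta>))) ^ n \<le> M"
      using DM G(1) by simp
    fix y assume y: "y \<in> \<Omega> \<inter> cball (\<xi> j) (\<gamma> * (\<theta> * R))"
    have "\<gamma> * \<theta> * R < \<delta> * R" using \<gamma>(3) R by (rule mult_strict_right_mono)
    then have "y \<in> ball (\<xi> j) (\<delta> * R)" using y by (simp add: mult.assoc)
    then have "y \<in> \<Omega> \<inter> ball (\<xi> i) (\<theta> * R)" using sub by blast
    from Suc.IH[OF i(1) this]
    show "u y \<le> M - D * (growth_factor e1 \<gamma> (1 - \<beta>) (1 - \<beta> / 2) * growth_factor e1 (\<beta> / 2) (2 * \<beta>) ((1 + \<tau>) * (2 * \<beta>))) ^ n"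
      using G(1) by simp
  qed
  then show ?case by (simp add: mult_ac)
qed

lemma path_in_rtrancl:
  assumes "\<And>i. i < m \<Longrightarrow> (p i, p (Suc i)) \<in> E"
  shows "(p 0, p m) \<in> E\<^sup>*"
  using assms by (induction m) (auto intro: rtrancl_into_rtrancl)

text \<open>Otherwise the point dividing the segment from 0 to \<open>\<xi>\<close> in the ratio
  \<open>z : 1\<close> would lie both in the original ball and in \<open>ball 0 q\<close>.\<close>

lemma zero_notin_enlarged_ball:
  fixes \<xi> :: "real^'n::finite"
  assumes "ball \<xi> r \<inter> ball 0 q = {}" "0 < r" "0 < q" "0 \<le> z" "z * r \<le> q"
  shows "0 \<notin> ball \<xi> ((1 + z) * r)"
proof
  assume "0 \<in> ball \<xi> ((1 + z) * r)"
  then have n: "norm \<xi> < (1 + z) * r" by (simp add: dist_norm)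
  define w where "w = (z / (1 + z)) *\<^sub>R \<xi>"
  have "1 / (1 + z) + z / (1 + z) = 1" using assms(4) by (simp add: add_divide_distrib[symmetric])
  then have "\<xi> = (1 / (1 + z)) *\<^sub>R \<xi> + w" by (metis scaleR_add_left scaleR_one w_def)
  then have "\<xi> - w = (1 / (1 + z)) *\<^sub>R \<xi>" by (metis add_diff_cancel_right')
  then have "norm (\<xi> - w) = norm \<xi> / (1 + z)" using assms(4) by simp
  also have "\<dots> < r" using n assms(4) by (simp add: divide_less_eq mult.commute)
  finally have 1: "w \<in> ball \<xi> r" by (simp add: dist_norm)
  have "norm w < q"
  proof (cases "z = 0")
    case False
    have "norm w = z * (norm \<xi> / (1 + z))" using assms(4) by (simp add: w_def)
    also have "\<dots> < z * r" using n assms(4) False by (intro mult_strict_left_mono) (auto simp: divide_less_eq mult.commute)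
    finally show ?thesis using assms(5) by simp
  qed (use assms(3) in \<open>simp add: w_def\<close>)
  then show False using 1 assms(1) by auto
qed

text \<open>An infinite supremum makes the claim trivial, so it suffices to treat real upper bounds
  \<open>M\<close>, and boundedness of \<open>u\<close> never has to be shown.\<close>

lemma SUP_ereal_le_divide:
  fixes u :: "'a \<Rightarrow> real"
  assumes c: "c < 1" and le: "\<And>M x. (\<And>y. y \<in> \<Omega> \<Longrightarrow> u y \<le> M) \<Longrightarrow> x \<in> S \<Longrightarrow> u x \<le> M * (1 - c)" and ne: "\<Omega> \<noteq> {}"
  shows "(SUP x\<in>S. ereal (u x)) / (1 - ereal c) \<le> (SUP x\<in>\<Omega>. ereal (u x))"
proof (cases "SUP x\<in>\<Omega>. ereal (u x)")
  case (real M)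
  have "u y \<le> M" if "y \<in> \<Omega>" for y
    using SUP_upper[OF that, of "\<lambda>x. ereal (u x)"] real by simp
  then have "(SUP x\<in>S. ereal (u x)) \<le> ereal (M * (1 - c))"
    by (intro SUP_least) (simp add: le)
  then have "(SUP x\<in>S. ereal (u x)) / ereal (1 - c) \<le> ereal (M * (1 - c)) / ereal (1 - c)"
    using c by (intro ereal_divide_right_mono) auto
  also have "\<dots> = ereal M" using c by simp
  finally show ?thesis using real by (simp add: one_ereal_def)
next
  case MInf
  obtain y where "y \<in> \<Omega>" using ne by blast
  then have "ereal (u y) \<le> - \<infinity>" using SUP_upper[of y \<Omega> "\<lambda>x. ereal (u x)"] MInf by simp
  then show ?thesis by simp
qed simp

text \<open>With \<open>q\<close> the subtracted quotient, \<open>\<tau> = q / 3\<close> works: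
  \<open>q \<le> 1\<close> gives \<open>(1 + q / 3)\<^sup>2 \<le> 1 + q\<close>, and
  \<open>(1 + q) * (1 - q) \<le> 1\<close>.\<close>

lemma cone_margin:
  fixes \<sigma> :: real
  assumes "0 < \<sigma>"
  obtains \<tau> where "0 < \<tau>" "\<tau> \<le> 1" "(1 + \<tau>)\<^sup>2 * (1 - \<sigma>\<^sup>2 / (1 + \<sigma>)\<^sup>2) \<le> 1"
proof -
  define q where "q = \<sigma>\<^sup>2 / (1 + \<sigma>)\<^sup>2"
  have "\<sigma>\<^sup>2 \<le> (1 + \<sigma>)\<^sup>2" using assms by (intro power_mono) auto
  then have q: "0 < q" "q \<le> 1" using assms by (auto simp: q_def)
  have "(1 + q / 3)\<^sup>2 \<le> 1 + q"
  proof -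
    have "q * q \<le> q * 1" using q by (intro mult_left_mono) auto
    moreover have "(1 + q / 3)\<^sup>2 = 1 + 2 / 3 * q + q * q / 9" by (simp add: power2_eq_square algebra_simps)
    ultimately show ?thesis using q by linarith
  qed
  then have "(1 + q / 3)\<^sup>2 * (1 - q) \<le> (1 + q) * (1 - q)" using q by (intro mult_right_mono) auto
  also have "\<dots> \<le> 1" by (simp add: algebra_simps)
  finally show ?thesis using q that[of "q / 3"] by (simp add: q_def)
qed

theorem lemma4p2:
  fixes k :: "'n::finite"
    and l :: "real^'n \<Rightarrow> real^'n"
    and s e1 L \<epsilon> a q1 q2 qs q3 q4 \<theta> \<kappa> \<delta> :: real
    and N :: nat
  assumes "CARD('n) \<ge> 3"
    and "s \<ge> e1 - 2"
    and "L \<ge> 0" and "\<epsilon> > 0"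
    and "a > 1" and "oblique_growth_const k L \<epsilon> e1 a"
    and "0 < q1" and "q1 < q2" and "q2 < qs" and "qs < q3" and "q3 < q4"
    and "\<theta> > 0" and "\<kappa> > 0" and "0 < \<delta>" and "\<delta> < 1/2"
  shows "\<exists>\<eta>>0. \<forall>(\<Omega> :: (real^'n) set) \<Gamma>1 \<Gamma>2 A r0 f R \<xi> u.
           bounded_domain \<Omega> \<longrightarrow>
           frontier \<Omega> = \<Gamma>1 \<union> {0} \<union> \<Gamma>2 \<longrightarrow> closure \<Gamma>1 \<inter> closure \<Gamma>2 = {0} \<longrightarrow>
           elliptic_coeffs \<Omega> A \<longrightarrow> ellipticity_const \<Omega> A = ereal e1 \<longrightarrow>
           r0 > 0 \<longrightarrow> L-lipschitz_on {y. y $ k = 0} f \<longrightarrow>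
           \<Gamma>2 \<inter> ball 0 r0 \<subseteq> {x. x $ k = f (horiz k x)} \<longrightarrow>
           \<Omega> \<inter> ball 0 r0 \<subseteq> {x. x $ k < f (horiz k x)} \<longrightarrow>
           oblique_field k L \<epsilon> \<Omega> \<Gamma>2 l \<longrightarrow>
           sub_elliptic \<Omega> \<Gamma>2 A u \<longrightarrow> continuous_on (\<Omega> \<union> \<Gamma>1 \<union> \<Gamma>2) u \<longrightarrow>
           (\<forall>x\<in>\<Omega>. u x > 0) \<longrightarrow> (\<forall>x\<in>\<Gamma>1. u x \<le> 0) \<longrightarrow> oblique_deriv_le_0 \<Gamma>2 l u \<longrightarrow>
           R > 0 \<longrightarrow> admissible_with s a q2 qs q3 \<theta> \<kappa> \<delta> N \<xi> \<Omega> \<Gamma>1 \<Gamma>2 R \<longrightarrow>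
           layer q1 q4 R \<subseteq> ball 0 r0 \<longrightarrow>
           (\<forall>j\<le>N. ball (\<xi> j) ((a + 2) * \<theta> * R) \<subseteq> ball 0 r0) \<longrightarrow>
           (let H = \<Gamma>1 \<inter> layer q2 q3 R;
                S = frontier (ball 0 (qs * R)) \<inter> \<Omega>;
                c = ereal \<eta> * enn2ereal (capacity s H) * ereal (R powr (- s))
            in c < 1 \<and>
               (SUP x\<in>\<Omega>. ereal (u x)) \<ge> (SUP x\<in>S. ereal (u x)) / (1 - c))"
proof (cases "e1 < 3")
  case True
  \<comment> \<open>Since \<open>e1\<close> is at least the dimension, no domain and operator
    satisfy the hypotheses in this case, and any positive constant serves.\<close>
  have "False" if dom: "bounded_domain \<Omega>" and ell: "elliptic_coeffs \<Omega> A" "ellipticity_const \<Omega> A = ereal e1" for \<Omega> :: "(real^'n) set" and A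
  proof -
    obtain x where "x \<in> \<Omega>" using dom by (auto simp: bounded_domain_def)
    then have "real CARD('n) \<le> e1" by (rule elliptic_coeffs_imp_elliptic_matrix(2)[OF ell])
    then show False using True assms(1) by simp
  qed
  then show ?thesis by (intro exI[of _ 1]) auto
next
  case False

  \<comment> \<open>Constants fixed before the domain\<close>
  then have e1: "0 < e1" and s: "0 < s" "e1 - 2 \<le> s" using assms(2) by auto
  obtain m where m: "0 < m" and cone: "\<And>v :: real^'n. norm v = 1 \<Longrightarrow> vec_angle v (axis k 1) \<le> arccot L - \<epsilon> \<Longrightarrow> m + L * norm (horiz k v) \<le> v $ k"
    using oblique_cone[OF assms(3,4)] by blast
  have "0 < m / (1 + L)" using m assms(3) by simp
  then obtain \<tau> where \<tau>: "0 < \<tau>" "\<tau> \<le> 1" "(1 + \<tau>)\<^sup>2 * (1 - (m / (1 + L))\<^sup>2 / (1 + m / (1 + L))\<^sup>2) \<le> 1"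
    by (rule cone_margin)
  have q2: "0 < q2" "0 < q3" using assms by auto
  have \<theta>: "0 < \<theta>" by fact
  \<comment> \<open>The balls enlarged by the factor \<open>1 + \<zeta>\<close> must stay within
    radius \<open>(a + 2) * \<theta> * R\<close>, hence \<open>\<zeta> \<le> 1\<close>, and must
    miss 0, hence \<open>\<zeta> * \<theta> \<le> q2\<close>.\<close>
  define \<zeta> where "\<zeta> = min 1 (q2 / \<theta>)"
  have \<zeta>: "0 < \<zeta>" "\<zeta> \<le> 1" "\<zeta> * \<theta> \<le> q2" using q2 \<theta> by (auto simp: \<zeta>_def min_def field_simps)
  define \<beta> where "\<beta> = min (1/4) (\<zeta> / (2 * (6 + 4 * L)))"
  have \<beta>: "0 < \<beta>" "\<beta> \<le> 1/4" "(6 + 4 * L) * (2 * \<beta>) \<le> \<zeta>"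
  proof -
    have L6: "0 < 6 + 4 * L" using assms(3) by simp
    then show "0 < \<beta>" using \<zeta> by (simp add: \<beta>_def)
    show "\<beta> \<le> 1/4" unfolding \<beta>_def by (rule min.cobounded1)
    have "(6 + 4 * L) * (2 * \<beta>) \<le> (6 + 4 * L) * (2 * (\<zeta> / (2 * (6 + 4 * L))))"
      using L6 by (intro mult_left_mono) (auto simp: \<beta>_def)
    also have "\<dots> = \<zeta>"
    proof -
      have "w * (2 * (\<zeta> / (2 * w))) = \<zeta>" if "0 < w" for w using that by simp
      from this[OF L6] show ?thesis .
    qed
    finally show "(6 + 4 * L) * (2 * \<beta>) \<le> \<zeta>" .
  qed
  \<comment> \<open>Makes the closed core of radius \<open>\<gamma> * \<theta> * R\<close> fit into
    the overlap ball of radius \<open>\<delta> * R\<close>.\<close>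
  define \<gamma> where "\<gamma> = min (1/2) (\<delta> / (2 * \<theta>))"
  have \<gamma>: "0 < \<gamma>" "\<gamma> \<le> 1/2" "\<gamma> * \<theta> < \<delta>"
  proof -
    show "0 < \<gamma>" using \<theta> \<open>0 < \<delta>\<close> by (simp add: \<gamma>_def)
    show "\<gamma> \<le> 1/2" unfolding \<gamma>_def by (rule min.cobounded1)
    have "\<gamma> * \<theta> \<le> \<delta> / (2 * \<theta>) * \<theta>" using \<theta> by (intro mult_right_mono) (auto simp: \<gamma>_def)
    then show "\<gamma> * \<theta> < \<delta>" using \<theta> \<open>0 < \<delta>\<close> by simp
  qed
  define G where "G = growth_factor e1 \<gamma> (1 - \<beta>) (1 - \<beta> / 2) * growth_factor e1 (\<beta> / 2) (2 * \<beta>) ((1 + \<tau>) * (2 * \<beta>))"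
  have G: "0 < G" "G \<le> 1"
  proof -
    have "2 * \<beta> < (1 + \<tau>) * (2 * \<beta>)" using \<tau>(1) \<beta>(1) by (simp add: distrib_right)
    then have F': "0 < growth_factor e1 (\<beta> / 2) (2 * \<beta>) ((1 + \<tau>) * (2 * \<beta>))" "growth_factor e1 (\<beta> / 2) (2 * \<beta>) ((1 + \<tau>) * (2 * \<beta>)) < 1"
      using growth_factor_bounds[of e1 "\<beta> / 2" "2 * \<beta>" "(1 + \<tau>) * (2 * \<beta>)"] e1 \<beta>(1) by auto
    have F: "0 < growth_factor e1 \<gamma> (1 - \<beta>) (1 - \<beta> / 2)" "growth_factor e1 \<gamma> (1 - \<beta>) (1 - \<beta> / 2) < 1"
      using growth_factor_bounds[of e1 \<gamma> "1 - \<beta>" "1 - \<beta> / 2"] e1 \<gamma> \<beta> by auto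
    show "0 < G" "G \<le> 1" using F F' by (auto simp: G_def intro!: mult_le_one)
  qed
  \<comment> \<open>Balls of radius \<open>4 * \<sigma> * R\<close> about points of the first ball
    stay in \<open>ball (\<xi> 0) (a * \<theta> * R)\<close>, which misses \<open>\<Gamma>2\<close>,
    and avoid 0 because the layer begins at radius \<open>q2 * R\<close>.\<close>
  define \<sigma> where "\<sigma> = min ((a - 1) * \<theta> / 8) (q2 / 8)"
  have \<sigma>: "0 < \<sigma>" "4 * \<sigma> < (a - 1) * \<theta>" "4 * \<sigma> < q2"
  proof -
    have "0 < (a - 1) * \<theta>" using \<theta> \<open>1 < a\<close> by simp
    then show "0 < \<sigma>" "4 * \<sigma> < (a - 1) * \<theta>" "4 * \<sigma> < q2" using q2 by (auto simp: \<sigma>_def)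
  qed
  obtain n0 :: nat and Q :: "nat \<Rightarrow> (real^'n) set" where Q: "\<And>i. Q i \<in> sets borel" "disjoint_family Q" "ball 0 \<theta> \<subseteq> (\<Union>i<n0. Q i)"
      "\<And>i x y. x \<in> Q i \<Longrightarrow> y \<in> Q i \<Longrightarrow> dist x y < \<sigma>"
    by (rule finite_borel_partition[OF bounded_ball[of "0 :: real^'n" \<theta>] \<sigma>(1)]) blast
  define n where "n = Suc (nat \<lceil>4 * \<theta> / \<sigma>\<rceil>)"
  have n: "0 < n" "4 * \<theta> / \<sigma> \<le> real n" by (auto simp: n_def) linarith
  define c0 where "c0 = ((2 * \<sigma>) powr (- s) - (3 * \<sigma>) powr (- s)) / 2 * growth_factor e1 (1/4) 1 2 ^ n / (real n0 + 1)"
  have c0: "0 < c0"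
  proof -
    have "(3 * \<sigma>) powr (- s) < (2 * \<sigma>) powr (- s)" using \<sigma> s by (intro powr_less_mono2_neg) auto
    moreover have "0 < growth_factor e1 (1/4) 1 2" using growth_factor_bounds[of e1 "1/4" 1 2] e1 by auto
    ultimately show ?thesis by (simp add: c0_def)
  qed
  \<comment> \<open>One factor \<open>G\<close> for each of at most \<open>Suc N * Suc N\<close>
    links, \<open>c0\<close> for the capacity comparison in the first ball, and
    \<open>\<kappa>\<close> for the share of the capacity found there.\<close>
  define \<eta>' where "\<eta>' = G ^ (Suc N * Suc N) * c0 * \<kappa>"
  have \<eta>': "0 < \<eta>'" using G c0 \<open>0 < \<kappa>\<close> by (simp add: \<eta>'_def)
  \<comment> \<open>The second entry keeps the denominator positive: the capacity is at most
    \<open>(q3 * R) powr s\<close>, so \<open>c\<close> is at most 1/2.\<close>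
  define \<eta> where "\<eta> = min \<eta>' (q3 powr (- s) / 2)"
  have \<eta>: "0 < \<eta>" "\<eta> \<le> \<eta>'" "\<eta> * q3 powr s < 1"
  proof -
    show "0 < \<eta>" "\<eta> \<le> \<eta>'" using \<eta>' q2 by (auto simp: \<eta>_def)
    have "\<eta> * q3 powr s \<le> q3 powr (- s) / 2 * q3 powr s" by (intro mult_right_mono) (auto simp: \<eta>_def)
    also have "\<dots> < 1" using q2 by (simp add: powr_minus)
    finally show "\<eta> * q3 powr s < 1" .
  qed
  show ?thesis
  proof (intro exI[of _ \<eta>] conjI \<eta>(1) allI impI)
    fix \<Omega> \<Gamma>1 \<Gamma>2 :: "(real^'n) set" and A r0 f R and \<xi> :: "nat \<Rightarrow> real^'n" and u
    assume dom: "bounded_domain \<Omega>" and front: "frontier \<Omega> = \<Gamma>1 \<union> {0} \<union> \<Gamma>2" and sep: "closure \<Gamma>1 \<inter> closure \<Gamma>2 = {0}"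
      and ell: "elliptic_coeffs \<Omega> A" "ellipticity_const \<Omega> A = ereal e1"
      and lip: "L-lipschitz_on {y. y $ k = 0} f" and graph: "\<Gamma>2 \<inter> ball 0 r0 \<subseteq> {x. x $ k = f (horiz k x)}"
      and below: "\<Omega> \<inter> ball 0 r0 \<subseteq> {x. x $ k < f (horiz k x)}" and field: "oblique_field k L \<epsilon> \<Omega> \<Gamma>2 l"
      and sub: "sub_elliptic \<Omega> \<Gamma>2 A u" and cont: "continuous_on (\<Omega> \<union> \<Gamma>1 \<union> \<Gamma>2) u"
      and pos: "\<forall>x\<in>\<Omega>. u x > 0" and neg: "\<forall>x\<in>\<Gamma>1. u x \<le> 0" and obl: "oblique_deriv_le_0 \<Gamma>2 l u"
      and R: "R > 0" and adm: "admissible_with s a q2 qs q3 \<theta> \<kappa> \<delta> N \<xi> \<Omega> \<Gamma>1 \<Gamma>2 R"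
      and balls: "\<forall>j\<le>N. ball (\<xi> j) ((a + 2) * \<theta> * R) \<subseteq> ball 0 r0"

    \<comment> \<open>The given layer: its balls, paths and capacity\<close>
    define H where "H = \<Gamma>1 \<inter> layer q2 q3 R"
    define S where "S = frontier (ball 0 (qs * R)) \<inter> \<Omega>"
    define H0 where "H0 = ball (\<xi> 0) (\<theta> * R) \<inter> \<Gamma>1"
    define E where "E = {(i, j). i \<le> N \<and> j \<le> N \<and> ball (\<xi> j) (\<delta> * R) \<subseteq> ball (\<xi> i) (\<theta> * R) \<inter> ball (\<xi> j) (\<theta> * R) \<inter> \<Omega>}"
    have \<theta>R: "0 < \<theta> * R" using \<theta> R by simp
    have lay: "ball (\<xi> j) (\<theta> * R) \<subseteq> layer q2 q3 R" if "j \<le> N" for j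
      using adm that by (simp add: admissible_with_def)
    have capH0: "ennreal \<kappa> * capacity s H \<le> capacity s H0" using adm by (simp add: admissible_with_def H_def H0_def)
    have a0: "ball (\<xi> 0) (a * \<theta> * R) \<inter> \<Gamma>2 = {}" using adm by (simp add: admissible_with_def)
    have \<Gamma>2b: "\<Gamma>2 \<inter> ball (\<xi> j) (\<theta> * R) = {}" if "j \<le> N" for j
    proof (cases "j = 0")
      case True
      have "1 * (\<theta> * R) \<le> a * (\<theta> * R)" using \<open>1 < a\<close> \<theta>R by (intro mult_right_mono) auto
      then have "ball (\<xi> 0) (\<theta> * R) \<subseteq> ball (\<xi> 0) (a * \<theta> * R)" by (intro subset_ball) (simp only: mult_1 mult.assoc)
      then show ?thesis using a0 True by blast
    next
      case False
      then have "j \<in> {1..N}" using that by simp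
      then show ?thesis using adm unfolding admissible_with_def by blast
    qed
    \<comment> \<open>Paths in the definition of admissibility may be arbitrarily long; in the
      transitive closure of a finite relation a path with at most \<open>card E\<close> links always
      suffices.\<close>
    have paths: "\<exists>i\<le>Suc N * Suc N. (0, j) \<in> E ^^ i" if j: "j \<le> N" for j
    proof -
      obtain mm p where p: "p (0::nat) = 0" "p mm = j" "\<forall>i\<le>mm. p i \<le> N"
        "\<forall>i<mm. ball (\<xi> (p (Suc i))) (\<delta> * R) \<subseteq>
           ball (\<xi> (p i)) (\<theta> * R) \<inter> ball (\<xi> (p (Suc i))) (\<theta> * R) \<inter> \<Omega>"
        using adm j unfolding admissible_with_def by blast
      have "(p 0, p mm) \<in> E\<^sup>*"
        by (rule path_in_rtrancl) (use p(3,4) in \<open>simp add: E_def\<close>)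
      then have star: "(0, j) \<in> E\<^sup>*" using p by simp
      have sub: "E \<subseteq> {..N} \<times> {..N}" by (auto simp: E_def)
      then have fin: "finite E" by (rule finite_subset) simp
      have "card E \<le> card ({..N} \<times> {..N})" using sub by (intro card_mono) auto
      also have "\<dots> = Suc N * Suc N" by (simp add: card_cartesian_product)
      finally have "card E \<le> Suc N * Suc N" .
      moreover obtain i where "i \<le> card E" "(0, j) \<in> E ^^ i"
        using star unfolding rtrancl_finite_eq_relpow[OF fin] by blast
      ultimately show ?thesis using order_trans by blast
    qed
    have cov: "S \<subseteq> (\<Union>j\<le>N. ball (\<xi> j) (\<theta> * R))" using adm by (simp add: admissible_with_def S_def)
    have "capacity s H \<le> ennreal ((q3 * R) powr s)"
    proof (rule capacity_le[OF _ s(1)])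
      show "0 \<notin> H" using q2 R by (simp add: H_def layer_def)
      show "0 < q3 * R" using q2 R by simp
      show "norm (0 - y) \<le> q3 * R" if "y \<in> H" for y using that by (simp add: H_def layer_def)
    qed
    then obtain C where C: "0 \<le> C" "capacity s H = ennreal C" "C \<le> (q3 * R) powr s"
      by (cases "capacity s H") (auto simp: top_unique)
    define c where "c = \<eta> * C * R powr (- s)"
    have RR: "R powr s * R powr (- s) = 1" using R by (simp add: powr_minus)
    have c1: "c < 1"
    proof -
      have "c \<le> \<eta> * (q3 * R) powr s * R powr (- s)"
        unfolding c_def using C \<eta> by (intro mult_right_mono mult_left_mono) auto
      also have "\<dots> = \<eta> * q3 powr s * (R powr s * R powr (- s))" using q2 R by (simp add: powr_mult)
      also have "\<dots> < 1" using \<eta>(3) by (simp only: RR)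
      finally show ?thesis .
    qed

    \<comment> \<open>The estimate on the sphere for one upper bound\<close>
    have main: "u x \<le> M * (1 - c)" if M: "\<And>y. y \<in> \<Omega> \<Longrightarrow> u y \<le> M" and xS: "x \<in> S" for M x
    proof -
      have fieldE: "norm (l y) = 1" "vec_angle (l y) (axis k 1) \<le> arccot L - \<epsilon>" "\<forall>\<^sub>F t in at_right 0. y - t *\<^sub>R l y \<in> \<Omega>"
        if "y \<in> \<Gamma>2" for y using field that by (auto simp: oblique_field_def)
      interpret oblique_graph_subsolution \<Omega> \<Gamma>1 \<Gamma>2 A l u e1 M k L r0 f m
      proof unfold_locales
        show "open \<Omega>" using dom by (simp add: bounded_domain_def)
        show "elliptic_matrix e1 (A y)" if "y \<in> \<Omega>" for y
          by (rule elliptic_coeffs_imp_elliptic_matrix(1)[OF ell that])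
      qed (use dom front e1 fieldE sub cont pos neg obl M sep lip graph below m cone in auto)
      obtain j where j: "j \<le> N" "x \<in> ball (\<xi> j) (\<theta> * R)" using cov xS by blast
      have x\<Omega>: "x \<in> \<Omega>" using xS by (simp add: S_def)
      define D where "D = M * c0 * R powr (- s) * (\<kappa> * C)"
      have q: "0 < M * c0 * R powr (- s)" using M_pos c0 R by simp
      have D0: "0 \<le> D" using q C(1) \<open>0 < \<kappa>\<close> by (simp add: D_def)
      have region: "0 \<notin> cball p (4 * (\<sigma> * R)) \<and> \<Gamma>2 \<inter> cball p (4 * (\<sigma> * R)) = {}" if p: "p \<in> ball (\<xi> 0) (\<theta> * R)" for p
      proof
        have "p \<in> layer q2 q3 R" using lay[of 0] p by blast
        then have "q2 * R \<le> norm p" by (simp add: layer_def)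
        moreover have "4 * \<sigma> * R < q2 * R" using \<sigma>(3) R by (rule mult_strict_right_mono)
        ultimately show "0 \<notin> cball p (4 * (\<sigma> * R))" by simp
        have "cball p (4 * (\<sigma> * R)) \<subseteq> ball (\<xi> 0) (a * \<theta> * R)"
        proof
          fix y assume y: "y \<in> cball p (4 * (\<sigma> * R))"
          have "4 * \<sigma> * R < (a - 1) * \<theta> * R" using \<sigma>(2) R by (rule mult_strict_right_mono)
          then have "dist (\<xi> 0) y < \<theta> * R + (a - 1) * \<theta> * R"
            using y p dist_triangle[of "\<xi> 0" y p] by simp
          then show "y \<in> ball (\<xi> 0) (a * \<theta> * R)" by (simp add: algebra_simps)
        qed
        then show "\<Gamma>2 \<inter> cball p (4 * (\<sigma> * R)) = {}" using a0 by blast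
      qed
      have first: "u y \<le> M - D" if y: "y \<in> \<Omega> \<inter> ball (\<xi> 0) (\<theta> * R)" for y
      proof -
        \<comment> \<open>\<open>T\<close> bounds the mass of every admissible measure on
          \<open>H0\<close>, hence the capacity of \<open>H0\<close> and with it
          \<open>\<kappa> * C\<close>; solving for \<open>u y\<close> gives the claim.\<close>
        define T where "T = (M - u y) / (M * c0 * R powr (- s))"
        have T: "0 \<le> T" using M y q by (simp add: T_def)
        have "capacity s H0 \<le> ennreal T"
          unfolding capacity_def
        proof (rule SUP_least)
          fix \<mu> assume "\<mu> \<in> capacity_measures s H0"
          then have \<mu>: "\<mu> \<in> capacity_measures s (ball (\<xi> 0) (\<theta> * R) \<inter> \<Gamma>1)" by (simp add: H0_def)
          note est = first_ball_estimate[OF R \<theta> \<sigma>(1) s Q n region \<mu> y]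
          have "M * c0 * R powr (- s) * measure \<mu> H0 \<le> M - u y"
            using est(1) by (simp add: c0_def H0_def)
          then have "measure \<mu> H0 \<le> T" unfolding T_def using q by (simp add: pos_le_divide_eq mult_ac)
          moreover have "emeasure \<mu> H0 = ennreal (measure \<mu> H0)"
            using est(2) by (intro emeasure_eq_ennreal_measure) (simp add: H0_def less_top)
          ultimately show "emeasure \<mu> H0 \<le> ennreal T" by (simp add: ennreal_leI)
        qed
        then have "ennreal (\<kappa> * C) \<le> ennreal T"
          using capH0 C \<open>0 < \<kappa>\<close> by (simp add: ennreal_mult)
        then have "\<kappa> * C \<le> T" using T by (simp add: ennreal_le_iff)
        then have "M * c0 * R powr (- s) * (\<kappa> * C) \<le> M * c0 * R powr (- s) * T"
          using q by (intro mult_left_mono) auto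
        also have "\<dots> = M - u y"
          unfolding T_def using less_imp_neq[OF q] by (metis nonzero_mult_div_cancel_left times_divide_eq_right)
        finally show ?thesis by (simp add: D_def)
      qed
      obtain i where i: "i \<le> Suc N * Suc N" "(0, j) \<in> E ^^ i" using paths[OF j(1)] by blast
      have "u x \<le> M - D * G ^ i"
      proof (rule chain_estimate[OF R \<theta> \<open>0 < \<delta>\<close> \<gamma> \<beta> \<tau> _ _ \<Gamma>2b D0 first G_def])
        show "0 \<le> G" using G by simp
        show "x \<in> \<Omega> \<inter> ball (\<xi> j) (\<theta> * R)" using x\<Omega> j(2) by simp
        show "(0, j) \<in> {(i, j). i \<le> N \<and> j \<le> N \<and> ball (\<xi> j) (\<delta> * R) \<subseteq> ball (\<xi> i) (\<theta> * R) \<inter> ball (\<xi> j) (\<theta> * R) \<inter> \<Omega>} ^^ i"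
          using i(2) by (simp add: E_def)
        fix j assume jN: "j \<le> N"
        have "(1 + \<zeta>) * (\<theta> * R) \<le> (a + 2) * (\<theta> * R)" using \<zeta>(2) \<open>1 < a\<close> \<theta>R by (intro mult_right_mono) auto
        then have "ball (\<xi> j) ((1 + \<zeta>) * (\<theta> * R)) \<subseteq> ball (\<xi> j) ((a + 2) * \<theta> * R)" by (intro subset_ball) (simp add: mult.assoc)
        then show "ball (\<xi> j) ((1 + \<zeta>) * (\<theta> * R)) \<subseteq> ball 0 r0" using balls jN by blast
        show "0 \<notin> ball (\<xi> j) ((1 + \<zeta>) * (\<theta> * R))"
        proof (rule zero_notin_enlarged_ball)
          show "ball (\<xi> j) (\<theta> * R) \<inter> ball 0 (q2 * R) = {}" using lay[OF jN] by (auto simp: layer_def)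
          have "\<zeta> * \<theta> * R \<le> q2 * R" using \<zeta>(3) R by (intro mult_right_mono) auto
          then show "\<zeta> * (\<theta> * R) \<le> q2 * R" by (simp add: mult.assoc)
        qed (use \<theta>R q2 R \<zeta> in auto)
      qed
      also have "\<dots> \<le> M * (1 - c)"
      proof -
        have "M * c \<le> M * (\<eta>' * C * R powr (- s))"
          unfolding c_def using M_pos \<eta>(2) C(1) by (intro mult_left_mono mult_right_mono) auto
        also have "\<dots> = D * G ^ (Suc N * Suc N)" by (simp add: D_def \<eta>'_def mult_ac)
        also have "\<dots> \<le> D * G ^ i" using D0 G i(1) by (intro mult_left_mono power_decreasing) auto
        finally show ?thesis by (simp add: right_diff_distrib)
      qed
      finally show ?thesis .
    qed
    have ne: "\<Omega> \<noteq> {}" using dom by (simp add: bounded_domain_def)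
    have ceq: "ereal \<eta> * enn2ereal (capacity s H) * ereal (R powr (- s)) = ereal c"
      using C by (simp add: c_def)
    have "ereal c < 1" using c1 by simp
    moreover have "(SUP x\<in>S. ereal (u x)) / (1 - ereal c) \<le> (SUP x\<in>\<Omega>. ereal (u x))"
      by (rule SUP_ereal_le_divide[OF c1 main ne])
    ultimately show "let H = \<Gamma>1 \<inter> layer q2 q3 R;
                S = frontier (ball 0 (qs * R)) \<inter> \<Omega>;
                c = ereal \<eta> * enn2ereal (capacity s H) * ereal (R powr (- s))
            in c < 1 \<and>
               (SUP x\<in>\<Omega>. ereal (u x)) \<ge> (SUP x\<in>S. ereal (u x)) / (1 - c)"
      unfolding Let_def H_def[symmetric] S_def[symmetric] ceq by simp
  qed
qed

end
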